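(* Let $d_1,d_2>0$ satisfy $d_2>2d_1$ and $d_2>2\sqrt{d_1(d_2-d_1)}$, let $x_2>0$, and let $d(x)=d_1$ for $x<x_2$ and $d(x)=d_2$ for $x\ge x_2$. Let $A$ and $a$ be real numbers such that (i) $a,A>1$; (ii) $a\sqrt A<\frac12\Big[1+\frac{d_2}{2\sqrt{d_1(d_2-d_1)}}\Big]$. Put $$t_0=x_2\frac{\sqrt{2(d_2-d_1)}}{d_2},\qquad t_1=\frac{1}{2\sqrt{2d_1}}\big(x_2+\sqrt{2d_1}\,t_0\big),\qquad x_1=\sqrt{2d_1}\,t_1 .$$ Then for any smooth increasing function $\overline c(x)$ such that $$d(x)<\overline c(x)<A\,d(ax)\qquad\text{for all }x\in\mathbb{R},$$ the wavefront corresponding to $\overline c$ has jumps. In particular, the excitation reaches the region $\{x>\frac{x_1}{a}+\rho\}$ before it reaches the point $\frac{x_1}{a}$, for every small enough $\rho>0$: there exist a time $s>0$ and a point $x>\frac{x_1}{a}+\rho$ such that $\lim_{\delta\downarrow0}u^{\delta}(s,x)=1$, while $\lim_{\delta\downarrow0}u^{\delta}(t,\frac{x_1}{a})=0$ for all $0<t\le s$.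
   Context: For $\delta>0$, $u^{\delta}(t,x)$ is the solution of $$u^{\delta}_t=\frac{\delta}{2}u^{\delta}_{xx}+\frac{\delta}{2}\frac{V_x(x)}{V(x)}u^{\delta}_x+\frac1\delta\,\overline c(x,u^{\delta})u^{\delta}\ \text{in }(0,\infty)\times\mathbb{R},\qquad u^{\delta}(0,x)=f(x)\ge0 .$$ Here $V(x)$ is the volume and $S(x)$ the boundary surface area of the cross-section $D_x\subset\mathbb{R}^m$ of a smooth tube $D=\{(x,y):x\in\mathbb{R},\ y\in D_x\}$ (each $D_x$ a bounded domain with smooth boundary, homeomorphic to a ball and containing $0$). The nonlinearity is $\overline c(x,u)=\frac12\frac{S(x)}{V(x)}c(x,0,u)$, with $\overline c(x)=\overline c(x,0)$. The coefficient $c$ is uniformly bounded, continuous in $x,y$, Lipschitz continuous in $u$, with $c(\cdot,\cdot,u)<-M$ for $u>N$ for some $M,N>0$, and is of K-P-P type: $c(x,0,u)>0$ for $u<1$, $c(x,0,u)<0$ for $u>1$, $c(x,0,0)=\max_{0\le u\le1}c(x,0,u)$. The boundary $\partial D$ is of class $\mathcal{C}^{3+a'}$ for some $a'\in(0,1)$, with inward unit normal three times differentiable and never parallel to the $x$-axis. The initial function $f$ is bounded, non-negative, with at most finitely many simple discontinuities, and its support is the half-line $F_o=\{x<0\}$ (up to closure). A point $x$ is regarded as excited at time $t$ if $\lim_{\delta\downarrow0}u^{\delta}(t,x)=1$ and as non-excited if this limit is $0$; the wavefront is the interface between these two regions. It has a jump if, at some time, excitation appears at points ahead of a point that has not yet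 been excited. (The function $u^\delta$ is the limit as $\epsilon\downarrow0$ of the rescaled solution of the heat equation with nonlinear boundary condition in the slowly changing tube of width $\epsilon$.) *)

theory Defs
  imports "HOL-Analysis.Analysis"
begin

section \<open>Hausdorff measure\<close>

text \<open>
  The \<open>s\<close>-dimensional Hausdorff measure for integer \<open>s\<close>, normalised so that it agrees with
  Lebesgue measure on \<open>s\<close>-dimensional planes. The exponent is a natural number, so that for
  \<open>s = 0\<close> a singleton has weight \<open>0 ^ 0 = 1\<close> (with \<^const>\<open>powr\<close> it would be \<open>0\<close>) and
  counting measure results. The covering sets are required to be bounded because
  \<^const>\<open>diameter\<close> is unspecified on unbounded sets.
\<close>

definition hausdorff_weight :: "nat \<Rightarrow> 'a::metric_space set \<Rightarrow> real" where
  "hausdorff_weight s A = (if A = {} then 0 else unit_ball_vol (real s) * (diameter A / 2) ^ s)"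

definition hausdorff_premeasure :: "nat \<Rightarrow> real \<Rightarrow> 'a::metric_space set \<Rightarrow> ennreal" where
  "hausdorff_premeasure s \<eta> A =
     (INF U \<in> {U :: nat \<Rightarrow> 'a set. A \<subseteq> (\<Union>i. U i) \<and> (\<forall>i. bounded (U i) \<and> diameter (U i) \<le> \<eta>)}.
        \<Sum>i. ennreal (hausdorff_weight s (U i)))"

definition hausdorff_measure :: "nat \<Rightarrow> 'a::metric_space set \<Rightarrow> ennreal" where
  "hausdorff_measure s A = (SUP \<eta> \<in> {0<..}. hausdorff_premeasure s \<eta> A)"


section \<open>Higher regularity and smooth boundaries\<close>

text \<open>
  \<open>times_differentiable_on P k U g\<close>: all partial (directional) derivatives of \<open>g\<close> of order
  less than \<open>k\<close> are Frechet differentiable at the points of \<open>U\<close>, and the derivatives of order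
  \<open>k\<close> satisfy \<open>P\<close>.
\<close>

primrec times_differentiable_on ::
  "(('a::euclidean_space \<Rightarrow> 'b::euclidean_space) \<Rightarrow> bool) \<Rightarrow> nat \<Rightarrow> 'a set \<Rightarrow> ('a \<Rightarrow> 'b) \<Rightarrow> bool"
where
  "times_differentiable_on P 0 U g \<longleftrightarrow> P g"
| "times_differentiable_on P (Suc k) U g \<longleftrightarrow>
     (\<forall>p\<in>U. g differentiable (at p)) \<and>
     (\<forall>v. times_differentiable_on P k U (\<lambda>p. frechet_derivative g (at p) v))"

definition holder_on :: "real \<Rightarrow> 'a::metric_space set \<Rightarrow> ('a \<Rightarrow> 'b::metric_space) \<Rightarrow> bool" where
  "holder_on \<alpha> U g \<longleftrightarrow> (\<exists>K. \<forall>p\<in>U. \<forall>q\<in>U. dist (g p) (g q) \<le> K * dist p q powr \<alpha>)"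

definition C_holder_on ::
  "nat \<Rightarrow> real \<Rightarrow> 'a::euclidean_space set \<Rightarrow> ('a \<Rightarrow> 'b::euclidean_space) \<Rightarrow> bool" where
  "C_holder_on k \<alpha> U g \<longleftrightarrow> times_differentiable_on (holder_on \<alpha> U) k U g"

text \<open>
  The boundary of \<open>D\<close> is of class \<open>C\<^sup>k\<^sup>+\<^sup>\<alpha>\<close>: near each boundary point, \<open>D\<close> is the side
  \<open>{\<phi> > 0}\<close> of a regular level set of a \<open>C\<^sup>k\<^sup>+\<^sup>\<alpha>\<close> function.
\<close>

definition boundary_of_class :: "nat \<Rightarrow> real \<Rightarrow> 'a::euclidean_space set \<Rightarrow> bool" where
  "boundary_of_class k \<alpha> D \<longleftrightarrow>
     (\<forall>p\<in>frontier D. \<exists>U (\<phi> :: 'a \<Rightarrow> real).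
        open U \<and> p \<in> U \<and> C_holder_on k \<alpha> U \<phi> \<and>
        (\<forall>q\<in>U. frechet_derivative \<phi> (at q) \<noteq> (\<lambda>_. 0)) \<and>
        D \<inter> U = {q\<in>U. \<phi> q > 0})"

definition inward_unit_normal :: "'a::euclidean_space set \<Rightarrow> 'a \<Rightarrow> 'a \<Rightarrow> bool" where
  "inward_unit_normal D p \<nu> \<longleftrightarrow> norm \<nu> = 1 \<and>
     (\<forall>v. v \<bullet> \<nu> > 0 \<longrightarrow> (\<forall>\<^sub>F h in at_right 0. p + h *\<^sub>R v \<in> D)) \<and>
     (\<forall>v. v \<bullet> \<nu> < 0 \<longrightarrow> (\<forall>\<^sub>F h in at_right 0. p + h *\<^sub>R v \<notin> D))"

text \<open>
  A function given on \<open>\<partial>D\<close> is \<open>k\<close> times differentiable if locally it is the restriction of a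
  \<open>k\<close> times differentiable function of the ambient space.
\<close>

definition normal_times_differentiable :: "nat \<Rightarrow> 'a::euclidean_space set \<Rightarrow> bool" where
  "normal_times_differentiable k D \<longleftrightarrow>
     (\<forall>p\<in>frontier D. \<exists>U (n :: 'a \<Rightarrow> 'a).
        open U \<and> p \<in> U \<and> times_differentiable_on (\<lambda>_. True) k U n \<and>
        (\<forall>q \<in> U \<inter> frontier D. inward_unit_normal D q (n q)))"


section \<open>The tube\<close>

text \<open>A tube is given by its cross-sections \<open>Q x\<close>.\<close>

definition tube :: "(real \<Rightarrow> (real ^ 'm) set) \<Rightarrow> (real \<times> (real ^ 'm)) set" where
  "tube Q = (SIGMA x:UNIV. Q x)"

definition smooth_tube :: "real \<Rightarrow> (real \<Rightarrow> (real ^ 'm) set) \<Rightarrow> bool" where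
  "smooth_tube \<alpha> Q \<longleftrightarrow>
     (\<forall>x. open (Q x) \<and> connected (Q x) \<and> bounded (Q x) \<and> 0 \<in> Q x \<and>
          Q x homeomorphic ball (0 :: real ^ 'm) 1 \<and> boundary_of_class 3 \<alpha> (Q x)) \<and>
     boundary_of_class 3 \<alpha> (tube Q) \<and>
     normal_times_differentiable 3 (tube Q) \<and>
     (\<forall>p \<in> frontier (tube Q). \<forall>\<nu>. inward_unit_normal (tube Q) p \<nu> \<longrightarrow> snd \<nu> \<noteq> 0)"

definition cross_volume :: "(real \<Rightarrow> (real ^ 'm) set) \<Rightarrow> real \<Rightarrow> real" where
  "cross_volume Q x = measure lebesgue (Q x)"

definition cross_surface :: "(real \<Rightarrow> (real ^ 'm) set) \<Rightarrow> real \<Rightarrow> real" where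
  "cross_surface Q x = enn2real (hausdorff_measure (CARD('m) - 1) (frontier (Q x)))"


section \<open>The nonlinearity and the initial function\<close>

text \<open>\<open>c x y u\<close> only matters for \<open>(x, y)\<close> in the closed tube and \<open>u \<ge> 0\<close>.\<close>

definition kpp_coefficient ::
  "(real \<Rightarrow> (real ^ 'm) set) \<Rightarrow> (real \<Rightarrow> real ^ 'm \<Rightarrow> real \<Rightarrow> real) \<Rightarrow> bool" where
  "kpp_coefficient Q c \<longleftrightarrow>
     (\<exists>K. \<forall>(x, y) \<in> closure (tube Q). \<forall>u\<ge>0. \<bar>c x y u\<bar> \<le> K) \<and>
     (\<forall>u\<ge>0. continuous_on (closure (tube Q)) (\<lambda>(x, y). c x y u)) \<and>
     (\<exists>L. \<forall>(x, y) \<in> closure (tube Q). L-lipschitz_on {0..} (c x y)) \<and>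
     (\<exists>M>0. \<exists>N>0. \<forall>(x, y) \<in> closure (tube Q). \<forall>u>N. c x y u < - M) \<and>
     (\<forall>x. (\<forall>u. 0 \<le> u \<and> u < 1 \<longrightarrow> c x 0 u > 0) \<and>
          (\<forall>u>1. c x 0 u < 0) \<and>
          (\<forall>u\<in>{0..1}. c x 0 u \<le> c x 0 0))"

definition cbar2 ::
  "(real \<Rightarrow> (real ^ 'm) set) \<Rightarrow> (real \<Rightarrow> real ^ 'm \<Rightarrow> real \<Rightarrow> real) \<Rightarrow> real \<Rightarrow> real \<Rightarrow> real" where
  "cbar2 Q c x u = 1 / 2 * (cross_surface Q x / cross_volume Q x) * c x 0 u"

definition cbar ::
  "(real \<Rightarrow> (real ^ 'm) set) \<Rightarrow> (real \<Rightarrow> real ^ 'm \<Rightarrow> real \<Rightarrow> real) \<Rightarrow> real \<Rightarrow> real" where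
  "cbar Q c x = cbar2 Q c x 0"

definition smooth :: "(real \<Rightarrow> real) \<Rightarrow> bool" where
  "smooth g \<longleftrightarrow> (\<forall>k x. (deriv ^^ k) g differentiable (at x))"

definition initial_function :: "(real \<Rightarrow> real) \<Rightarrow> bool" where
  "initial_function f \<longleftrightarrow>
     (\<forall>x. 0 \<le> f x) \<and> bdd_above (range f) \<and>
     finite {x. \<not> isCont f x} \<and>
     (\<forall>x. (\<exists>l. (f \<longlongrightarrow> l) (at_left x)) \<and> (\<exists>r. (f \<longlongrightarrow> r) (at_right x))) \<and>
     closure {x. f x > 0} = closure {x. x < 0}"


section \<open>The Cauchy problem\<close>

text \<open>
  Classical (\<open>C\<^sup>1\<^sup>,\<^sup>2\<close> for \<open>t > 0\<close>) bounded solutions, where the initial value is attained at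
  the continuity points of \<open>f\<close>. The bound \<open>max 1 (sup f)\<close> is the one of the maximum principle
  (the nonlinearity is negative for \<open>u > 1\<close>). It has to be part of the notion of
  solution: nothing is assumed on the growth of \<open>V\<^sub>x / V\<close> at infinity, so the
  diffusion on the line may explode, and then there are further bounded solutions, with
  arbitrarily large bounds, that are fed in from infinity.
\<close>

definition cauchy_solution ::
  "real \<Rightarrow> (real \<Rightarrow> real) \<Rightarrow> (real \<Rightarrow> real \<Rightarrow> real) \<Rightarrow> (real \<Rightarrow> real) \<Rightarrow> (real \<Rightarrow> real \<Rightarrow> real) \<Rightarrow> bool"
where
  "cauchy_solution \<delta> V g f u \<longleftrightarrow>
     (\<forall>t\<ge>0. \<forall>x. 0 \<le> u t x \<and> u t x \<le> max 1 (SUP z. f z)) \<and>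
     (\<forall>x. u 0 x = f x) \<and>
     (\<forall>x. isCont f x \<longrightarrow>
        ((\<lambda>(t, z). u t z) \<longlongrightarrow> f x) (at (0, x) within {0<..} \<times> UNIV)) \<and>
     (\<forall>t>0. \<forall>x. (\<lambda>s. u s x) differentiable (at t) \<and> u t differentiable (at x) \<and>
        deriv (u t) differentiable (at x)) \<and>
     continuous_on ({0<..} \<times> UNIV) (\<lambda>(t, x). u t x) \<and>
     continuous_on ({0<..} \<times> UNIV) (\<lambda>(t, x). deriv (\<lambda>s. u s x) t) \<and>
     continuous_on ({0<..} \<times> UNIV) (\<lambda>(t, x). deriv (u t) x) \<and>
     continuous_on ({0<..} \<times> UNIV) (\<lambda>(t, x). deriv (deriv (u t)) x) \<and>
     (\<forall>t>0. \<forall>x. deriv (\<lambda>s. u s x) t =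
        \<delta> / 2 * deriv (deriv (u t)) x + \<delta> / 2 * (deriv V x / V x) * deriv (u t) x
        + 1 / \<delta> * g x (u t x) * u t x)"


section \<open>Excitation and jumps of the wavefront\<close>

definition excited :: "(real \<Rightarrow> real \<Rightarrow> real \<Rightarrow> real) \<Rightarrow> real \<Rightarrow> real \<Rightarrow> bool" where
  "excited u t x \<longleftrightarrow> ((\<lambda>\<delta>. u \<delta> t x) \<longlongrightarrow> 1) (at_right 0)"

definition non_excited :: "(real \<Rightarrow> real \<Rightarrow> real \<Rightarrow> real) \<Rightarrow> real \<Rightarrow> real \<Rightarrow> bool" where
  "non_excited u t x \<longleftrightarrow> ((\<lambda>\<delta>. u \<delta> t x) \<longlongrightarrow> 0) (at_right 0)"

text \<open>The front moves to the right, so \<open>ahead of p\<close> means \<open>x > p\<close>.\<close>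

definition wavefront_has_jump :: "(real \<Rightarrow> real \<Rightarrow> real \<Rightarrow> real) \<Rightarrow> bool" where
  "wavefront_has_jump u \<longleftrightarrow>
     (\<exists>s>0. \<exists>p x. p < x \<and> excited u s x \<and> (\<forall>t. 0 < t \<and> t \<le> s \<longrightarrow> non_excited u t p))"

end

theory Submission
  imports Defs
begin

text \<open>
  The proof compares the solutions with explicit barriers. On the scale \<open>u = exp (W / \<delta>)\<close> the
  equation becomes, up to terms of order \<open>\<delta>\<close>, the Hamilton-Jacobi equation
  \<open>W\<^sub>t = W\<^sub>x\<^sup>2 / 2 + c\<close> with \<open>c\<close> the growth rate at \<open>u = 0\<close>, and for a constant rate \<open>c\<close> this has
  the affine solutions \<open>W = \<alpha> t + p x + k\<close> with \<open>\<alpha> = p\<^sup>2 / 2 + c\<close>. All exponential barriers below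
  are sums of a few functions \<open>exp (W / \<delta>)\<close> of this form, with a small slack in the equation that
  absorbs the drift \<open>V\<^sub>x / V\<close>. It suffices for this that the drift is bounded on compact sets.

  The drift is locally bounded because the volume \<open>V\<close> of the cross-sections is locally Lipschitz and locally
  bounded away from \<open>0\<close>: as the normal of the tube is never parallel to the axis, the set of points
  that enter or leave a cross-section between two positions \<open>x\<close> and \<open>x'\<close> is a layer of thickness
  \<open>O(\<bar>x - x'\<bar>)\<close> around the boundary.

  \<^emph>\<open>The point \<open>x2\<close> is excited at time \<open>t0\<close>.\<close> Since \<open>cbar > d\<close>, the excitation can be
  followed along a path that runs from the origin to \<open>x2\<close> with speed \<open>\<nu> = sqrt (2 (d2 - d1))\<close> and
  then stays there. On the way the amplitude decays at the exponential rate \<open>d2 - 2 d1\<close>, for the time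
  \<open>x2 / \<nu>\<close>; at \<open>x2\<close> it grows at a rate slightly larger than \<open>d2\<close>. The time \<open>t0\<close> is the one at which
  growth at the rate \<open>d2\<close> exactly makes up for the loss, so with the larger rate the amplitude is of
  order one strictly before \<open>t0\<close>. Until then the bump is kept so small that the nonlinear rate differs
  little from the one at \<open>u = 0\<close>. The remaining time is long in comparison with \<open>\<delta>\<close> and is enough to
  reach any level below \<open>1\<close>. A travelling bump that is positive only in a short interval makes this
  precise (\<open>bump_propagation\<close>, \<open>arrival_at_interface\<close>, \<open>growth_in_place\<close>, \<open>excited_at_interface\<close>).
  Values above \<open>1\<close> are consumed by the reaction in a time of order \<open>\<delta>\<close>
  (\<open>eventually_below_one_plus\<close>).

  \<^emph>\<open>The point \<open>x1 / a\<close> is not excited up to time \<open>t0\<close>.\<close> Since \<open>cbar x < A d (a x)\<close>, two waves can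
  reach this point: the one that starts at the origin and moves with speed \<open>sqrt (2 A d1)\<close>, and the
  one that is sent back with the same speed from \<open>x2 / a\<close>, but only after the rate \<open>A d2\<close> has brought
  \<open>x2 / a\<close> to order one. Up to that time the solution at \<open>x2 / a\<close> is estimated by the linear equation;
  afterwards it is bounded by a constant. The linear equation alone gives too large a bound in
  general, because its solution goes on growing at \<open>x2 / a\<close>. The two waves meet at \<open>x1 / a\<close>, at the time
  \<open>t1 / (a sqrt A)\<close> (\<open>below_at_interface\<close>, \<open>not_excited_before_the_fronts_meet\<close>).

  The hypothesis on \<open>a sqrt A\<close> says precisely that \<open>t0 < t1 / (a sqrt A)\<close>, and \<open>x1 / a < x1 < x2\<close>. So
  at time \<open>t0\<close> the point \<open>x2\<close> is excited while \<open>x1 / a\<close>, which lies closer to the origin, has never been.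
\<close>

section \<open>Variation of the cross-sections\<close>

text \<open>
  The translates of \<open>S\<close> by multiples of \<open>\<tau> e\<close> are pairwise disjoint, and about \<open>1 / \<tau>\<close> of them fit
  into one fixed ball. This plays the part of Fubini's theorem along the lines in direction \<open>e\<close>.
\<close>
lemma measure_thin_set_le:
  fixes e y0 :: "'a::euclidean_space"
  assumes S: "S \<in> sets lebesgue" "S \<subseteq> ball y0 \<rho>" and "\<tau> > 0"
    and thin: "\<And>y s. y \<in> S \<Longrightarrow> s \<ge> \<tau> \<Longrightarrow> y + s *\<^sub>R e \<notin> S"
  shows "measure lebesgue S \<le> 2 * measure lebesgue (ball y0 (\<rho> + norm e)) * \<tau>"
proof -
  define C where "C = measure lebesgue (ball y0 (\<rho> + norm e))"
  define N where "N = nat \<lfloor>1 / \<tau>\<rfloor>"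
  have Sm: "S \<in> lmeasurable"
    using S by (meson bounded_ball bounded_set_imp_lmeasurable bounded_subset)
  have sub: "(\<lambda>y. (real j * \<tau>) *\<^sub>R e + y) ` S \<subseteq> ball y0 (\<rho> + norm e)" if "real j * \<tau> \<le> 1" for j
  proof
    fix x assume "x \<in> (\<lambda>y. (real j * \<tau>) *\<^sub>R e + y) ` S"
    then obtain y where y: "y \<in> S" "x = (real j * \<tau>) *\<^sub>R e + y" by auto
    have "norm ((real j * \<tau>) *\<^sub>R e) \<le> norm e"
      using that \<open>\<tau> > 0\<close> by (simp add: mult_left_le_one_le)
    moreover have "dist y0 x \<le> dist y0 y + norm ((real j * \<tau>) *\<^sub>R e)"
      unfolding y(2) dist_norm by (metis norm_triangle_ineq4 diff_add_eq_diff_diff_swap)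
    moreover have "dist y0 y < \<rho>" using S y by auto
    ultimately show "x \<in> ball y0 (\<rho> + norm e)" by simp
  qed
  have S_le_C: "measure lebesgue S \<le> C"
    unfolding C_def using sub[of 0] by (intro measure_mono_fmeasurable) (use S in auto)
  have N_le: "real j * \<tau> \<le> 1" if "j < N" for j
  proof -
    have "real j \<le> 1 / \<tau>" using that \<open>\<tau> > 0\<close> unfolding N_def by linarith
    then show ?thesis using \<open>\<tau> > 0\<close> by (simp add: field_simps)
  qed
  have disj: "disjoint_family_on (\<lambda>j. (\<lambda>y. (real j * \<tau>) *\<^sub>R e + y) ` S) {..<N}"
  proof -
    have *: False if "i < j" "y \<in> S" "y' \<in> S"
      "(real i * \<tau>) *\<^sub>R e + y = (real j * \<tau>) *\<^sub>R e + y'" for i j y y'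
    proof -
      have eq: "y = y' + ((real j - real i) * \<tau>) *\<^sub>R e"
        using that(4) by (simp add: algebra_simps)
      have "1 \<le> real j - real i" using that(1) by linarith
      then have "(real j - real i) * \<tau> \<ge> \<tau>"
        using \<open>\<tau> > 0\<close> by (simp add: mult_le_cancel_right1)
      from thin[OF that(3) this] eq that(2) show False by simp
    qed
    show ?thesis unfolding disjoint_family_on_def
      by (auto, metis * linorder_neqE_nat)
  qed
  have "real N * measure lebesgue S = (\<Sum>j<N. measure lebesgue ((\<lambda>y. (real j * \<tau>) *\<^sub>R e + y) ` S))"
    by (simp add: measure_translation)
  also have "\<dots> = measure lebesgue (\<Union>j<N. (\<lambda>y. (real j * \<tau>) *\<^sub>R e + y) ` S)"
    by (intro measure_finite_Union[symmetric] disj)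
       (use Sm fmeasurableD2[OF measurable_translation[OF Sm]] in
         \<open>auto intro!: fmeasurableD measurable_translation\<close>)
  also have "\<dots> \<le> C"
    unfolding C_def using sub N_le
    by (intro measure_mono_fmeasurable) (use Sm in \<open>auto intro!: sets.finite_UN fmeasurableD measurable_translation\<close>)
  finally have NC: "real N * measure lebesgue S \<le> C" .
  have "C \<ge> 0" unfolding C_def by simp
  show ?thesis
  proof (cases "\<tau> \<le> 1")
    case True
    have "1 / \<tau> \<ge> 1" using True \<open>\<tau> > 0\<close> by simp
    moreover have "y \<le> 2 * real (nat \<lfloor>y\<rfloor>)" if "y \<ge> 1" for y :: real
    proof -
      have "1 \<le> \<lfloor>y\<rfloor>" using that by simp
      moreover have "y < real_of_int \<lfloor>y\<rfloor> + 1" by (simp add: floor_correct)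
      ultimately show ?thesis by linarith
    qed
    ultimately have "1 / \<tau> \<le> 2 * real N" unfolding N_def by blast
    then have "1 \<le> 2 * real N * \<tau>" using \<open>\<tau> > 0\<close> by (simp add: field_simps)
    then have "1 * measure lebesgue S \<le> (2 * real N * \<tau>) * measure lebesgue S"
      by (intro mult_right_mono) auto
    also have "\<dots> = 2 * \<tau> * (real N * measure lebesgue S)" by simp
    also have "\<dots> \<le> 2 * \<tau> * C" using NC \<open>\<tau> > 0\<close> by (intro mult_left_mono) auto
    finally show ?thesis unfolding C_def by (simp add: mult_ac)
  next
    case False
    then have "C * 1 \<le> C * (2 * \<tau>)" using \<open>C \<ge> 0\<close> by (intro mult_left_mono) auto
    then show ?thesis using S_le_C unfolding C_def by (simp add: mult_ac)
  qed
qed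

lemma boundary_of_class_Int_frontier:
  assumes "boundary_of_class k \<alpha> D" "k > 0"
  shows "D \<inter> frontier D = {}"
proof -
  have False if p: "p \<in> D" "p \<in> frontier D" for p
  proof -
    obtain U and \<phi> :: "'a \<Rightarrow> real" where U: "open U" "p \<in> U" "C_holder_on k \<alpha> U \<phi>"
      "D \<inter> U = {q\<in>U. \<phi> q > 0}"
      using assms(1) p(2) unfolding boundary_of_class_def by blast
    have "\<phi> differentiable (at q)" if "q \<in> U" for q
      using U(3) \<open>k > 0\<close> that unfolding C_holder_on_def by (cases k) auto
    then have "continuous_on U \<phi>"
      by (metis continuous_at_imp_continuous_on differentiable_imp_continuous_within)
    then have "open {q\<in>U. \<phi> q > 0}"
      using continuous_open_preimage[of U \<phi> "{0<..}"] U(1) by (simp add: vimage_def Int_def conj_commute)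
    then have "open (D \<inter> U)" using U(4) by simp
    then have "p \<in> interior D" using p(1) U(2) by (meson IntI Int_lower1 interiorI)
    then show False using p(2) by (simp add: frontier_def)
  qed
  then show ?thesis by auto
qed

lemma has_real_derivative_along_line:
  fixes \<phi> :: "'a::real_normed_vector \<Rightarrow> real"
  assumes "(\<phi> has_derivative F) (at (q + h *\<^sub>R v))"
  shows "((\<lambda>h. \<phi> (q + h *\<^sub>R v)) has_real_derivative F v) (at h)"
proof -
  have "((\<lambda>h. q + h *\<^sub>R v) has_derivative (\<lambda>k. k *\<^sub>R v)) (at h)"
    by (auto intro!: derivative_eq_intros)
  from has_derivative_compose[OF this assms]
  have "((\<lambda>h. \<phi> (q + h *\<^sub>R v)) has_derivative (\<lambda>k. F (k *\<^sub>R v))) (at h)" .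
  moreover have "(\<lambda>k. F (k *\<^sub>R v)) = (*) (F v)"
    using has_derivative_linear[OF assms] by (auto simp: linear_scale)
  ultimately show ?thesis unfolding has_field_derivative_def by simp
qed

lemma smooth_tube_open:
  assumes "smooth_tube \<alpha> Q" shows "open (tube Q)"
proof -
  have "boundary_of_class 3 \<alpha> (tube Q)" using assms unfolding smooth_tube_def by blast
  from boundary_of_class_Int_frontier[OF this] show ?thesis
    by (metis frontier_Int_closed Int_commute frontier_disjoint_eq zero_less_numeral)
qed

text \<open>
  If the derivatives of \<open>\<phi>\<close> in all directions \<open>(0, e)\<close> vanished at \<open>p\<close>, then the inward normal at
  \<open>p\<close> would be parallel to the axis of the tube. Hence a cross-section near \<open>p\<close> can be left and
  entered by moving in one fixed direction \<open>e\<close>, and this controls how it changes with \<open>x\<close>.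
\<close>
lemma smooth_tube_boundary_chart:
  assumes tube: "smooth_tube \<alpha> Q" and p: "p \<in> frontier (tube Q)"
  obtains U \<phi> e where "open U" "p \<in> U" "tube Q \<inter> U = {q\<in>U. (\<phi> :: _ \<Rightarrow> real) q > 0}"
    "\<forall>q\<in>U. (\<phi> has_derivative frechet_derivative \<phi> (at q)) (at q)"
    "\<forall>v. continuous_on U (\<lambda>q. frechet_derivative \<phi> (at q) v)"
    "frechet_derivative \<phi> (at p) (0, e) > 0"
    "\<phi> p = 0"
proof -
  have bc: "boundary_of_class 3 \<alpha> (tube Q)"
    and nrm: "\<And>\<nu>. inward_unit_normal (tube Q) p \<nu> \<Longrightarrow> snd \<nu> \<noteq> 0"
    using assms unfolding smooth_tube_def by auto
  obtain U and \<phi> :: "_ \<Rightarrow> real" where U: "open U" "p \<in> U" "C_holder_on 3 \<alpha> U \<phi>"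
      "tube Q \<inter> U = {q\<in>U. \<phi> q > 0}" and ne: "frechet_derivative \<phi> (at p) \<noteq> (\<lambda>_. 0)"
    using bc p unfolding boundary_of_class_def by blast
  have diff: "\<phi> differentiable (at q)"
    and diff2: "(\<lambda>q. frechet_derivative \<phi> (at q) v) differentiable (at q)" if "q \<in> U" for q v
    using U(3) that unfolding C_holder_on_def numeral_3_eq_3 times_differentiable_on.simps by blast+
  have hd: "(\<phi> has_derivative frechet_derivative \<phi> (at q)) (at q)" if "q \<in> U" for q
    using diff[OF that] frechet_derivative_works by blast
  have cont: "continuous_on U (\<lambda>q. frechet_derivative \<phi> (at q) v)" for v
    by (intro continuous_at_imp_continuous_on ballI differentiable_imp_continuous_within diff2)
  define F where "F = frechet_derivative \<phi> (at p)"
  have lin: "linear F" unfolding F_def using hd[OF U(2)] has_derivative_linear by blast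
  have \<phi>p: "\<phi> p = 0"
  proof -
    have "p \<notin> tube Q" using p smooth_tube_open[OF tube] by (simp add: frontier_def interior_open)
    then have "\<phi> p \<le> 0" using U by force
    moreover have "\<not> \<phi> p < 0"
    proof
      assume "\<phi> p < 0"
      have "isCont \<phi> p" using diff[OF U(2)] by (rule differentiable_imp_continuous_within)
      then have "\<forall>\<^sub>F q in nhds p. \<phi> q < 0" using \<open>\<phi> p < 0\<close>
        by (metis isCont_def order_tendstoD(2) tendsto_at_iff_tendsto_nhds)
      moreover have "\<forall>\<^sub>F q in nhds p. q \<in> U" using U by (simp add: eventually_nhds_in_open)
      ultimately have "\<forall>\<^sub>F q in nhds p. \<phi> q < 0 \<and> q \<in> U" by (rule eventually_conj)
      then obtain W where W: "open W" "p \<in> W" "\<forall>q\<in>W. \<phi> q < 0 \<and> q \<in> U"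
        unfolding eventually_nhds by blast
      then have "W \<inter> tube Q = {}" using U(4) by force
      moreover have "p \<in> closure (tube Q)" using p by (simp add: frontier_def)
      ultimately show False using W open_Int_closure_eq_empty by blast
    qed
    ultimately show ?thesis by simp
  qed
  have sgn: "\<forall>\<^sub>F h in at_right 0. \<phi> (p + h *\<^sub>R v) * sgn (F v) > 0 \<and> p + h *\<^sub>R v \<in> U" if "F v \<noteq> 0" for v
  proof -
    have der: "((\<lambda>h. \<phi> (p + h *\<^sub>R v)) has_real_derivative F v) (at 0)"
      using hd[OF U(2)] unfolding F_def by (intro has_real_derivative_along_line) simp
    have "((\<lambda>h. p + h *\<^sub>R v) \<longlongrightarrow> p + 0 *\<^sub>R v) (at_right 0)"
      by (intro tendsto_intros)
    then have inU: "\<forall>\<^sub>F h in at_right 0. p + h *\<^sub>R v \<in> U"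
      using U topological_tendstoD by fastforce
    have "\<forall>\<^sub>F h in at_right 0. \<phi> (p + h *\<^sub>R v) * sgn (F v) > 0"
    proof (cases "F v > 0")
      case True
      obtain d where "d > 0" "\<forall>h>0. h < d \<longrightarrow> \<phi> (p + 0 *\<^sub>R v) < \<phi> (p + (0 + h) *\<^sub>R v)"
        using DERIV_pos_inc_right[OF der True] by blast
      then show ?thesis using True \<phi>p unfolding eventually_at_right_field by (intro exI[of _ d]) auto
    next
      case False
      then have neg: "F v < 0" using that by simp
      obtain d where "d > 0" "\<forall>h>0. h < d \<longrightarrow> \<phi> (p + 0 *\<^sub>R v) > \<phi> (p + (0 + h) *\<^sub>R v)"
        using DERIV_neg_dec_right[OF der neg] by blast
      then show ?thesis using neg \<phi>p unfolding eventually_at_right_field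
        by (intro exI[of _ d]) (auto simp: mult_neg_neg)
    qed
    with inU show ?thesis by eventually_elim simp
  qed
  \<comment> \<open>Otherwise \<open>(sgn (F (1, 0)), 0)\<close> is the inward normal at \<open>p\<close>.\<close>
  have "\<exists>e. F (0, e) \<noteq> 0"
  proof (rule ccontr)
    assume "\<not> ?thesis"
    then have F0: "F (0, e) = 0" for e by blast
    have F: "F v = fst v * F (1, 0)" for v
    proof -
      have "F v = F (fst v *\<^sub>R (1, 0) + (0, snd v))" by (cases v) simp
      also have "\<dots> = fst v * F (1, 0)" using lin F0 by (simp only: linear_add linear_scale) simp
      finally show ?thesis .
    qed
    have c: "F (1, 0) \<noteq> 0"
    proof
      assume "F (1, 0) = 0"
      then have "F v = 0" for v using F[of v] by simp
      then have "F = (\<lambda>_. 0)" by blast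
      then show False using ne unfolding F_def by blast
    qed
    have F_sgn: "F v = (v \<bullet> (sgn (F (1, 0)), 0)) * \<bar>F (1, 0)\<bar>" for v
      unfolding F[of v] by (cases v) (simp add: mult.assoc mult_sgn_abs)
    have "inward_unit_normal (tube Q) p (sgn (F (1, 0)), 0)"
      unfolding inward_unit_normal_def
    proof (intro conjI allI impI)
      show "norm (sgn (F (1, 0)), 0 :: real ^ 'a) = 1" using c by (simp add: norm_Pair real_sgn_eq)
    next
      fix v :: "real \<times> (real ^ 'a)" assume "v \<bullet> (sgn (F (1, 0)), 0) > 0"
      then have pos: "F v > 0" unfolding F_sgn[of v] using c by (intro mult_pos_pos) auto
      show "\<forall>\<^sub>F h in at_right 0. p + h *\<^sub>R v \<in> tube Q"
        using sgn[of v] pos by (auto elim!: eventually_mono) (use U(4) in blast)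
    next
      fix v :: "real \<times> (real ^ 'a)" assume "v \<bullet> (sgn (F (1, 0)), 0) < 0"
      then have neg: "F v < 0" unfolding F_sgn[of v] using c by (intro mult_neg_pos) auto
      have "\<forall>\<^sub>F h in at_right 0. \<phi> (p + h *\<^sub>R v) * sgn (F v) > 0 \<and> p + h *\<^sub>R v \<in> U"
        using sgn[of v] neg by simp
      then show "\<forall>\<^sub>F h in at_right 0. p + h *\<^sub>R v \<notin> tube Q"
      proof eventually_elim
        case (elim h)
        then have "\<phi> (p + h *\<^sub>R v) < 0" using neg by simp
        then show ?case using U(4) elim by force
      qed
    qed
    from nrm[OF this] show False by simp
  qed
  then obtain e0 where e0: "F (0, e0) \<noteq> 0" by blast
  define e where "e = sgn (F (0, e0)) *\<^sub>R e0"
  have "F (0, e) = sgn (F (0, e0)) * F (0, e0)"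
    using linear_scale[OF lin, of "sgn (F (0, e0))" "(0, e0)"] by (simp add: e_def)
  then have "F (0, e) > 0" using e0 by (simp add: sgn_if)
  with that U(1,2,4) hd cont \<phi>p show thesis unfolding F_def by blast
qed

text \<open>
  At a point \<open>y\<close> of \<open>Q x - Q x'\<close> the defining function \<open>\<phi>\<close> is positive over \<open>x\<close> and not positive
  over \<open>x'\<close>, so \<open>\<phi> (x', y)\<close> lies in a window of length \<open>K \<bar>x - x'\<bar>\<close>. As \<open>\<phi>\<close> grows at least at
  the rate \<open>\<kappa>\<close> in direction \<open>e\<close>, such points fill a set that is thin in this direction.
\<close>
lemma cross_section_difference_near_boundary:
  fixes Q :: "real \<Rightarrow> (real ^ 'm) set"
  assumes tube: "smooth_tube \<alpha> Q" and p: "(x0, y0) \<in> frontier (tube Q)"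
  shows "\<exists>\<rho>>0. \<exists>L. \<forall>x\<in>ball x0 \<rho>. \<forall>x'\<in>ball x0 \<rho>.
    measure lebesgue ((Q x - Q x') \<inter> ball y0 \<rho>) \<le> L * \<bar>x - x'\<bar>"
proof -
  obtain U and \<phi> :: "_ \<Rightarrow> real" and e where U: "open U" "(x0, y0) \<in> U"
    and QU: "tube Q \<inter> U = {q\<in>U. \<phi> q > 0}"
    and hd: "\<forall>q\<in>U. (\<phi> has_derivative frechet_derivative \<phi> (at q)) (at q)"
    and cont: "\<forall>v. continuous_on U (\<lambda>q. frechet_derivative \<phi> (at q) v)"
    and pos: "frechet_derivative \<phi> (at (x0, y0)) (0, e) > 0"
    and "\<phi> (x0, y0) = 0"
    by (rule smooth_tube_boundary_chart[OF tube p])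
  define G where "G q v = frechet_derivative \<phi> (at q) v" for q v
  define \<kappa> where "\<kappa> = G (x0, y0) (0, e) / 2"
  define K where "K = \<bar>G (x0, y0) (1, 0)\<bar> + 1"
  have \<kappa>: "\<kappa> > 0" "\<kappa> < G (x0, y0) (0, e)" using pos unfolding \<kappa>_def G_def by auto
  have K: "K > 0" "\<bar>G (x0, y0) (1, 0)\<bar> < K" unfolding K_def by auto
  have contG: "isCont (\<lambda>q. G q v) (x0, y0)" for v
    using spec[OF cont, of v] U unfolding G_def by (simp add: continuous_on_eq_continuous_at)
  have lim: "((\<lambda>q. G q v) \<longlongrightarrow> G (x0, y0) v) (nhds (x0, y0))" for v
    using contG[of v] tendsto_at_iff_tendsto_nhds[of "\<lambda>q. G q v" "(x0, y0)"] unfolding isCont_def by simp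
  have "\<forall>\<^sub>F q in nhds (x0, y0). \<kappa> < G q (0, e)"
    using lim \<kappa>(2) by (rule order_tendstoD(1))
  moreover have "\<forall>\<^sub>F q in nhds (x0, y0). \<bar>G q (1, 0)\<bar> < K"
    using tendsto_rabs[OF lim] K(2) by (rule order_tendstoD(2))
  moreover have "\<forall>\<^sub>F q in nhds (x0, y0). q \<in> U" using U by (simp add: eventually_nhds_in_open)
  ultimately have "\<forall>\<^sub>F q in nhds (x0, y0). \<kappa> < G q (0, e) \<and> \<bar>G q (1, 0)\<bar> < K \<and> q \<in> U"
    by eventually_elim simp
  then obtain W where "open W" "(x0, y0) \<in> W" "\<And>q. q \<in> W \<Longrightarrow> \<kappa> < G q (0, e) \<and> \<bar>G q (1, 0)\<bar> < K \<and> q \<in> U"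
    unfolding eventually_nhds by blast
  then obtain r where r: "r > 0"
    and Wr: "\<And>q. q \<in> ball (x0, y0) r \<Longrightarrow> \<kappa> < G q (0, e) \<and> \<bar>G q (1, 0)\<bar> < K \<and> q \<in> U"
    unfolding open_contains_ball by blast
  define \<rho> where "\<rho> = r / 2"
  have \<rho>: "\<rho> > 0" using r unfolding \<rho>_def by simp
  have box: "\<kappa> < G (x, y) (0, e) \<and> \<bar>G (x, y) (1, 0)\<bar> < K \<and> (x, y) \<in> U"
    if "x \<in> ball x0 \<rho>" "y \<in> ball y0 \<rho>" for x y
  proof (rule Wr)
    have "dist (x0, y0) (x, y) \<le> dist x0 x + dist y0 y"
      unfolding dist_prod_def fst_conv snd_conv by (rule sqrt_sum_squares_le_sum) auto
    then show "(x, y) \<in> ball (x0, y0) r" using that unfolding \<rho>_def by simp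
  qed
  have vertical: "\<phi> (x, y + s *\<^sub>R e) - \<phi> (x, y) \<ge> \<kappa> * s"
    if "x \<in> ball x0 \<rho>" "y \<in> ball y0 \<rho>" "y + s *\<^sub>R e \<in> ball y0 \<rho>" "s > 0" for x y s
  proof -
    have der: "((\<lambda>h. \<phi> (x, y + h *\<^sub>R e)) has_real_derivative G (x, y + h *\<^sub>R e) (0, e)) (at h)"
      if h: "0 \<le> h" "h \<le> s" for h
    proof -
      have "y + h *\<^sub>R e = (1 - h / s) *\<^sub>R y + (h / s) *\<^sub>R (y + s *\<^sub>R e)"
        using \<open>s > 0\<close> by (simp add: algebra_simps)
      moreover have "(1 - h / s) *\<^sub>R y + (h / s) *\<^sub>R (y + s *\<^sub>R e) \<in> ball y0 \<rho>"
        using that \<open>y \<in> ball y0 \<rho>\<close> \<open>y + s *\<^sub>R e \<in> ball y0 \<rho>\<close> \<open>s > 0\<close>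
        by (intro convexD[OF convex_ball]) auto
      ultimately have "y + h *\<^sub>R e \<in> ball y0 \<rho>" by simp
      then have inU: "(x, y + h *\<^sub>R e) \<in> U" using box \<open>x \<in> ball x0 \<rho>\<close> by blast
      show ?thesis
        using has_real_derivative_along_line[of \<phi> _ "(x, y)" h "(0, e)"] bspec[OF hd inU]
        unfolding G_def by simp
    qed
    obtain h where h: "0 < h" "h < s"
      "\<phi> (x, y + s *\<^sub>R e) - \<phi> (x, y + 0 *\<^sub>R e) = (s - 0) * G (x, y + h *\<^sub>R e) (0, e)"
      using MVT2[OF \<open>s > 0\<close> der] by blast
    have "y + h *\<^sub>R e = (1 - h / s) *\<^sub>R y + (h / s) *\<^sub>R (y + s *\<^sub>R e)"
      using \<open>s > 0\<close> by (simp add: algebra_simps)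
    moreover have "(1 - h / s) *\<^sub>R y + (h / s) *\<^sub>R (y + s *\<^sub>R e) \<in> ball y0 \<rho>"
      using that h by (intro convexD[OF convex_ball]) auto
    ultimately have "\<kappa> < G (x, y + h *\<^sub>R e) (0, e)" using box that(1) by simp
    then show ?thesis using h \<open>s > 0\<close> by (simp add: mult.commute)
  qed
  have horizontal: "\<bar>\<phi> (x, y) - \<phi> (x', y)\<bar> \<le> K * \<bar>x - x'\<bar>"
    if "x \<in> ball x0 \<rho>" "x' \<in> ball x0 \<rho>" "y \<in> ball y0 \<rho>" for x x' y
  proof -
    have "norm (\<phi> (x, y) - \<phi> (x', y)) \<le> K * norm (x - x')"
    proof (rule field_differentiable_bound[of "ball x0 \<rho>" "\<lambda>h. \<phi> (h, y)" "\<lambda>h. G (h, y) (1, 0)"])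
      fix h assume h: "h \<in> ball x0 \<rho>"
      then have inU: "(h, y) \<in> U" using box that by blast
      have "((\<lambda>h. \<phi> (h, y)) has_field_derivative G (h, y) (1, 0)) (at h)"
        using has_real_derivative_along_line[of \<phi> _ "(0, y)" h "(1, 0)"] bspec[OF hd inU]
        unfolding G_def by simp
      then show "((\<lambda>h. \<phi> (h, y)) has_field_derivative G (h, y) (1, 0)) (at h within ball x0 \<rho>)"
        by (rule DERIV_subset) simp
      show "norm (G (h, y) (1, 0)) \<le> K" using box[OF h that(3)] by simp
    qed (use that in auto)
    then show ?thesis by simp
  qed
  have open_sec: "open (Q x)" for x using tube unfolding smooth_tube_def by auto
  define L where "L = 2 * measure lebesgue (ball y0 (\<rho> + norm e)) * (K / \<kappa>)"
  have "measure lebesgue ((Q x - Q x') \<inter> ball y0 \<rho>) \<le> L * \<bar>x - x'\<bar>"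
    if x: "x \<in> ball x0 \<rho>" and x': "x' \<in> ball x0 \<rho>" for x x'
  proof (cases "x = x'")
    case False
    define \<tau> where "\<tau> = K / \<kappa> * \<bar>x - x'\<bar>"
    have "\<tau> > 0" using False K \<kappa> unfolding \<tau>_def by simp
    define S where "S = (Q x - Q x') \<inter> ball y0 \<rho>"
    have level: "y \<in> ball y0 \<rho> \<and> - (K * \<bar>x - x'\<bar>) < \<phi> (x', y) \<and> \<phi> (x', y) \<le> 0" if "y \<in> S" for y
    proof -
      have y: "y \<in> ball y0 \<rho>" "y \<in> Q x" "y \<notin> Q x'" using that unfolding S_def by auto
      have "\<phi> (x, y) > 0" using QU y box[OF x y(1)] unfolding tube_def by blast
      moreover have "\<phi> (x', y) \<le> 0" using QU y box[OF x' y(1)] unfolding tube_def by force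
      ultimately show ?thesis using horizontal[OF x x' y(1)] y(1) by linarith
    qed
    have "measure lebesgue S \<le> 2 * measure lebesgue (ball y0 (\<rho> + norm e)) * \<tau>"
    proof (rule measure_thin_set_le)
      show "S \<in> sets lebesgue" unfolding S_def using open_sec by (simp add: borel_open)
      show "S \<subseteq> ball y0 \<rho>" unfolding S_def by simp
      show "\<tau> > 0" by fact
      fix y s assume y: "y \<in> S" and s: "\<tau> \<le> s"
      show "y + s *\<^sub>R e \<notin> S"
      proof
        assume y': "y + s *\<^sub>R e \<in> S"
        have "\<kappa> * s \<le> \<phi> (x', y + s *\<^sub>R e) - \<phi> (x', y)"
          using level[OF y] level[OF y'] s \<open>\<tau> > 0\<close> by (intro vertical x') auto
        also have "\<dots> < K * \<bar>x - x'\<bar>" using level[OF y] level[OF y'] by linarith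
        also have "\<dots> = \<kappa> * \<tau>" using \<kappa> unfolding \<tau>_def by simp
        also have "\<dots> \<le> \<kappa> * s" using s \<kappa> by simp
        finally show False by simp
      qed
    qed
    then show ?thesis unfolding S_def \<tau>_def L_def by (simp add: mult_ac)
  qed simp
  then show ?thesis using \<rho> by blast
qed

lemma cross_section_difference_locally:
  fixes Q :: "real \<Rightarrow> (real ^ 'm) set"
  assumes tube: "smooth_tube \<alpha> Q"
  shows "\<exists>\<rho>>0. \<exists>L. \<forall>x\<in>ball x0 \<rho>. \<forall>x'\<in>ball x0 \<rho>.
    measure lebesgue ((Q x - Q x') \<inter> ball y0 \<rho>) \<le> L * \<bar>x - x'\<bar>"
proof (cases "(x0, y0) \<in> frontier (tube Q)")
  case True then show ?thesis using cross_section_difference_near_boundary[OF tube] by blast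
next
  case False
  then have "(x0, y0) \<in> interior (tube Q) \<union> interior (- tube Q)"
    by (auto simp: frontier_def closure_interior)
  then obtain r where r: "r > 0" "ball (x0, y0) r \<subseteq> tube Q \<or> ball (x0, y0) r \<subseteq> - tube Q"
    by (meson UnE mem_interior)
  have box: "(x, y) \<in> ball (x0, y0) r" if "x \<in> ball x0 (r / 2)" "y \<in> ball y0 (r / 2)" for x y
  proof -
    have "dist (x0, y0) (x, y) \<le> dist x0 x + dist y0 y"
      unfolding dist_prod_def fst_conv snd_conv by (rule sqrt_sum_squares_le_sum) auto
    then show ?thesis using that by simp
  qed
  have "(Q x - Q x') \<inter> ball y0 (r / 2) = {}" if "x \<in> ball x0 (r / 2)" "x' \<in> ball x0 (r / 2)" for x x'
    using r(2) box[OF that(1)] box[OF that(2)] unfolding tube_def by blast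
  then have "\<forall>x\<in>ball x0 (r / 2). \<forall>x'\<in>ball x0 (r / 2).
    measure lebesgue ((Q x - Q x') \<inter> ball y0 (r / 2)) \<le> 0 * \<bar>x - x'\<bar>" by simp
  then show ?thesis using r(1) half_gt_zero by blast
qed

text \<open>
  The cross-sections near \<open>x0\<close> cannot have parts that escape to infinity as \<open>x\<close> tends to \<open>x0\<close>: a
  connected set that contains \<open>0\<close> and a point outside a sphere meets the sphere, whereas the closure
  of the tube stays away from a large sphere over \<open>x0\<close>, and by compactness also over nearby points.
\<close>
lemma cross_sections_locally_uniformly_bounded:
  fixes Q :: "real \<Rightarrow> (real ^ 'm) set"
  assumes tube: "smooth_tube \<alpha> Q"
  shows "\<exists>\<rho>>0. \<exists>R. \<forall>x\<in>ball x0 \<rho>. Q x \<subseteq> cball 0 R"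
proof -
  have sec: "bounded (Q x)" "connected (Q x)" "0 \<in> Q x" for x
    using tube unfolding smooth_tube_def by auto
  obtain R0 where R0: "R0 > 0" "\<And>y. y \<in> Q x0 \<Longrightarrow> norm y \<le> R0"
    using sec(1)[of x0] unfolding bounded_pos by blast
  define R where "R = R0 + 1"
  have closure_bd: "norm y \<le> R0" if "(x0, y) \<in> closure (tube Q)" for y
  proof (rule ccontr)
    assume far: "\<not> ?thesis"
    then have "(x0, y) \<notin> tube Q" using R0(2) unfolding tube_def by auto
    then have fr: "(x0, y) \<in> frontier (tube Q)"
      using that smooth_tube_open[OF tube] by (simp add: frontier_def interior_open)
    obtain U and \<phi> :: "_ \<Rightarrow> real" and e where U: "open U" "(x0, y) \<in> U"
      and QU: "tube Q \<inter> U = {q\<in>U. \<phi> q > 0}"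
      and hd: "\<forall>q\<in>U. (\<phi> has_derivative frechet_derivative \<phi> (at q)) (at q)"
      and "\<forall>v. continuous_on U (\<lambda>q. frechet_derivative \<phi> (at q) v)"
      and pos: "frechet_derivative \<phi> (at (x0, y)) (0, e) > 0"
      and zero: "\<phi> (x0, y) = 0"
      by (rule smooth_tube_boundary_chart[OF tube fr])
    define F where "F = frechet_derivative \<phi> (at (x0, y))"
    have "((\<lambda>h. \<phi> (x0, y + h *\<^sub>R e)) has_real_derivative F (0, e)) (at 0)"
      using has_real_derivative_along_line[of \<phi> _ "(x0, y)" 0 "(0, e)"] bspec[OF hd U(2)]
      unfolding F_def by simp
    from DERIV_pos_inc_right[OF this pos[folded F_def]]
    obtain d where d: "d > 0" "\<And>h. h > 0 \<Longrightarrow> h < d \<Longrightarrow> \<phi> (x0, y + h *\<^sub>R e) > 0"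
      using zero by auto
    then have "\<forall>\<^sub>F h in at_right 0. \<phi> (x0, y + h *\<^sub>R e) > 0"
      unfolding eventually_at_right_field by auto
    moreover have "((\<lambda>h. (x0, y + h *\<^sub>R e)) \<longlongrightarrow> (x0, y + 0 *\<^sub>R e)) (at_right 0)"
      by (intro tendsto_intros)
    then have "\<forall>\<^sub>F h in at_right 0. (x0, y + h *\<^sub>R e) \<in> U"
      using U by (intro topological_tendstoD[of _ _ _ U]) auto
    moreover have "((\<lambda>h. norm (y + h *\<^sub>R e)) \<longlongrightarrow> norm (y + 0 *\<^sub>R e)) (at_right 0)"
      by (intro tendsto_intros)
    then have "\<forall>\<^sub>F h in at_right 0. norm (y + h *\<^sub>R e) > R0"
      by (rule order_tendstoD(1)) (use far in simp)
    ultimately have "\<forall>\<^sub>F h in at_right (0::real). False"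
    proof eventually_elim
      case (elim h)
      then have "(x0, y + h *\<^sub>R e) \<in> tube Q" using QU by blast
      then have "y + h *\<^sub>R e \<in> Q x0" unfolding tube_def by simp
      from R0(2)[OF this] elim(3) show ?case by simp
    qed
    then show False by simp
  qed
  have "compact ({x0} \<times> sphere (0 :: real ^ 'm) R)" by (intro compact_Times) auto
  moreover have "({x0} \<times> sphere 0 R) \<inter> closure (tube Q) = {}"
  proof -
    have "\<not> norm y = R" if "(x0, y) \<in> closure (tube Q)" for y
      using closure_bd[OF that] unfolding R_def by simp
    then show ?thesis by auto
  qed
  ultimately obtain \<rho> where \<rho>: "\<rho> > 0"
    "\<And>p q. p \<in> {x0} \<times> sphere 0 R \<Longrightarrow> q \<in> closure (tube Q) \<Longrightarrow> \<rho> \<le> dist p q"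
    using separate_compact_closed[of "{x0} \<times> sphere (0 :: real ^ 'm) R" "closure (tube Q)"] by blast
  have "Q x \<subseteq> cball 0 R" if "x \<in> ball x0 \<rho>" for x
  proof (rule ccontr)
    assume "\<not> ?thesis"
    then obtain y where "y \<in> Q x" "y \<notin> cball 0 R" by blast
    then have y: "y \<in> Q x" "norm y > R" by (auto simp: not_le)
    have "connected (norm ` Q x)" by (intro connected_continuous_image continuous_intros sec)
    moreover have "0 \<in> norm ` Q x" by (rule image_eqI[OF _ sec(3)]) simp
    moreover have "norm y \<in> norm ` Q x" using y by blast
    ultimately have "{0..norm y} \<subseteq> norm ` Q x" by (rule connected_contains_Icc)
    moreover have "R \<in> {0..norm y}" using y(2) R0(1) unfolding R_def by simp
    ultimately have "R \<in> norm ` Q x" by blast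
    then obtain w where w: "w \<in> Q x" "norm w = R" by auto
    have "(x, w) \<in> tube Q" using w unfolding tube_def by simp
    then have "(x, w) \<in> closure (tube Q)" by (rule subsetD[OF closure_subset])
    then have "\<rho> \<le> dist (x0, w) (x, w)" using \<rho>(2) w by simp
    then show False using that by (simp add: dist_prod_def)
  qed
  then show ?thesis using \<rho>(1) by blast
qed

lemma cross_volume_locally_Lipschitz:
  fixes Q :: "real \<Rightarrow> (real ^ 'm) set"
  assumes tube: "smooth_tube \<alpha> Q"
  shows "\<exists>\<rho>>0. \<exists>L. \<forall>x\<in>ball x0 \<rho>. \<forall>x'\<in>ball x0 \<rho>.
    \<bar>cross_volume Q x - cross_volume Q x'\<bar> \<le> L * \<bar>x - x'\<bar>"
proof -
  have sec: "bounded (Q x)" "open (Q x)" for x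
    using tube unfolding smooth_tube_def by auto
  have lm: "Q x \<in> lmeasurable" for x
    using sec by (simp add: lmeasurable_open)
  obtain \<rho>0 R where \<rho>0: "\<rho>0 > 0" "\<And>x. x \<in> ball x0 \<rho>0 \<Longrightarrow> Q x \<subseteq> cball 0 R"
    using cross_sections_locally_uniformly_bounded[OF tube] by blast
  obtain \<rho> L where \<rho>: "\<And>y. \<rho> y > 0" and L: "\<And>y x x'. x \<in> ball x0 (\<rho> y) \<Longrightarrow> x' \<in> ball x0 (\<rho> y) \<Longrightarrow>
    measure lebesgue ((Q x - Q x') \<inter> ball y (\<rho> y)) \<le> L y * \<bar>x - x'\<bar>"
    using cross_section_difference_locally[OF tube, of x0] by metis
  have cp: "compact (cball (0 :: real ^ 'm) R)" by simp
  have cover: "cball 0 R \<subseteq> (\<Union>y\<in>cball 0 R. ball y (\<rho> y))" using \<rho> by force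
  obtain Y where Y: "Y \<subseteq> cball 0 R" "finite Y" "cball 0 R \<subseteq> (\<Union>y\<in>Y. ball y (\<rho> y))"
    by (rule compactE_image[OF cp _ cover]) auto
  define r where "r = Min (insert \<rho>0 (\<rho> ` Y))"
  have r: "r > 0" "r \<le> \<rho>0" "\<And>y. y \<in> Y \<Longrightarrow> r \<le> \<rho> y"
    unfolding r_def using Y(2) \<rho> \<rho>0(1) by auto
  have one: "cross_volume Q x - cross_volume Q x' \<le> (\<Sum>y\<in>Y. L y) * \<bar>x - x'\<bar>"
    if "x \<in> ball x0 r" "x' \<in> ball x0 r" for x x'
  proof -
    have "measure lebesgue (Q x) \<le> measure lebesgue (Q x' \<union> (Q x - Q x'))"
      using lm by (intro measure_mono_fmeasurable) (auto simp: fmeasurable.Un fmeasurable.Diff)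
    also have "\<dots> \<le> measure lebesgue (Q x') + measure lebesgue (Q x - Q x')"
      by (intro measure_Un_le) (auto intro!: fmeasurableD lm fmeasurable.Diff)
    finally have "cross_volume Q x - cross_volume Q x' \<le> measure lebesgue (Q x - Q x')"
      unfolding cross_volume_def by simp
    also have "\<dots> \<le> measure lebesgue (\<Union>y\<in>Y. (Q x - Q x') \<inter> ball y (\<rho> y))"
    proof (intro measure_mono_fmeasurable)
      have "Q x \<subseteq> cball 0 R" using \<rho>0(2)[of x] that(1) r(2) by force
      then show "Q x - Q x' \<subseteq> (\<Union>y\<in>Y. (Q x - Q x') \<inter> ball y (\<rho> y))" using Y(3) by blast
      show "(\<Union>y\<in>Y. (Q x - Q x') \<inter> ball y (\<rho> y)) \<in> lmeasurable"
        using Y(2) by (intro fmeasurable.finite_UN) (auto intro!: fmeasurable.Int fmeasurable.Diff lm)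
    qed (auto intro!: fmeasurableD lm fmeasurable.Diff)
    also have "\<dots> \<le> (\<Sum>y\<in>Y. measure lebesgue ((Q x - Q x') \<inter> ball y (\<rho> y)))"
      using Y(2) by (intro measure_UNION_le) (auto intro!: fmeasurableD lm fmeasurable.Diff fmeasurable.Int)
    also have "\<dots> \<le> (\<Sum>y\<in>Y. L y * \<bar>x - x'\<bar>)"
    proof (rule sum_mono)
      fix y assume "y \<in> Y"
      then show "measure lebesgue ((Q x - Q x') \<inter> ball y (\<rho> y)) \<le> L y * \<bar>x - x'\<bar>"
        using r(3)[of y] that by (intro L) auto
    qed
    finally show ?thesis by (simp add: sum_distrib_right)
  qed
  have "\<bar>cross_volume Q x - cross_volume Q x'\<bar> \<le> (\<Sum>y\<in>Y. L y) * \<bar>x - x'\<bar>"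
    if "x \<in> ball x0 r" "x' \<in> ball x0 r" for x x'
    using one[OF that] one[OF that(2,1)] by (auto simp: abs_minus_commute abs_le_iff)
  then show ?thesis using r(1) by blast
qed

lemma cross_volume_locally_bounded_below:
  fixes Q :: "real \<Rightarrow> (real ^ 'm) set"
  assumes tube: "smooth_tube \<alpha> Q"
  shows "\<exists>\<rho>>0. \<exists>v>0. \<forall>x\<in>ball x0 \<rho>. v \<le> cross_volume Q x"
proof -
  have sec: "bounded (Q x)" "open (Q x)" "0 \<in> Q x" for x
    using tube unfolding smooth_tube_def by auto
  have "(x0, 0) \<in> tube Q" using sec(3) unfolding tube_def by simp
  then obtain r where r: "r > 0" "ball (x0, 0) r \<subseteq> tube Q"
    using smooth_tube_open[OF tube] openE by blast
  have "measure lebesgue (ball (0 :: real ^ 'm) (r / 2)) \<le> cross_volume Q x" if "x \<in> ball x0 (r / 2)" for x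
    unfolding cross_volume_def
  proof (rule measure_mono_fmeasurable)
    show "ball 0 (r / 2) \<subseteq> Q x"
    proof
      fix y :: "real ^ 'm" assume y: "y \<in> ball 0 (r / 2)"
      have "dist (x0, 0) (x, y) \<le> dist x0 x + dist 0 y"
        unfolding dist_prod_def fst_conv snd_conv by (rule sqrt_sum_squares_le_sum) auto
      then have "(x, y) \<in> ball (x0, 0) r" using that y by simp
      then show "y \<in> Q x" using r(2) unfolding tube_def by blast
    qed
    show "Q x \<in> lmeasurable" using sec by (simp add: lmeasurable_open)
  qed auto
  moreover have "measure lebesgue (ball (0 :: real ^ 'm) (r / 2)) > 0"
    using r(1) content_ball_pos[of "r / 2" "0 :: real ^ 'm"] by simp
  ultimately show ?thesis using r(1) half_gt_zero by blast
qed

lemma deriv_le_Lipschitz: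
  fixes V :: "real \<Rightarrow> real"
  assumes L: "\<And>x'. x' \<in> ball x \<rho> \<Longrightarrow> \<bar>V x' - V x\<bar> \<le> L * \<bar>x' - x\<bar>" and "\<rho> > 0"
    and der: "(V has_real_derivative D) (at x)"
  shows "\<bar>D\<bar> \<le> L"
proof -
  have "((\<lambda>h. (V (x + h) - V x) / h) \<longlongrightarrow> D) (at 0)"
    using der unfolding DERIV_def .
  then have "((\<lambda>h. \<bar>(V (x + h) - V x) / h\<bar>) \<longlongrightarrow> \<bar>D\<bar>) (at 0)" by (rule tendsto_rabs)
  moreover have "\<forall>\<^sub>F h in at 0. \<bar>(V (x + h) - V x) / h\<bar> \<le> L"
    unfolding eventually_at
  proof (intro exI[of _ \<rho>] conjI ballI impI)
    fix h :: real assume "h \<noteq> 0 \<and> dist h 0 < \<rho>"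
    then show "\<bar>(V (x + h) - V x) / h\<bar> \<le> L" using L[of "x + h"]
      by (simp add: dist_real_def divide_simps)
  qed fact
  ultimately show ?thesis by (rule tendsto_upperbound) simp
qed

text \<open>
  This quotient is the drift of the equation. On the exponential scale a bounded drift is a
  perturbation of order \<open>\<delta>\<close>.
\<close>
lemma tube_log_derivative_locally_bounded:
  fixes Q :: "real \<Rightarrow> (real ^ 'm) set"
  assumes tube: "smooth_tube \<alpha> Q"
  shows "\<exists>\<beta>. \<forall>x\<in>{-R..R}. \<bar>deriv (cross_volume Q) x / cross_volume Q x\<bar> \<le> \<beta>"
proof -
  define V where "V = cross_volume Q"
  \<comment> \<open>Where \<open>V\<close> has no derivative, \<^const>\<open>deriv\<close> has this value, the same one at all such points.\<close>
  define K0 where "K0 = (SOME D :: real. False)"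
  have "\<exists>\<rho>>0. \<exists>\<beta>. \<forall>x\<in>ball x0 \<rho>. \<bar>deriv V x / V x\<bar> \<le> \<beta>" for x0
  proof -
    obtain \<rho>1 L where \<rho>1: "\<rho>1 > 0" and
      L: "\<And>x x'. x \<in> ball x0 \<rho>1 \<Longrightarrow> x' \<in> ball x0 \<rho>1 \<Longrightarrow> \<bar>V x - V x'\<bar> \<le> L * \<bar>x - x'\<bar>"
      using cross_volume_locally_Lipschitz[OF tube] unfolding V_def by blast
    obtain \<rho>2 v where \<rho>2: "\<rho>2 > 0" and v: "v > 0" "\<And>x. x \<in> ball x0 \<rho>2 \<Longrightarrow> v \<le> V x"
      using cross_volume_locally_bounded_below[OF tube] unfolding V_def by blast
    have "\<bar>deriv V x / V x\<bar> \<le> max L \<bar>K0\<bar> / v" if x: "x \<in> ball x0 (min \<rho>1 \<rho>2)" for x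
    proof -
      have "\<bar>deriv V x\<bar> \<le> max L \<bar>K0\<bar>"
      proof (cases "\<exists>D. (V has_real_derivative D) (at x)")
        case True
        then obtain D where D: "(V has_real_derivative D) (at x)" by blast
        have "x \<in> ball x0 \<rho>1" using x by simp
        from openE[OF open_ball this] obtain \<rho>' where \<rho>': "\<rho>' > 0" "ball x \<rho>' \<subseteq> ball x0 \<rho>1"
          by blast
        have "\<bar>D\<bar> \<le> L"
        proof (rule deriv_le_Lipschitz[OF _ \<rho>'(1) D])
          fix x' assume "x' \<in> ball x \<rho>'"
          then have "x' \<in> ball x0 \<rho>1" using \<rho>'(2) by blast
          from L[OF this \<open>x \<in> ball x0 \<rho>1\<close>] show "\<bar>V x' - V x\<bar> \<le> L * \<bar>x' - x\<bar>" .
        qed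
        then show ?thesis using D by (simp add: DERIV_imp_deriv)
      next
        case False
        then have "deriv V x = K0" unfolding deriv_def K0_def by simp
        then show ?thesis by simp
      qed
      moreover have "v \<le> V x" using v(2) x by simp
      ultimately show ?thesis using v(1) by (simp add: abs_divide frac_le)
    qed
    then have "\<forall>x\<in>ball x0 (min \<rho>1 \<rho>2). \<bar>deriv V x / V x\<bar> \<le> max L \<bar>K0\<bar> / v" by blast
    moreover have "0 < min \<rho>1 \<rho>2" using \<rho>1 \<rho>2 by simp
    ultimately show ?thesis by blast
  qed
  then have "\<forall>x0. \<exists>\<rho>. \<exists>\<beta>. 0 < \<rho> \<and> (\<forall>x\<in>ball x0 \<rho>. \<bar>deriv V x / V x\<bar> \<le> \<beta>)" by blast
  then obtain \<rho> where "\<forall>x0. \<exists>\<beta>. 0 < \<rho> x0 \<and> (\<forall>x\<in>ball x0 (\<rho> x0). \<bar>deriv V x / V x\<bar> \<le> \<beta>)"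
    using choice[of "\<lambda>x0 \<rho>. \<exists>\<beta>. 0 < \<rho> \<and> (\<forall>x\<in>ball x0 \<rho>. \<bar>deriv V x / V x\<bar> \<le> \<beta>)"] by blast
  then obtain \<beta> where "\<forall>x0. 0 < \<rho> x0 \<and> (\<forall>x\<in>ball x0 (\<rho> x0). \<bar>deriv V x / V x\<bar> \<le> \<beta> x0)"
    using choice[of "\<lambda>x0 \<beta>. 0 < \<rho> x0 \<and> (\<forall>x\<in>ball x0 (\<rho> x0). \<bar>deriv V x / V x\<bar> \<le> \<beta>)"] by blast
  then have \<rho>: "\<And>x0. \<rho> x0 > 0"
    and \<beta>: "\<And>x0 x. x \<in> ball x0 (\<rho> x0) \<Longrightarrow> \<bar>deriv V x / V x\<bar> \<le> \<beta> x0" by blast+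
  have cp: "compact {-R..R}" by simp
  have cover: "{-R..R} \<subseteq> (\<Union>y\<in>{-R..R}. ball y (\<rho> y))" using \<rho> by force
  obtain Y where Y: "Y \<subseteq> {-R..R}" "finite Y" "{-R..R} \<subseteq> (\<Union>y\<in>Y. ball y (\<rho> y))"
    by (rule compactE_image[OF cp _ cover]) auto
  have "\<bar>deriv V x / V x\<bar> \<le> Max (\<beta> ` Y)" if xR: "x \<in> {-R..R}" for x
  proof -
    obtain y where y: "y \<in> Y" "x \<in> ball y (\<rho> y)" using Y(3) xR by blast
    have "\<beta> y \<le> Max (\<beta> ` Y)" using Y(2) y(1) by simp
    then show ?thesis using \<beta>[OF y(2)] by linarith
  qed
  then show ?thesis unfolding V_def by blast
qed

section \<open>The parabolic maximum principle\<close>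

lemma second_derivative_nonneg_at_min:
  fixes h h' :: "real \<Rightarrow> real"
  assumes lr: "l < x" "x < r" and min: "\<And>y. l \<le> y \<Longrightarrow> y \<le> r \<Longrightarrow> h x \<le> h y"
    and d1: "\<And>y. l < y \<Longrightarrow> y < r \<Longrightarrow> (h has_real_derivative h' y) (at y)"
    and d2: "(h' has_real_derivative h'') (at x)"
  shows "h' x = 0" "h'' \<ge> 0"
proof -
  show h'0: "h' x = 0"
  proof (rule DERIV_local_min[OF d1[OF lr]])
    show "0 < min (x - l) (r - x)" using lr by simp
    show "\<forall>y. \<bar>x - y\<bar> < min (x - l) (r - x) \<longrightarrow> h x \<le> h y" by (auto intro!: min)
  qed
  show "h'' \<ge> 0"
  proof (rule ccontr)
    assume "\<not> ?thesis"
    then obtain d where d: "d > 0" "\<And>k. 0 < k \<Longrightarrow> k < d \<Longrightarrow> h' (x + k) < 0"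
      using DERIV_neg_dec_right[OF d2] h'0 by auto
    define k where "k = min (d / 2) ((r - x) / 2)"
    have k: "0 < k" "k < d" "x + k < r"
    proof -
      show "0 < k" "k < d" using d(1) lr unfolding k_def by auto
      have "k \<le> (r - x) / 2" unfolding k_def by (rule min.cobounded2)
      then show "x + k < r" using lr(2) by (simp add: field_simps)
    qed
    have "\<exists>z>x. z < x + k \<and> h (x + k) - h x = (x + k - x) * h' z"
      using k lr by (intro MVT2) (auto intro!: d1)
    then obtain z where z: "x < z" "z < x + k" "h (x + k) - h x = k * h' z" by auto
    have "h' z < 0" using d(2)[of "z - x"] z k by auto
    then have "k * h' z < 0" using k(1) by (simp add: mult_pos_neg)
    then have "h (x + k) < h x" using z(3) by linarith
    then show False using min[of "x + k"] k lr by simp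
  qed
qed

text \<open>
  The parabolic maximum principle in the form of a first contact. At the first time at which \<open>z\<close>
  ceases to be positive it has an interior minimum with value \<open>0\<close>, and it has not increased in time.
  For the difference of two functions this means that at the contact they agree together with their
  slopes, so that neither the drift nor the nonlinearity distinguishes them there.
\<close>
lemma first_touching:
  fixes z zt zx zxx :: "real \<Rightarrow> real \<Rightarrow> real"
  assumes "l \<le> r" "\<tau> \<le> T"
    and cont: "continuous_on ({\<tau>..T} \<times> {l..r}) (\<lambda>(t, x). z t x)"
    and init: "\<And>x. l \<le> x \<Longrightarrow> x \<le> r \<Longrightarrow> z \<tau> x > 0"
    and sides: "\<And>t. \<tau> \<le> t \<Longrightarrow> t \<le> T \<Longrightarrow> z t l > 0 \<and> z t r > 0"
    and dt: "\<And>t x. \<tau> < t \<Longrightarrow> t \<le> T \<Longrightarrow> l < x \<Longrightarrow> x < r \<Longrightarrow>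
      ((\<lambda>s. z s x) has_real_derivative zt t x) (at t)"
    and dx: "\<And>t x. \<tau> < t \<Longrightarrow> t \<le> T \<Longrightarrow> l < x \<Longrightarrow> x < r \<Longrightarrow> (z t has_real_derivative zx t x) (at x)"
    and dxx: "\<And>t x. \<tau> < t \<Longrightarrow> t \<le> T \<Longrightarrow> l < x \<Longrightarrow> x < r \<Longrightarrow> (zx t has_real_derivative zxx t x) (at x)"
    and touch: "\<And>t x. \<tau> < t \<Longrightarrow> t \<le> T \<Longrightarrow> l < x \<Longrightarrow> x < r \<Longrightarrow>
      z t x = 0 \<Longrightarrow> zx t x = 0 \<Longrightarrow> zxx t x \<ge> 0 \<Longrightarrow> zt t x > 0"
    and tx: "\<tau> \<le> t" "t \<le> T" "l \<le> x" "x \<le> r"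
  shows "z t x > 0"
proof (rule ccontr)
  assume neg: "\<not> ?thesis"
  define P where "P = {p \<in> {\<tau>..T} \<times> {l..r}. (\<lambda>(t, x). z t x) p \<le> 0}"
  have "compact P"
  proof -
    have "closed (({\<tau>..T} \<times> {l..r}) \<inter> (\<lambda>(t, x). z t x) -` {..0})"
      by (intro continuous_closed_preimage cont closed_Times) auto
    moreover have "P = ({\<tau>..T} \<times> {l..r}) \<inter> (({\<tau>..T} \<times> {l..r}) \<inter> (\<lambda>(t, x). z t x) -` {..0})"
      unfolding P_def by auto
    ultimately show ?thesis by (metis compact_Int_closed compact_Icc compact_Times)
  qed
  then have "compact (fst ` P)" by (intro compact_continuous_image continuous_intros)
  moreover have "(t, x) \<in> P" using neg tx unfolding P_def by auto
  ultimately obtain t1 where t1: "t1 \<in> fst ` P" "\<And>s. s \<in> fst ` P \<Longrightarrow> t1 \<le> s"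
    using compact_attains_inf[of "fst ` P"] by blast
  then obtain x1 where x1: "(t1, x1) \<in> P" by auto
  then have b1: "\<tau> \<le> t1" "t1 \<le> T" "l \<le> x1" "x1 \<le> r" "z t1 x1 \<le> 0" unfolding P_def by auto
  have before: "z s y > 0" if "\<tau> \<le> s" "s < t1" "l \<le> y" "y \<le> r" for s y
  proof (rule ccontr)
    assume "\<not> ?thesis"
    then have "(s, y) \<in> P" using that b1 unfolding P_def by auto
    then have "s \<in> fst ` P" by force
    then show False using t1(2) that(2) by force
  qed
  have t1_gt: "\<tau> < t1" using b1 init[of x1] by (cases "t1 = \<tau>") auto
  have nn: "z t1 y \<ge> 0" if "l \<le> y" "y \<le> r" for y
  proof -
    have "continuous_on {\<tau>..t1} (\<lambda>s. (\<lambda>(t, x). z t x) (s, y))"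
      using that b1 by (intro continuous_on_compose2[OF cont] continuous_intros) auto
    then have "((\<lambda>s. z s y) \<longlongrightarrow> z t1 y) (at_left t1)"
      using t1_gt continuous_on_Icc_at_leftD[of \<tau> t1 "\<lambda>s. z s y"] by simp
    moreover have "\<forall>\<^sub>F s in at_left t1. z s y \<ge> 0"
      using t1_gt before that less_imp_le by (auto simp: eventually_at_left_field intro!: exI[of _ \<tau>])
    ultimately show ?thesis by (rule tendsto_lowerbound) simp
  qed
  have z0: "z t1 x1 = 0" using nn b1 by force
  have int: "l < x1" "x1 < r" using sides[of t1] b1 z0 by (metis less_eq_real_def less_irrefl)+
  have min: "z t1 x1 \<le> z t1 y" if "l \<le> y" "y \<le> r" for y using nn z0 that by simp
  have "zx t1 x1 = 0" "zxx t1 x1 \<ge> 0"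
    using dx[OF t1_gt b1(2)] dxx[OF t1_gt b1(2) int] min
    by (auto intro: second_derivative_nonneg_at_min[OF int, where h = "z t1" and h' = "zx t1"])
  then have pos: "zt t1 x1 > 0" using touch t1_gt b1 int z0 by auto
  obtain d where d: "d > 0" "\<And>h. 0 < h \<Longrightarrow> h < d \<Longrightarrow> z (t1 - h) x1 < z t1 x1"
    using DERIV_pos_inc_left[OF dt[OF t1_gt b1(2) int] pos] by blast
  define h where "h = min (d / 2) (t1 - \<tau>)"
  have "0 < h" "h < d" "\<tau> \<le> t1 - h" using d(1) t1_gt unfolding h_def by auto
  then show False using d(2)[of h] before[of "t1 - h" x1] b1 z0 by simp
qed

section \<open>Sums of exponentials as barriers\<close>

lemma eventually_exp_less:
  fixes a y :: real
  assumes "0 < a" "0 < y"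
  shows "\<forall>\<^sub>F \<delta> in at_right 0. exp (- a / \<delta>) < y"
proof -
  define \<delta>0 where "\<delta>0 = a / (1 + \<bar>ln y\<bar>)"
  have pos: "0 < 1 + \<bar>ln y\<bar>" by simp
  have "exp (- a / \<delta>) < y" if "0 < \<delta>" "\<delta> < \<delta>0" for \<delta>
  proof -
    have "\<delta> * (1 + \<bar>ln y\<bar>) < a" using that(2) pos unfolding \<delta>0_def by (simp add: pos_less_divide_eq)
    then have "1 + \<bar>ln y\<bar> < a / \<delta>" using that(1) by (simp add: pos_less_divide_eq mult.commute)
    moreover have "- \<bar>ln y\<bar> \<le> ln y" by (rule abs_ge_minus_self[THEN le_imp_neg_le, simplified])
    ultimately have "- a / \<delta> < ln y" by simp
    then show ?thesis using assms(2) by (metis exp_less_cancel_iff exp_ln)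
  qed
  moreover have "0 < \<delta>0" using assms(1) pos unfolding \<delta>0_def by simp
  ultimately show ?thesis unfolding eventually_at_right_field by blast
qed

lemma eventually_mult_less:
  fixes a y :: real
  assumes "0 < y"
  shows "\<forall>\<^sub>F \<delta> in at_right 0. \<delta> * a < y"
proof -
  have "((\<lambda>\<delta>. \<delta> * a) \<longlongrightarrow> 0 * a) (at_right 0)" by (intro tendsto_intros)
  then show ?thesis by (rule order_tendstoD(2)) (use assms in simp)
qed

text \<open>
  The drift \<open>b\<close> stands for \<open>V\<^sub>x / V\<close>, and \<open>g x v\<close> for the reaction rate at the value \<open>v\<close>. The partial
  derivatives of the solutions are parameters, so that the equation becomes an identity between
  functions whose meaning is given by \<open>dt\<close>, \<open>dx\<close> and \<open>dxx\<close>.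
\<close>
locale kpp_family =
  fixes u :: "real \<Rightarrow> real \<Rightarrow> real \<Rightarrow> real" and f b :: "real \<Rightarrow> real"
    and g :: "real \<Rightarrow> real \<Rightarrow> real" and B :: real
    and ut ux uxx :: "real \<Rightarrow> real \<Rightarrow> real \<Rightarrow> real"
  assumes B_ge_1: "1 \<le> B"
    and bounds: "\<And>\<delta> t x. 0 < \<delta> \<Longrightarrow> 0 \<le> t \<Longrightarrow> 0 \<le> u \<delta> t x \<and> u \<delta> t x \<le> B"
    and initial: "\<And>\<delta> x. 0 < \<delta> \<Longrightarrow> isCont f x \<Longrightarrow>
      ((\<lambda>(t, z). u \<delta> t z) \<longlongrightarrow> f x) (at (0, x) within {0<..} \<times> UNIV)"
    and cont: "\<And>\<delta>. 0 < \<delta> \<Longrightarrow> continuous_on ({0<..} \<times> UNIV) (\<lambda>(t, x). u \<delta> t x)"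
    and dt: "\<And>\<delta> t x. 0 < \<delta> \<Longrightarrow> 0 < t \<Longrightarrow> ((\<lambda>s. u \<delta> s x) has_real_derivative ut \<delta> t x) (at t)"
    and dx: "\<And>\<delta> t x. 0 < \<delta> \<Longrightarrow> 0 < t \<Longrightarrow> (u \<delta> t has_real_derivative ux \<delta> t x) (at x)"
    and dxx: "\<And>\<delta> t x. 0 < \<delta> \<Longrightarrow> 0 < t \<Longrightarrow> (ux \<delta> t has_real_derivative uxx \<delta> t x) (at x)"
    and pde: "\<And>\<delta> t x. 0 < \<delta> \<Longrightarrow> 0 < t \<Longrightarrow>
      ut \<delta> t x = \<delta> / 2 * uxx \<delta> t x + \<delta> / 2 * b x * ux \<delta> t x + 1 / \<delta> * g x (u \<delta> t x) * u \<delta> t x"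
    and drift_bounded: "\<And>R. \<exists>\<beta>. \<forall>x\<in>{-R..R}. \<bar>b x\<bar> \<le> \<beta>"
begin

lemma cont_rectangle:
  assumes "0 < \<delta>" "0 < \<tau>"
  shows "continuous_on ({\<tau>..T} \<times> {l..r}) (\<lambda>(t, x). u \<delta> t x)"
  using cont[OF assms(1)] by (rule continuous_on_subset) (use assms(2) in auto)

lemma below_supersolution:
  fixes w wt wx wxx :: "real \<Rightarrow> real \<Rightarrow> real"
  assumes \<delta>: "0 < \<delta>" and \<tau>: "0 < \<tau>" "\<tau> \<le> T" and lr: "l \<le> r"
    and wcont: "continuous_on ({\<tau>..T} \<times> {l..r}) (\<lambda>(t, x). w t x)"
    and wdt: "\<And>t x. ((\<lambda>s. w s x) has_real_derivative wt t x) (at t)"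
    and wdx: "\<And>t x. (w t has_real_derivative wx t x) (at x)"
    and wdxx: "\<And>t x. (wx t has_real_derivative wxx t x) (at x)"
    and init: "\<And>x. l \<le> x \<Longrightarrow> x \<le> r \<Longrightarrow> u \<delta> \<tau> x < w \<tau> x"
    and sides: "\<And>t. \<tau> \<le> t \<Longrightarrow> t \<le> T \<Longrightarrow> u \<delta> t l < w t l \<and> u \<delta> t r < w t r"
    and super: "\<And>t x. \<tau> < t \<Longrightarrow> t \<le> T \<Longrightarrow> l < x \<Longrightarrow> x < r \<Longrightarrow> u \<delta> t x = w t x \<Longrightarrow>
      \<delta> / 2 * wxx t x + \<delta> / 2 * b x * wx t x + 1 / \<delta> * g x (w t x) * w t x < wt t x"
    and tx: "\<tau> \<le> t" "t \<le> T" "l \<le> x" "x \<le> r"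
  shows "u \<delta> t x < w t x"
proof -
  have "0 < w t x - u \<delta> t x"
  proof (rule first_touching[where l = l and r = r and \<tau> = \<tau> and T = T and z = "\<lambda>t x. w t x - u \<delta> t x"
        and zt = "\<lambda>t x. wt t x - ut \<delta> t x" and zx = "\<lambda>t x. wx t x - ux \<delta> t x"
        and zxx = "\<lambda>t x. wxx t x - uxx \<delta> t x"])
    show "continuous_on ({\<tau>..T} \<times> {l..r}) (\<lambda>(t, x). w t x - u \<delta> t x)"
      using continuous_on_diff[OF wcont cont_rectangle[OF \<delta> \<tau>(1)]] by (simp add: case_prod_unfold)
    fix t x assume t: "\<tau> < t" "t \<le> T" and x: "l < x" "x < r"
    have "0 < t" using t(1) \<tau>(1) by simp
    show "((\<lambda>s. w s x - u \<delta> s x) has_real_derivative wt t x - ut \<delta> t x) (at t)"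
      "((\<lambda>x. w t x - u \<delta> t x) has_real_derivative wx t x - ux \<delta> t x) (at x)"
      "((\<lambda>x. wx t x - ux \<delta> t x) has_real_derivative wxx t x - uxx \<delta> t x) (at x)"
      by (intro DERIV_diff wdt wdx wdxx dt dx dxx \<delta> \<open>0 < t\<close>)+
    assume z: "w t x - u \<delta> t x = 0" "wx t x - ux \<delta> t x = 0" "0 \<le> wxx t x - uxx \<delta> t x"
    then have eq: "u \<delta> t x = w t x" "ux \<delta> t x = wx t x" by simp_all
    have "\<delta> / 2 * uxx \<delta> t x \<le> \<delta> / 2 * wxx t x" using z(3) \<delta> by simp
    with super[OF t x eq(1)] show "0 < wt t x - ut \<delta> t x"
      unfolding pde[OF \<delta> \<open>0 < t\<close>] eq by linarith
  qed (use assms in auto)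
  then show ?thesis by simp
qed

lemma above_subsolution:
  fixes w wt wx wxx :: "real \<Rightarrow> real \<Rightarrow> real"
  assumes \<delta>: "0 < \<delta>" and \<tau>: "0 < \<tau>" "\<tau> \<le> T" and lr: "l \<le> r"
    and wcont: "continuous_on ({\<tau>..T} \<times> {l..r}) (\<lambda>(t, x). w t x)"
    and wdt: "\<And>t x. ((\<lambda>s. w s x) has_real_derivative wt t x) (at t)"
    and wdx: "\<And>t x. (w t has_real_derivative wx t x) (at x)"
    and wdxx: "\<And>t x. (wx t has_real_derivative wxx t x) (at x)"
    and init: "\<And>x. l \<le> x \<Longrightarrow> x \<le> r \<Longrightarrow> w \<tau> x < u \<delta> \<tau> x"
    and sides: "\<And>t. \<tau> \<le> t \<Longrightarrow> t \<le> T \<Longrightarrow> w t l < u \<delta> t l \<and> w t r < u \<delta> t r"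
    and sub: "\<And>t x. \<tau> < t \<Longrightarrow> t \<le> T \<Longrightarrow> l < x \<Longrightarrow> x < r \<Longrightarrow> u \<delta> t x = w t x \<Longrightarrow>
      wt t x < \<delta> / 2 * wxx t x + \<delta> / 2 * b x * wx t x + 1 / \<delta> * g x (w t x) * w t x"
    and tx: "\<tau> \<le> t" "t \<le> T" "l \<le> x" "x \<le> r"
  shows "w t x < u \<delta> t x"
proof -
  have "0 < u \<delta> t x - w t x"
  proof (rule first_touching[where l = l and r = r and \<tau> = \<tau> and T = T and z = "\<lambda>t x. u \<delta> t x - w t x"
        and zt = "\<lambda>t x. ut \<delta> t x - wt t x" and zx = "\<lambda>t x. ux \<delta> t x - wx t x"
        and zxx = "\<lambda>t x. uxx \<delta> t x - wxx t x"])
    show "continuous_on ({\<tau>..T} \<times> {l..r}) (\<lambda>(t, x). u \<delta> t x - w t x)"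
      using continuous_on_diff[OF cont_rectangle[OF \<delta> \<tau>(1)] wcont] by (simp add: case_prod_unfold)
    fix t x assume t: "\<tau> < t" "t \<le> T" and x: "l < x" "x < r"
    have "0 < t" using t(1) \<tau>(1) by simp
    show "((\<lambda>s. u \<delta> s x - w s x) has_real_derivative ut \<delta> t x - wt t x) (at t)"
      "((\<lambda>x. u \<delta> t x - w t x) has_real_derivative ux \<delta> t x - wx t x) (at x)"
      "((\<lambda>x. ux \<delta> t x - wx t x) has_real_derivative uxx \<delta> t x - wxx t x) (at x)"
      by (intro DERIV_diff wdt wdx wdxx dt dx dxx \<delta> \<open>0 < t\<close>)+
    assume z: "u \<delta> t x - w t x = 0" "ux \<delta> t x - wx t x = 0" "0 \<le> uxx \<delta> t x - wxx t x"
    then have eq: "u \<delta> t x = w t x" "ux \<delta> t x = wx t x" by simp_all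
    have "\<delta> / 2 * wxx t x \<le> \<delta> / 2 * uxx \<delta> t x" using z(3) \<delta> by simp
    with sub[OF t x eq(1)] show "0 < ut \<delta> t x - wt t x"
      unfolding pde[OF \<delta> \<open>0 < t\<close>] eq by linarith
  qed (use assms in auto)
  then show ?thesis by simp
qed

end

text \<open>
  The barrier itself has the weight \<open>F = 1\<close>. The weight is there to express its derivatives: a
  derivative in \<open>t\<close> multiplies it by \<open>\<alpha> / \<delta>\<close> and a derivative in \<open>x\<close> by \<open>p / \<delta>\<close>.
\<close>
definition exp_sum ::
  "real \<Rightarrow> (real \<Rightarrow> real \<Rightarrow> real) \<Rightarrow> (real \<times> real \<times> real \<times> real) list \<Rightarrow> real \<Rightarrow> real \<Rightarrow> real" where
  "exp_sum \<delta> F ps t x = (\<Sum>(m, \<alpha>, p, k)\<leftarrow>ps. m * F \<alpha> p * exp ((\<alpha> * t + p * x + k) / \<delta>))"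

lemma exp_sum_simps [simp]:
  "exp_sum \<delta> F [] t x = 0"
  "exp_sum \<delta> F ((m, \<alpha>, p, k) # ps) t x = m * F \<alpha> p * exp ((\<alpha> * t + p * x + k) / \<delta>) + exp_sum \<delta> F ps t x"
  by (simp_all add: exp_sum_def)

lemma exp_sum_dt:
  "((\<lambda>s. exp_sum \<delta> F ps s x) has_real_derivative exp_sum \<delta> (\<lambda>\<alpha> p. F \<alpha> p * \<alpha> / \<delta>) ps t x) (at t)"
proof (induction ps)
  case (Cons q ps)
  obtain m \<alpha> p k where q: "q = (m, \<alpha>, p, k)" by (cases q)
  have "((\<lambda>s. m * F \<alpha> p * exp ((\<alpha> * s + p * x + k) / \<delta>)) has_real_derivative
      m * (F \<alpha> p * \<alpha> / \<delta>) * exp ((\<alpha> * t + p * x + k) / \<delta>)) (at t)"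
    by (cases "\<delta> = 0") (auto intro!: derivative_eq_intros)
  from DERIV_add[OF this Cons.IH] show ?case unfolding q by simp
qed simp

lemma exp_sum_dx:
  "(exp_sum \<delta> F ps t has_real_derivative exp_sum \<delta> (\<lambda>\<alpha> p. F \<alpha> p * p / \<delta>) ps t x) (at x)"
proof -
  have "((\<lambda>x. exp_sum \<delta> F ps t x) has_real_derivative exp_sum \<delta> (\<lambda>\<alpha> p. F \<alpha> p * p / \<delta>) ps t x) (at x)"
  proof (induction ps)
    case (Cons q ps)
    obtain m \<alpha> p k where q: "q = (m, \<alpha>, p, k)" by (cases q)
    have "((\<lambda>x. m * F \<alpha> p * exp ((\<alpha> * t + p * x + k) / \<delta>)) has_real_derivative
        m * (F \<alpha> p * p / \<delta>) * exp ((\<alpha> * t + p * x + k) / \<delta>)) (at x)"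
      by (cases "\<delta> = 0") (auto intro!: derivative_eq_intros)
    from DERIV_add[OF this Cons.IH] show ?case unfolding q by simp
  qed simp
  then show ?thesis by simp
qed

lemma exp_sum_continuous: "continuous_on S (\<lambda>(t, x). exp_sum \<delta> F ps t x)"
proof (induction ps)
  case (Cons q ps)
  obtain m \<alpha> p k where q: "q = (m, \<alpha>, p, k)" by (cases q)
  have "continuous_on S (\<lambda>z. m * F \<alpha> p * exp ((\<alpha> * fst z + p * snd z + k) * (1 / \<delta>)))"
    by (intro continuous_intros)
  from continuous_on_add[OF this Cons.IH] show ?case unfolding q by (simp add: case_prod_unfold)
qed (simp add: case_prod_unfold)

text \<open>
  The linearised equation turns into the Hamilton-Jacobi residual \<open>\<alpha> - p\<^sup>2 / 2 - c\<close> of each exponent.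
  The drift contributes a term of order \<open>\<delta>\<close> only, so a residual of a fixed sign decides whether a
  barrier is a super- or a subsolution for small \<open>\<delta>\<close>.
\<close>
lemma exp_sum_operator:
  assumes "\<delta> \<noteq> 0"
  shows "exp_sum \<delta> (\<lambda>\<alpha> p. 1 * \<alpha> / \<delta>) ps t x - (\<delta> / 2 * exp_sum \<delta> (\<lambda>\<alpha> p. 1 * p / \<delta> * p / \<delta>) ps t x
      + \<delta> / 2 * \<beta> * exp_sum \<delta> (\<lambda>\<alpha> p. 1 * p / \<delta>) ps t x + 1 / \<delta> * c * exp_sum \<delta> (\<lambda>_ _. 1) ps t x)
    = 1 / \<delta> * exp_sum \<delta> (\<lambda>\<alpha> p. \<alpha> - p\<^sup>2 / 2 - \<delta> / 2 * \<beta> * p - c) ps t x"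
proof (induction ps)
  case (Cons q ps)
  obtain m \<alpha> p k where q: "q = (m, \<alpha>, p, k)" by (cases q)
  define X where "X = exp ((\<alpha> * t + p * x + k) / \<delta>)"
  have "m * (1 * \<alpha> / \<delta>) * X - (\<delta> / 2 * (m * (1 * p / \<delta> * p / \<delta>) * X)
      + \<delta> / 2 * \<beta> * (m * (1 * p / \<delta>) * X) + 1 / \<delta> * c * (m * 1 * X))
    = 1 / \<delta> * (m * (\<alpha> - p\<^sup>2 / 2 - \<delta> / 2 * \<beta> * p - c) * X)"
    using assms by (simp add: field_simps power2_eq_square)
  with Cons.IH show ?case unfolding q exp_sum_simps X_def by (simp only: distrib_left)
qed simp

context kpp_family begin

lemma below_exponential_barrier:
  assumes \<delta>: "0 < \<delta>" and \<tau>: "0 < \<tau>" "\<tau> \<le> T" and lr: "l \<le> r"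
    and rate: "\<And>x v. l < x \<Longrightarrow> x < r \<Longrightarrow> 0 \<le> v \<Longrightarrow> g x v \<le> C x"
    and super: "\<And>t x. \<tau> < t \<Longrightarrow> t \<le> T \<Longrightarrow> l < x \<Longrightarrow> x < r \<Longrightarrow>
      0 < exp_sum \<delta> (\<lambda>\<alpha> p. \<alpha> - p\<^sup>2 / 2 - \<delta> / 2 * b x * p - C x) ps t x"
    and init: "\<And>x. l \<le> x \<Longrightarrow> x \<le> r \<Longrightarrow> u \<delta> \<tau> x < exp_sum \<delta> (\<lambda>_ _. 1) ps \<tau> x"
    and sides: "\<And>t. \<tau> \<le> t \<Longrightarrow> t \<le> T \<Longrightarrow>
      u \<delta> t l < exp_sum \<delta> (\<lambda>_ _. 1) ps t l \<and> u \<delta> t r < exp_sum \<delta> (\<lambda>_ _. 1) ps t r"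
    and tx: "\<tau> \<le> t" "t \<le> T" "l \<le> x" "x \<le> r"
  shows "u \<delta> t x < exp_sum \<delta> (\<lambda>_ _. 1) ps t x"
proof (rule below_supersolution[OF \<delta> \<tau> lr exp_sum_continuous exp_sum_dt exp_sum_dx exp_sum_dx init sides _ tx])
  fix t x assume t: "\<tau> < t" "t \<le> T" and x: "l < x" "x < r"
    and eq: "u \<delta> t x = exp_sum \<delta> (\<lambda>_ _. 1) ps t x"
  define w where "w = exp_sum \<delta> (\<lambda>_ _. 1) ps t x"
  have "0 \<le> w" using bounds[OF \<delta>, of t x] t \<tau> eq unfolding w_def by simp
  then have "g x w * w \<le> C x * w" using rate[OF x] by (intro mult_right_mono)
  then have "1 / \<delta> * g x w * w \<le> 1 / \<delta> * C x * w" using \<delta> by (simp add: divide_right_mono)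
  moreover have "0 < 1 / \<delta> * exp_sum \<delta> (\<lambda>\<alpha> p. \<alpha> - p\<^sup>2 / 2 - \<delta> / 2 * b x * p - C x) ps t x"
    using super[OF t x] \<delta> by simp
  moreover note exp_sum_operator[of \<delta> ps t x "b x" "C x"]
  ultimately show "\<delta> / 2 * exp_sum \<delta> (\<lambda>\<alpha> p. 1 * p / \<delta> * p / \<delta>) ps t x
     + \<delta> / 2 * b x * exp_sum \<delta> (\<lambda>\<alpha> p. 1 * p / \<delta>) ps t x
     + 1 / \<delta> * g x (exp_sum \<delta> (\<lambda>_ _. 1) ps t x) * exp_sum \<delta> (\<lambda>_ _. 1) ps t x
     < exp_sum \<delta> (\<lambda>\<alpha> p. 1 * \<alpha> / \<delta>) ps t x"
    using \<delta> unfolding w_def by linarith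
qed auto

lemma above_exponential_barrier:
  assumes \<delta>: "0 < \<delta>" and \<tau>: "0 < \<tau>" "\<tau> \<le> T" and lr: "l \<le> r"
    and rate: "\<And>x v. l < x \<Longrightarrow> x < r \<Longrightarrow> 0 \<le> v \<Longrightarrow> v \<le> M \<Longrightarrow> c \<le> g x v"
    and cap: "\<And>t x. \<tau> < t \<Longrightarrow> t \<le> T \<Longrightarrow> l < x \<Longrightarrow> x < r \<Longrightarrow> exp_sum \<delta> (\<lambda>_ _. 1) ps t x \<le> M"
    and sub: "\<And>t x. \<tau> < t \<Longrightarrow> t \<le> T \<Longrightarrow> l < x \<Longrightarrow> x < r \<Longrightarrow>
      exp_sum \<delta> (\<lambda>\<alpha> p. \<alpha> - p\<^sup>2 / 2 - \<delta> / 2 * b x * p - c) ps t x < 0"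
    and init: "\<And>x. l \<le> x \<Longrightarrow> x \<le> r \<Longrightarrow> exp_sum \<delta> (\<lambda>_ _. 1) ps \<tau> x < u \<delta> \<tau> x"
    and sides: "\<And>t. \<tau> \<le> t \<Longrightarrow> t \<le> T \<Longrightarrow>
      exp_sum \<delta> (\<lambda>_ _. 1) ps t l < u \<delta> t l \<and> exp_sum \<delta> (\<lambda>_ _. 1) ps t r < u \<delta> t r"
    and tx: "\<tau> \<le> t" "t \<le> T" "l \<le> x" "x \<le> r"
  shows "exp_sum \<delta> (\<lambda>_ _. 1) ps t x < u \<delta> t x"
proof (rule above_subsolution[OF \<delta> \<tau> lr exp_sum_continuous exp_sum_dt exp_sum_dx exp_sum_dx init sides _ tx])
  fix t x assume t: "\<tau> < t" "t \<le> T" and x: "l < x" "x < r"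
    and eq: "u \<delta> t x = exp_sum \<delta> (\<lambda>_ _. 1) ps t x"
  define w where "w = exp_sum \<delta> (\<lambda>_ _. 1) ps t x"
  have "0 \<le> w" "w \<le> M" using bounds[OF \<delta>, of t x] t \<tau> eq cap[OF t x] unfolding w_def by auto
  then have "c * w \<le> g x w * w" using rate[OF x] by (intro mult_right_mono)
  then have "1 / \<delta> * c * w \<le> 1 / \<delta> * g x w * w" using \<delta> by (simp add: divide_right_mono)
  moreover have "1 / \<delta> * exp_sum \<delta> (\<lambda>\<alpha> p. \<alpha> - p\<^sup>2 / 2 - \<delta> / 2 * b x * p - c) ps t x < 0"
    using sub[OF t x] \<delta> by (simp add: divide_neg_pos)
  moreover note exp_sum_operator[of \<delta> ps t x "b x" c]
  ultimately show "exp_sum \<delta> (\<lambda>\<alpha> p. 1 * \<alpha> / \<delta>) ps t x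
    < \<delta> / 2 * exp_sum \<delta> (\<lambda>\<alpha> p. 1 * p / \<delta> * p / \<delta>) ps t x
     + \<delta> / 2 * b x * exp_sum \<delta> (\<lambda>\<alpha> p. 1 * p / \<delta>) ps t x
     + 1 / \<delta> * g x (exp_sum \<delta> (\<lambda>_ _. 1) ps t x) * exp_sum \<delta> (\<lambda>_ _. 1) ps t x"
    using \<delta> unfolding w_def by linarith
qed auto

section \<open>Upper bounds on the excitation\<close>

lemma drift_bounded_on:
  obtains \<beta> where "0 \<le> \<beta>" "\<And>x. l \<le> x \<Longrightarrow> x \<le> r \<Longrightarrow> \<bar>b x\<bar> \<le> \<beta>"
proof -
  obtain \<beta> where \<beta>: "\<forall>x\<in>{- (max \<bar>l\<bar> \<bar>r\<bar>)..max \<bar>l\<bar> \<bar>r\<bar>}. \<bar>b x\<bar> \<le> \<beta>" using drift_bounded by blast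
  show thesis
  proof (rule that[of "max 0 \<beta>"])
    fix x assume "l \<le> x" "x \<le> r"
    then have "x \<in> {- (max \<bar>l\<bar> \<bar>r\<bar>)..max \<bar>l\<bar> \<bar>r\<bar>}" by auto
    then show "\<bar>b x\<bar> \<le> max 0 \<beta>" using \<beta> by fastforce
  qed simp
qed

lemma initial_values_on_compact:
  assumes \<delta>: "0 < \<delta>" and K: "compact K" and S: "open S"
    and f: "\<And>x. x \<in> K \<Longrightarrow> isCont f x \<and> f x \<in> S"
  shows "\<exists>\<tau>>0. \<forall>t x. 0 < t \<and> t < \<tau> \<and> x \<in> K \<longrightarrow> u \<delta> t x \<in> S"
proof -
  have "\<exists>\<rho>>0. \<forall>t y. 0 < t \<and> t < \<rho> \<and> y \<in> ball x \<rho> \<longrightarrow> u \<delta> t y \<in> S" if x: "x \<in> K" for x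
  proof -
    have "\<forall>\<^sub>F p in at (0, x) within {0<..} \<times> UNIV. (\<lambda>(t, z). u \<delta> t z) p \<in> S"
      using initial[OF \<delta>] f[OF x] S by (intro topological_tendstoD) auto
    then obtain d where d: "d > 0"
      "\<And>p. p \<in> {0<..} \<times> UNIV \<Longrightarrow> p \<noteq> (0, x) \<Longrightarrow> dist p (0, x) < d \<Longrightarrow> (\<lambda>(t, z). u \<delta> t z) p \<in> S"
      unfolding eventually_at by blast
    have "u \<delta> t y \<in> S" if t: "0 < t" "t < d / 2" and y: "y \<in> ball x (d / 2)" for t y
    proof -
      have "dist (t, y) (0, x) \<le> dist t 0 + dist y x"
        unfolding dist_prod_def fst_conv snd_conv by (rule sqrt_sum_squares_le_sum) auto
      also have "\<dots> < d" using t y by (simp add: dist_commute)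
      finally show ?thesis using d(2)[of "(t, y)"] t by simp
    qed
    then show ?thesis using d(1) half_gt_zero by blast
  qed
  then have "\<forall>x. \<exists>\<rho>. x \<in> K \<longrightarrow> 0 < \<rho> \<and> (\<forall>t y. 0 < t \<and> t < \<rho> \<and> y \<in> ball x \<rho> \<longrightarrow> u \<delta> t y \<in> S)" by blast
  then obtain \<rho> where \<rho>: "\<forall>x. x \<in> K \<longrightarrow> 0 < \<rho> x \<and> (\<forall>t y. 0 < t \<and> t < \<rho> x \<and> y \<in> ball x (\<rho> x) \<longrightarrow> u \<delta> t y \<in> S)"
    using choice[of "\<lambda>x \<rho>. x \<in> K \<longrightarrow> 0 < \<rho> \<and> (\<forall>t y. 0 < t \<and> t < \<rho> \<and> y \<in> ball x \<rho> \<longrightarrow> u \<delta> t y \<in> S)"] by blast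
  then have cover: "K \<subseteq> (\<Union>x\<in>K. ball x (\<rho> x))" by force
  obtain Y where Y: "Y \<subseteq> K" "finite Y" "K \<subseteq> (\<Union>x\<in>Y. ball x (\<rho> x))"
    by (rule compactE_image[OF K _ cover]) auto
  define \<tau> where "\<tau> = Min (insert 1 (\<rho> ` Y))"
  have "\<rho> y > 0" if "y \<in> Y" for y using \<rho> Y(1) that by blast
  then have "0 < \<tau>" unfolding \<tau>_def using Y(2) by auto
  moreover have "u \<delta> t x \<in> S" if t: "0 < t" "t < \<tau>" and x: "x \<in> K" for t x
  proof -
    obtain y where y: "y \<in> Y" "x \<in> ball y (\<rho> y)" using Y(3) x by blast
    then have "\<tau> \<le> \<rho> y" unfolding \<tau>_def using Y(2) by simp
    then have "t < \<rho> y" using t by linarith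
    then show ?thesis using \<rho> y Y(1) t(1) by blast
  qed
  ultimately show ?thesis by blast
qed

text \<open>
  The initial values vanish for \<open>x > 0\<close> but may jump at \<open>0\<close>. Close to \<open>0\<close>, where nothing is known
  about the limit \<open>t \<rightarrow> 0\<close>, the exponential is still larger than \<open>1 / 2\<close>, and the global bound \<open>B\<close>
  suffices.
\<close>
lemma initially_below_exponential:
  assumes \<delta>: "0 < \<delta>" and ahead: "\<And>x. 0 < x \<Longrightarrow> f x = 0" and p: "0 \<le> p"
  shows "\<exists>\<tau>>0. \<forall>t x. 0 < t \<and> t < \<tau> \<and> 0 \<le> x \<and> x \<le> R \<longrightarrow> u \<delta> t x < 2 * B * exp (- p * x / \<delta>)"
proof -
  define \<rho> where "\<rho> = \<delta> * ln 2 / (p + 1)"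
  have \<rho>: "0 < \<rho>" using \<delta> p unfolding \<rho>_def by simp
  have isc: "isCont f x \<and> f x \<in> {..<2 * B * exp (- p * R / \<delta>)}" if "x \<in> {\<rho>..R}" for x
  proof -
    have x: "0 < x" using that \<rho> by simp
    then have "\<forall>\<^sub>F y in nhds x. f y = 0"
      using eventually_nhds_in_open[of "{0<..}" x] ahead by (auto elim!: eventually_mono)
    then have "isCont f x \<longleftrightarrow> isCont (\<lambda>_. 0 :: real) x" by (rule isCont_cong)
    then show ?thesis using ahead[OF x] B_ge_1 by simp
  qed
  from initial_values_on_compact[OF \<delta> compact_Icc open_lessThan isc]
  obtain \<tau> where \<tau>: "0 < \<tau>"
    "\<forall>t x. 0 < t \<and> t < \<tau> \<and> x \<in> {\<rho>..R} \<longrightarrow> u \<delta> t x \<in> {..<2 * B * exp (- p * R / \<delta>)}"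
    by blast
  have "u \<delta> t x < 2 * B * exp (- p * x / \<delta>)" if t: "0 < t" "t < \<tau>" and x: "0 \<le> x" "x \<le> R" for t x
  proof (cases "x < \<rho>")
    case True
    have "p * x \<le> p * \<rho>" using True p by (intro mult_left_mono) auto
    also have "p * \<rho> = \<delta> * ln 2 * (p / (p + 1))" unfolding \<rho>_def by simp
    also have "\<dots> < \<delta> * ln 2 * 1" using p \<delta> by (intro mult_strict_left_mono) auto
    finally have "p * x / \<delta> < ln 2" using \<delta> by (simp add: pos_divide_less_eq mult.commute)
    then have "- ln 2 < - p * x / \<delta>" by simp
    then have "exp (- ln 2) < exp (- p * x / \<delta>)" by (simp only: exp_less_cancel_iff)
    then have "1 / 2 < exp (- p * x / \<delta>)" by (simp add: exp_minus inverse_eq_divide)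
    then have "2 * B * (1 / 2) < 2 * B * exp (- p * x / \<delta>)" using B_ge_1 by (intro mult_strict_left_mono) auto
    then show ?thesis using bounds[OF \<delta>, of t x] t by simp
  next
    case False
    have "p * x \<le> p * R" using x p by (intro mult_left_mono) auto
    then have "exp (- p * R / \<delta>) \<le> exp (- p * x / \<delta>)" using \<delta> by (simp add: divide_right_mono)
    then have "2 * B * exp (- p * R / \<delta>) \<le> 2 * B * exp (- p * x / \<delta>)" using B_ge_1 by (intro mult_left_mono) auto
    moreover have "u \<delta> t x < 2 * B * exp (- p * R / \<delta>)" using \<tau>(2) t x False by auto
    ultimately show ?thesis by linarith
  qed
  then show ?thesis using \<tau>(1) by blast
qed

text \<open>
  Before \<open>X\<close> is excited, the solution at \<open>X\<close> comes from paths that cross \<open>{0..X}\<close> with speed \<open>\<nu>\<close> and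
  then wait at \<open>X\<close>; their exponent is \<open>c2 t - \<nu> X\<close> and reaches \<open>0\<close> at the time \<open>\<nu> X / c2\<close>. As
  \<open>2 c1 \<le> c2\<close>, the result can be stated with the smaller rate \<open>2 c1\<close> of the wave that \<open>X\<close> sends back
  to the left.
\<close>
lemma below_at_interface:
  assumes ahead: "\<And>x. 0 < x \<Longrightarrow> f x = 0"
    and c: "0 < c1" "2 * c1 \<le> c2" and X: "0 < X" and \<epsilon>: "0 < \<epsilon>"
    and rate1: "\<And>x v. 0 < x \<Longrightarrow> x < X \<Longrightarrow> 0 \<le> v \<Longrightarrow> g x v \<le> c1"
    and rate2: "\<And>x v. 0 < x \<Longrightarrow> 0 \<le> v \<Longrightarrow> g x v \<le> c2"
    and \<nu>: "\<nu> = sqrt (2 * (c2 - c1))" and T0: "T0 = (\<nu> * X - \<epsilon>) / (c2 + \<epsilon>)" "0 < T0"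
  shows "\<forall>\<^sub>F \<delta> in at_right 0. \<forall>t. 0 < t \<and> t \<le> T0 \<longrightarrow>
    u \<delta> t X < 6 * B * exp ((2 * c1 + \<epsilon>) * (t - T0) / \<delta>)"
proof -
  define K where "K = c2 + 1 / 2 + \<epsilon>"
  \<comment> \<open>So far away that a disturbance which starts at \<open>R\<close> has not become relevant at \<open>X\<close> before
    the time \<open>T0\<close>.\<close>
  define R where "R = X + K * T0"
  have K: "0 < K" "2 * c1 + \<epsilon> \<le> K" using c \<epsilon> unfolding K_def by auto
  have R: "X < R" using K(1) T0(2) unfolding R_def by simp
  have \<nu>2: "\<nu>\<^sup>2 = 2 * (c2 - c1)" and \<nu>0: "0 \<le> \<nu>" using c unfolding \<nu> by auto
  obtain \<beta> where \<beta>: "0 \<le> \<beta>" "\<And>x. 0 \<le> x \<Longrightarrow> x \<le> R \<Longrightarrow> \<bar>b x\<bar> \<le> \<beta>"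
    by (rule drift_bounded_on[of 0 R]) blast
  have "\<forall>\<^sub>F \<delta> in at_right 0. \<delta> * (\<beta> * (\<nu> + 1) / 2) < \<epsilon>" using \<epsilon> by (rule eventually_mult_less)
  moreover have "\<forall>\<^sub>F \<delta> in at_right 0. \<delta> * \<nu>\<^sup>2 < 2 * \<epsilon>\<^sup>2" using \<epsilon> by (intro eventually_mult_less) simp
  moreover have "\<forall>\<^sub>F \<delta> in at_right 0. (0::real) < \<delta>" by (simp add: eventually_at_right_less)
  ultimately show ?thesis
  proof eventually_elim
    case (elim \<delta>)
    have \<delta>: "0 < \<delta>" by fact
    \<comment> \<open>The first exponential is a supersolution to the left of \<open>X\<close> only. To the right of \<open>X\<close> the
      second one, which is flat, is larger by the factor \<open>exp (\<epsilon> / \<delta>)\<close> and compensates for the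
      defect. The third one stands for whatever enters from far away: it is at least \<open>1\<close> at \<open>R\<close>
      but small at \<open>X\<close> before the time \<open>T0\<close>.\<close>
    define ps where "ps = [(2 * B, c2 + \<epsilon>, - \<nu>, 0), (2 * B, c2 + \<epsilon>, 0, \<epsilon> - \<nu> * X), (2 * B, K, 1, - R)]"
    define A1 where "A1 t x = exp (((c2 + \<epsilon>) * t - \<nu> * x) / \<delta>)" for t x
    define A2 where "A2 t = exp (((c2 + \<epsilon>) * t + \<epsilon> - \<nu> * X) / \<delta>)" for t
    define A3 where "A3 t x = exp ((K * t + x - R) / \<delta>)" for t x
    have exp_sum_ps: "exp_sum \<delta> F ps t x = 2 * B * (F (c2 + \<epsilon>) (- \<nu>) * A1 t x + F (c2 + \<epsilon>) 0 * A2 t + F K 1 * A3 t x)" for F t x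
      unfolding ps_def exp_sum_simps A1_def A2_def A3_def by (simp add: algebra_simps)
    have pos: "0 < A1 t x" "0 < A2 t" "0 < A3 t x" for t x unfolding A1_def A2_def A3_def by auto
    obtain \<tau> where \<tau>: "0 < \<tau>" "\<And>t x. 0 < t \<Longrightarrow> t < \<tau> \<Longrightarrow> 0 \<le> x \<Longrightarrow> x \<le> R \<Longrightarrow> u \<delta> t x < 2 * B * exp (- \<nu> * x / \<delta>)"
      using initially_below_exponential[OF \<delta> ahead \<nu>0, of R] by blast
    have "u \<delta> t X < 6 * B * exp ((2 * c1 + \<epsilon>) * (t - T0) / \<delta>)" if t: "0 < t" "t \<le> T0" for t
    proof -
      define \<tau>' where "\<tau>' = min (\<tau> / 2) t"
      have \<tau>': "0 < \<tau>'" "\<tau>' < \<tau>" "\<tau>' \<le> t" using \<tau>(1) t(1) unfolding \<tau>'_def by auto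
      have "u \<delta> t X < exp_sum \<delta> (\<lambda>_ _. 1) ps t X"
      proof (rule below_exponential_barrier[OF \<delta>, where \<tau> = \<tau>' and T = t and l = 0 and r = R
            and C = "\<lambda>x. if x < X then c1 else c2"])
        fix x v :: real assume "0 < x" "0 \<le> v"
        then show "g x v \<le> (if x < X then c1 else c2)" using rate1[of x v] rate2[of x v] by auto
      next
        fix t x assume x: "0 < x" "x < R"
        have "\<bar>\<delta> / 2 * b x * p\<bar> < \<epsilon>" if "\<bar>p\<bar> \<le> \<nu> + 1" for p
        proof -
          have "\<bar>\<delta> / 2 * b x * p\<bar> = \<delta> / 2 * (\<bar>b x\<bar> * \<bar>p\<bar>)" using \<delta> by (simp add: abs_mult)
          also have "\<dots> \<le> \<delta> / 2 * (\<beta> * (\<nu> + 1))"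
            using \<beta> x that \<delta> \<nu>0 by (intro mult_left_mono mult_mono) auto
          also have "\<dots> < \<epsilon>" using elim(1) by (simp add: mult_ac)
          finally show ?thesis .
        qed
        from this[of "- \<nu>"] this[of 1] have drift: "0 < \<epsilon> - \<delta> / 2 * b x * (- \<nu>)" "0 < \<epsilon> - \<delta> / 2 * b x * 1"
          using \<nu>0 by (simp_all add: abs_less_iff)
        have "0 < ((c2 + \<epsilon>) - (- \<nu>)\<^sup>2 / 2 - \<delta> / 2 * b x * (- \<nu>) - (if x < X then c1 else c2)) * A1 t x
          + ((c2 + \<epsilon>) - 0\<^sup>2 / 2 - \<delta> / 2 * b x * 0 - (if x < X then c1 else c2)) * A2 t
          + (K - 1\<^sup>2 / 2 - \<delta> / 2 * b x * 1 - (if x < X then c1 else c2)) * A3 t x" (is "0 < ?a * A1 t x + ?b * A2 t + ?c * A3 t x")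
        proof -
          have "0 < ?c" using drift(2) c unfolding K_def by auto
          then have 3: "0 < ?c * A3 t x" using pos by simp
          have "0 < ?a * A1 t x + ?b * A2 t"
          proof (cases "x < X")
            case True
            then have "0 < ?a" "0 < ?b" using drift(1) c \<epsilon> \<nu>2 by (auto simp: field_simps)
            then show ?thesis using pos by (simp add: add_pos_pos)
          next
            case False
            then have a: "- (\<nu>\<^sup>2 / 2) \<le> ?a" and b: "?b = \<epsilon>" using drift(1) by auto
            have "\<nu> * X \<le> \<nu> * x" using False \<nu>0 by (intro mult_left_mono) auto
            then have "A1 t x \<le> exp ((((c2 + \<epsilon>) * t + \<epsilon> - \<nu> * X) - \<epsilon>) / \<delta>)"
              unfolding A1_def using \<delta> by (simp add: divide_right_mono)
            also have "\<dots> = A2 t * exp (- (\<epsilon> / \<delta>))"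
              unfolding A2_def diff_divide_distrib[of _ \<epsilon>] by (simp add: exp_diff exp_minus divide_inverse)
            finally have "A1 t x * exp (\<epsilon> / \<delta>) \<le> A2 t * exp (- (\<epsilon> / \<delta>)) * exp (\<epsilon> / \<delta>)" by (intro mult_right_mono) auto
            then have "A1 t x * exp (\<epsilon> / \<delta>) \<le> A2 t" unfolding mult.assoc by (simp flip: exp_add)
            moreover have "\<epsilon> / \<delta> < exp (\<epsilon> / \<delta>)" using exp_ge_add_one_self[of "\<epsilon> / \<delta>"] by linarith
            then have "A1 t x * (\<epsilon> / \<delta>) < A1 t x * exp (\<epsilon> / \<delta>)"
              using pos by (intro mult_strict_left_mono)
            ultimately have "A1 t x * (\<epsilon> / \<delta>) < A2 t" by linarith
            then have "\<epsilon> * (A1 t x * (\<epsilon> / \<delta>)) < \<epsilon> * A2 t" using \<epsilon> by (intro mult_strict_left_mono)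
            moreover have "\<nu>\<^sup>2 / 2 < \<epsilon> * (\<epsilon> / \<delta>)" using elim(2) \<delta> by (simp add: field_simps power2_eq_square)
            then have "\<nu>\<^sup>2 / 2 * A1 t x < \<epsilon> * (\<epsilon> / \<delta>) * A1 t x" using pos by (intro mult_strict_right_mono)
            moreover have "- (\<nu>\<^sup>2 / 2) * A1 t x \<le> ?a * A1 t x" using a pos by (intro mult_right_mono) (auto intro: less_imp_le)
            moreover have "\<epsilon> * (A1 t x * (\<epsilon> / \<delta>)) = \<epsilon> * (\<epsilon> / \<delta>) * A1 t x"
              "- (\<nu>\<^sup>2 / 2) * A1 t x = - (\<nu>\<^sup>2 / 2 * A1 t x)" by simp_all
            ultimately show ?thesis unfolding b by linarith
          qed
          with 3 show ?thesis by linarith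
        qed
        then show "0 < exp_sum \<delta> (\<lambda>\<alpha> p. \<alpha> - p\<^sup>2 / 2 - \<delta> / 2 * b x * p - (if x < X then c1 else c2)) ps t x"
          unfolding exp_sum_ps using B_ge_1 by (intro mult_pos_pos) auto
      next
        fix x assume x: "0 \<le> x" "x \<le> R"
        have "exp (- \<nu> * x / \<delta>) \<le> A1 \<tau>' x"
          unfolding A1_def exp_le_cancel_iff using \<delta> c \<epsilon> \<tau>' by (intro divide_right_mono) auto
        also have "\<dots> \<le> A1 \<tau>' x + A2 \<tau>' + A3 \<tau>' x" using pos(1)[of \<tau>' x] pos(2)[of \<tau>'] pos(3)[of \<tau>' x] by linarith
        finally have "2 * B * exp (- \<nu> * x / \<delta>) \<le> 2 * B * (A1 \<tau>' x + A2 \<tau>' + A3 \<tau>' x)"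
          using B_ge_1 by (intro mult_left_mono) auto
        then show "u \<delta> \<tau>' x < exp_sum \<delta> (\<lambda>_ _. 1) ps \<tau>' x"
          unfolding exp_sum_ps using \<tau>(2)[OF \<tau>'(1,2) x] by simp
      next
        fix s assume "\<tau>' \<le> s" "s \<le> t"
        then have s: "0 \<le> s" using \<tau>'(1) by linarith
        have "1 \<le> A1 s 0" unfolding A1_def using \<delta> s c \<epsilon> by simp
        then have "2 * B * 1 \<le> 2 * B * (A1 s 0 + A2 s + A3 s 0)"
          using pos(2)[of s] pos(3)[of s 0] B_ge_1 by (intro mult_left_mono) auto
        moreover have "1 \<le> A3 s R" unfolding A3_def using \<delta> s K by simp
        then have "2 * B * 1 \<le> 2 * B * (A1 s R + A2 s + A3 s R)"
          using pos(1)[of s R] pos(2)[of s] B_ge_1 by (intro mult_left_mono) auto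
        moreover have "exp_sum \<delta> (\<lambda>_ _. 1) ps s 0 = 2 * B * (A1 s 0 + A2 s + A3 s 0)"
          "exp_sum \<delta> (\<lambda>_ _. 1) ps s R = 2 * B * (A1 s R + A2 s + A3 s R)"
          unfolding exp_sum_ps by simp_all
        moreover have "u \<delta> s 0 \<le> B" "u \<delta> s R \<le> B" using bounds[OF \<delta> s] by simp_all
        ultimately show "u \<delta> s 0 < exp_sum \<delta> (\<lambda>_ _. 1) ps s 0 \<and> u \<delta> s R < exp_sum \<delta> (\<lambda>_ _. 1) ps s R"
          using B_ge_1 by (intro conjI; linarith)
      qed (use \<tau>' t R X in auto)
      also have "\<dots> \<le> 2 * B * (3 * exp ((2 * c1 + \<epsilon>) * (t - T0) / \<delta>))"
      proof -
        have T0': "(c2 + \<epsilon>) * T0 = \<nu> * X - \<epsilon>" unfolding T0(1) using c \<epsilon> by simp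
        have le: "k * (t - T0) \<le> (2 * c1 + \<epsilon>) * (t - T0)" if "2 * c1 + \<epsilon> \<le> k" for k
          using that t(2) by (intro mult_right_mono_neg) auto
        have "(c2 + \<epsilon>) * t + \<epsilon> - \<nu> * X = (c2 + \<epsilon>) * (t - T0)" using T0' by (simp add: algebra_simps)
        then have 2: "(c2 + \<epsilon>) * t + \<epsilon> - \<nu> * X \<le> (2 * c1 + \<epsilon>) * (t - T0)" using le[of "c2 + \<epsilon>"] c by simp
        then have 1: "(c2 + \<epsilon>) * t - \<nu> * X \<le> (2 * c1 + \<epsilon>) * (t - T0)" using \<epsilon> by linarith
        have "K * t + X - R = K * (t - T0)" unfolding R_def by (simp add: algebra_simps)
        then have 3: "K * t + X - R \<le> (2 * c1 + \<epsilon>) * (t - T0)" using le[OF K(2)] by simp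
        have "A1 t X \<le> exp ((2 * c1 + \<epsilon>) * (t - T0) / \<delta>)" "A2 t \<le> exp ((2 * c1 + \<epsilon>) * (t - T0) / \<delta>)"
          "A3 t X \<le> exp ((2 * c1 + \<epsilon>) * (t - T0) / \<delta>)"
          unfolding A1_def A2_def A3_def exp_le_cancel_iff by (intro divide_right_mono 1 2 3; use \<delta> in simp)+
        then show ?thesis unfolding exp_sum_ps using B_ge_1 by (intro mult_left_mono) auto
      qed
      finally show ?thesis by simp
    qed
    then show ?case by blast
  qed
qed

text \<open>
  To the left of \<open>X\<close> the barrier consists of the front that comes from \<open>0\<close> and the one that comes from
  \<open>X\<close>, both with the speed \<open>k = sqrt (2 c1)\<close>. On the boundary \<open>X\<close> the second one dominates the
  solution by \<open>below_at_interface\<close> until the time \<open>T0\<close>, and is larger than \<open>B\<close> afterwards.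
\<close>
lemma not_excited_before_the_fronts_meet:
  assumes ahead: "\<And>x. 0 < x \<Longrightarrow> f x = 0"
    and c: "0 < c1" "2 * c1 \<le> c2" and q: "0 < q" "q < X"
    and rate1: "\<And>x v. 0 < x \<Longrightarrow> x < X \<Longrightarrow> 0 \<le> v \<Longrightarrow> g x v \<le> c1"
    and rate2: "\<And>x v. 0 < x \<Longrightarrow> 0 \<le> v \<Longrightarrow> g x v \<le> c2"
    and left: "sqrt (2 * c1) * s < q"
    and right: "sqrt (2 * c1) * (s - sqrt (2 * (c2 - c1)) * X / c2) < X - q"
    and t: "0 < t" "t \<le> s"
  shows "((\<lambda>\<delta>. u \<delta> t q) \<longlongrightarrow> 0) (at_right 0)"
proof -
  define k where "k = sqrt (2 * c1)"
  define \<nu> where "\<nu> = sqrt (2 * (c2 - c1))"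
  have X: "0 < X" using q by simp
  have k: "k\<^sup>2 = 2 * c1" "0 < k" using c unfolding k_def by auto
  have \<nu>: "0 < \<nu>" using c unfolding \<nu>_def by simp
  have "k * (k * s) < k * q" using left k(2) unfolding k_def[symmetric] by simp
  then have left': "(2 * c1 + 0) * s < k * q" unfolding k(1)[symmetric] by (simp add: power2_eq_square mult.assoc)
  have "k * (k * (s - \<nu> * X / c2)) < k * (X - q)" using right k(2) unfolding k_def[symmetric] \<nu>_def[symmetric] by simp
  then have right': "(2 * c1 + 0) * (s - (\<nu> * X - 0) / (c2 + 0)) < k * (X - q)"
    unfolding k(1)[symmetric] by (simp add: power2_eq_square mult.assoc)
  have "((\<lambda>\<epsilon>. (2 * c1 + \<epsilon>) * s) \<longlongrightarrow> (2 * c1 + 0) * s) (at_right 0)" by (intro tendsto_intros)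
  from order_tendstoD(2)[OF this left'] have "\<forall>\<^sub>F \<epsilon> in at_right 0. (2 * c1 + \<epsilon>) * s < k * q" .
  moreover have "((\<lambda>\<epsilon>. (2 * c1 + \<epsilon>) * (s - (\<nu> * X - \<epsilon>) / (c2 + \<epsilon>))) \<longlongrightarrow>
    (2 * c1 + 0) * (s - (\<nu> * X - 0) / (c2 + 0))) (at_right 0)" using c by (intro tendsto_intros) auto
  from order_tendstoD(2)[OF this right']
  have "\<forall>\<^sub>F \<epsilon> in at_right 0. (2 * c1 + \<epsilon>) * (s - (\<nu> * X - \<epsilon>) / (c2 + \<epsilon>)) < k * (X - q)" .
  moreover have "\<forall>\<^sub>F \<epsilon> in at_right 0. \<epsilon> * 1 < \<nu> * X" using \<nu> X by (intro eventually_mult_less) simp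
  moreover have "\<forall>\<^sub>F \<epsilon> in at_right 0. (0::real) < \<epsilon>" by (simp add: eventually_at_right_less)
  ultimately have "\<forall>\<^sub>F \<epsilon> in at_right 0. (2 * c1 + \<epsilon>) * s < k * q \<and>
      (2 * c1 + \<epsilon>) * (s - (\<nu> * X - \<epsilon>) / (c2 + \<epsilon>)) < k * (X - q) \<and> \<epsilon> < \<nu> * X \<and> 0 < \<epsilon>"
    by eventually_elim simp
  then obtain \<epsilon> where \<epsilon>: "(2 * c1 + \<epsilon>) * s < k * q"
      "(2 * c1 + \<epsilon>) * (s - (\<nu> * X - \<epsilon>) / (c2 + \<epsilon>)) < k * (X - q)" "\<epsilon> < \<nu> * X" "0 < \<epsilon>"
    using eventually_happens'[OF trivial_limit_at_right_real] by blast
  define T0 where "T0 = (\<nu> * X - \<epsilon>) / (c2 + \<epsilon>)"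
  have T0: "0 < T0" using \<epsilon> c unfolding T0_def by simp
  define \<mu> where "\<mu> = 2 * c1 + \<epsilon>"
  have \<mu>: "0 < \<mu>" using c \<epsilon> unfolding \<mu>_def by simp
  define \<sigma> where "\<sigma> = min (k * q - \<mu> * s) (k * (X - q) - \<mu> * (s - T0))"
  have \<sigma>: "0 < \<sigma>" using \<epsilon> unfolding \<sigma>_def \<mu>_def T0_def by simp
  obtain \<beta> where \<beta>: "0 \<le> \<beta>" "\<And>x. 0 \<le> x \<Longrightarrow> x \<le> X \<Longrightarrow> \<bar>b x\<bar> \<le> \<beta>"
    by (rule drift_bounded_on[of 0 X]) blast
  have main: "\<forall>\<^sub>F \<delta> in at_right 0. u \<delta> t q \<le> 12 * B * exp (- \<sigma> / \<delta>)"
  proof -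
    have "\<forall>\<^sub>F \<delta> in at_right 0. \<forall>t. 0 < t \<and> t \<le> T0 \<longrightarrow> u \<delta> t X < 6 * B * exp ((2 * c1 + \<epsilon>) * (t - T0) / \<delta>)"
      using below_at_interface[OF ahead c X \<epsilon>(4) rate1 rate2 \<nu>_def T0_def T0] .
    moreover have "\<forall>\<^sub>F \<delta> in at_right 0. \<delta> * (\<beta> * k / 2) < \<epsilon>" using \<epsilon>(4) by (rule eventually_mult_less)
    moreover have "\<forall>\<^sub>F \<delta> in at_right 0. (0::real) < \<delta>" by (simp add: eventually_at_right_less)
    ultimately show ?thesis
    proof eventually_elim
      case (elim \<delta>)
      have \<delta>: "0 < \<delta>" by fact
      define ps where "ps = [(6 * B, \<mu>, - k, 0), (6 * B, \<mu>, k, - k * X - \<mu> * T0)]"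
      define A1 where "A1 t x = exp ((\<mu> * t - k * x) / \<delta>)" for t x
      define A2 where "A2 t x = exp ((\<mu> * (t - T0) - k * (X - x)) / \<delta>)" for t x
      have exp_sum_ps: "exp_sum \<delta> F ps t x = 6 * B * (F \<mu> (- k) * A1 t x + F \<mu> k * A2 t x)" for F t x
        unfolding ps_def exp_sum_simps A1_def A2_def by (simp add: algebra_simps)
      have pos: "0 < A1 t x" "0 < A2 t x" for t x unfolding A1_def A2_def by auto
      obtain \<tau> where \<tau>: "0 < \<tau>" "\<And>t x. 0 < t \<Longrightarrow> t < \<tau> \<Longrightarrow> 0 \<le> x \<Longrightarrow> x \<le> X \<Longrightarrow> u \<delta> t x < 2 * B * exp (- k * x / \<delta>)"
        using initially_below_exponential[OF \<delta> ahead less_imp_le[OF k(2)], of X] by blast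
      define \<tau>' where "\<tau>' = min (\<tau> / 2) t"
      have \<tau>': "0 < \<tau>'" "\<tau>' < \<tau>" "\<tau>' \<le> t" using \<tau>(1) t(1) unfolding \<tau>'_def by auto
      have "u \<delta> t q < exp_sum \<delta> (\<lambda>_ _. 1) ps t q"
      proof (rule below_exponential_barrier[OF \<delta>, where \<tau> = \<tau>' and T = t and l = 0 and r = X and C = "\<lambda>_. c1"])
        fix t x assume x: "0 < x" "x < X"
        have "\<bar>\<delta> / 2 * b x * k\<bar> = \<delta> / 2 * (\<bar>b x\<bar> * k)" using \<delta> k by (simp add: abs_mult)
        also have "\<dots> \<le> \<delta> / 2 * (\<beta> * k)" using \<beta> x \<delta> k by (intro mult_left_mono mult_mono) auto
        also have "\<dots> < \<epsilon>" using elim(2) by (simp add: mult_ac)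
        finally have "\<bar>\<delta> / 2 * b x * k\<bar> < \<epsilon>" .
        then have "0 < \<mu> - (- k)\<^sup>2 / 2 - \<delta> / 2 * b x * (- k) - c1" "0 < \<mu> - k\<^sup>2 / 2 - \<delta> / 2 * b x * k - c1"
          using k(1) unfolding \<mu>_def abs_less_iff by auto
        then show "0 < exp_sum \<delta> (\<lambda>\<alpha> p. \<alpha> - p\<^sup>2 / 2 - \<delta> / 2 * b x * p - c1) ps t x"
          unfolding exp_sum_ps using B_ge_1 pos by (intro mult_pos_pos add_pos_pos) auto
      next
        fix x assume x: "0 \<le> x" "x \<le> X"
        have "exp (- k * x / \<delta>) \<le> A1 \<tau>' x"
          unfolding A1_def exp_le_cancel_iff using \<delta> \<mu> \<tau>' by (intro divide_right_mono) auto
        also have "\<dots> \<le> A1 \<tau>' x + A2 \<tau>' x" using pos[of \<tau>' x] by linarith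
        finally have "2 * B * exp (- k * x / \<delta>) \<le> 6 * B * (A1 \<tau>' x + A2 \<tau>' x)"
          using B_ge_1 pos by (intro mult_mono) auto
        then show "u \<delta> \<tau>' x < exp_sum \<delta> (\<lambda>_ _. 1) ps \<tau>' x"
          unfolding exp_sum_ps using \<tau>(2)[OF \<tau>'(1,2) x] by simp
      next
        fix s assume "\<tau>' \<le> s" "s \<le> t"
        then have s: "0 < s" using \<tau>'(1) by linarith
        have "1 \<le> A1 s 0" unfolding A1_def using \<delta> s \<mu> by simp
        then have "6 * B * 1 \<le> 6 * B * (A1 s 0 + A2 s 0)"
          using pos[of s 0] B_ge_1 by (intro mult_left_mono) auto
        moreover have "u \<delta> s X < 6 * B * A2 s X"
        proof (cases "s \<le> T0")
          case True
          then show ?thesis using elim(1) s unfolding A2_def \<mu>_def by simp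
        next
          case False
          then have "1 \<le> A2 s X" unfolding A2_def using \<delta> \<mu> by simp
          then have "6 * B * 1 \<le> 6 * B * A2 s X" using B_ge_1 by (intro mult_left_mono) auto
          moreover have "u \<delta> s X \<le> B" using bounds[OF \<delta>, of s X] s by simp
          ultimately show ?thesis using B_ge_1 by linarith
        qed
        moreover have "6 * B * A2 s X \<le> 6 * B * (A1 s X + A2 s X)"
          using pos[of s X] B_ge_1 by (intro mult_left_mono) auto
        moreover have "exp_sum \<delta> (\<lambda>_ _. 1) ps s 0 = 6 * B * (A1 s 0 + A2 s 0)"
          "exp_sum \<delta> (\<lambda>_ _. 1) ps s X = 6 * B * (A1 s X + A2 s X)"
          unfolding exp_sum_ps by simp_all
        moreover have "u \<delta> s 0 \<le> B" using bounds[OF \<delta> less_imp_le[OF s], of 0] by simp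
        ultimately show "u \<delta> s 0 < exp_sum \<delta> (\<lambda>_ _. 1) ps s 0 \<and> u \<delta> s X < exp_sum \<delta> (\<lambda>_ _. 1) ps s X"
          using B_ge_1 by (intro conjI; linarith)
      qed (use \<tau>' t q rate1 in auto)
      also have "\<dots> \<le> 6 * B * (2 * exp (- \<sigma> / \<delta>))"
      proof -
        have "\<mu> * t \<le> \<mu> * s" using t \<mu> by simp
        moreover have "\<sigma> \<le> k * q - \<mu> * s" "\<sigma> \<le> k * (X - q) - \<mu> * (s - T0)" unfolding \<sigma>_def by auto
        ultimately have "\<mu> * t - k * q \<le> - \<sigma>" "\<mu> * (t - T0) - k * (X - q) \<le> - \<sigma>"
          unfolding right_diff_distrib[of \<mu>] by linarith+
        then have "A1 t q \<le> exp (- \<sigma> / \<delta>)" "A2 t q \<le> exp (- \<sigma> / \<delta>)"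
          unfolding A1_def A2_def exp_le_cancel_iff by (intro divide_right_mono; use \<delta> in simp)+
        then show ?thesis unfolding exp_sum_ps using B_ge_1 by (intro mult_left_mono) auto
      qed
      finally show ?case by simp
    qed
  qed
  have lim: "((\<lambda>\<delta>. 12 * B * exp (- \<sigma> / \<delta>)) \<longlongrightarrow> 0) (at_right 0)"
  proof (rule order_tendstoI)
    fix a :: real assume "a < 0"
    then show "\<forall>\<^sub>F \<delta> in at_right 0. a < 12 * B * exp (- \<sigma> / \<delta>)"
      using B_ge_1 by (intro always_eventually) (auto intro: less_trans)
  next
    fix a :: real assume a: "0 < a"
    have "\<forall>\<^sub>F \<delta> in at_right 0. exp (- \<sigma> / \<delta>) < a / (12 * B)"
      using \<sigma> a B_ge_1 by (intro eventually_exp_less) auto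
    then show "\<forall>\<^sub>F \<delta> in at_right 0. 12 * B * exp (- \<sigma> / \<delta>) < a"
      by eventually_elim (use B_ge_1 in \<open>simp add: field_simps\<close>)
  qed
  show ?thesis
  proof (rule tendsto_sandwich[OF _ main tendsto_const lim])
    show "\<forall>\<^sub>F \<delta> in at_right 0. 0 \<le> u \<delta> t q"
      using eventually_at_right_less[of "0::real"] by eventually_elim (use bounds t in auto)
  qed
qed

text \<open>
  Above the level \<open>1 + \<eta>\<close> the reaction consumes at the rate \<open>\<kappa> / \<delta>\<close>, which outweighs every smooth
  barrier once \<open>\<delta>\<close> is small. A paraboloid is enough that exceeds \<open>B\<close> on the sides and for early times
  and has the value \<open>1 + \<eta>\<close> at \<open>(s, y)\<close>.
\<close>
lemma eventually_below_one_plus: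
  assumes s: "0 < s" and h: "0 < h" and \<eta>: "0 < \<eta>" and \<kappa>: "0 < \<kappa>"
    and rate: "\<And>x v. \<bar>x - y\<bar> < h \<Longrightarrow> 1 + \<eta> \<le> v \<Longrightarrow> v \<le> B \<Longrightarrow> g x v \<le> - \<kappa>"
  shows "\<forall>\<^sub>F \<delta> in at_right 0. u \<delta> s y < 1 + \<eta>"
proof -
  obtain \<beta> where \<beta>: "0 \<le> \<beta>" "\<And>x. y - h \<le> x \<Longrightarrow> x \<le> y + h \<Longrightarrow> \<bar>b x\<bar> \<le> \<beta>"
    by (rule drift_bounded_on[of "y - h" "y + h"]) blast
  have "((\<lambda>\<delta>. \<delta> * (\<delta> * (B / h\<^sup>2 + \<beta> * B / h) + B / s)) \<longlongrightarrow> 0 * (0 * (B / h\<^sup>2 + \<beta> * B / h) + B / s)) (at_right 0)"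
    by (intro tendsto_intros)
  then have "\<forall>\<^sub>F \<delta> in at_right 0. \<delta> * (\<delta> * (B / h\<^sup>2 + \<beta> * B / h) + B / s) < \<kappa>"
    by (rule order_tendstoD(2)) (use \<kappa> in simp)
  moreover have "\<forall>\<^sub>F \<delta> in at_right 0. (0::real) < \<delta>" by (simp add: eventually_at_right_less)
  ultimately show ?thesis
  proof eventually_elim
    case (elim \<delta>)
    have \<delta>: "0 < \<delta>" by fact
    define w where "w t x = 1 + \<eta> + B / h\<^sup>2 * (x - y)\<^sup>2 + B / s * (s - t)" for t x
    define \<tau> where "\<tau> = s / (2 * B)"
    have \<tau>: "0 < \<tau>" "\<tau> \<le> s" using s B_ge_1 unfolding \<tau>_def by (auto simp: field_simps)
    have "u \<delta> s y < w s y"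
    proof (rule below_supersolution[OF \<delta> \<tau>, where l = "y - h" and r = "y + h"
          and wt = "\<lambda>_ _. - B / s" and wx = "\<lambda>_ x. 2 * (B / h\<^sup>2) * (x - y)" and wxx = "\<lambda>_ _. 2 * (B / h\<^sup>2)"])
      show "continuous_on ({\<tau>..s} \<times> {y - h..y + h}) (\<lambda>(t, x). w t x)"
        unfolding w_def case_prod_unfold by (intro continuous_intros)
      show "((\<lambda>s. w s x) has_real_derivative - B / s) (at t)" for t x
        unfolding w_def using s by (auto intro!: derivative_eq_intros)
      show "(w t has_real_derivative 2 * (B / h\<^sup>2) * (x - y)) (at x)" for t x
        unfolding w_def using h by (auto intro!: derivative_eq_intros simp: field_simps power2_eq_square)
      show "((\<lambda>x. 2 * (B / h\<^sup>2) * (x - y)) has_real_derivative 2 * (B / h\<^sup>2)) (at x)" for x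
        using h by (auto intro!: derivative_eq_intros simp: field_simps power2_eq_square)
    next
      fix x
      have "B / s * (s - \<tau>) = B - 1 / 2" using s B_ge_1 unfolding \<tau>_def by (simp add: field_simps)
      moreover have "0 \<le> B / h\<^sup>2 * (x - y)\<^sup>2" using B_ge_1 by simp
      ultimately show "u \<delta> \<tau> x < w \<tau> x" using bounds[OF \<delta>, of \<tau> x] \<tau> \<eta> unfolding w_def by linarith
    next
      fix t assume t: "\<tau> \<le> t" "t \<le> s"
      have "0 \<le> B / s * (s - t)" using t s B_ge_1 by simp
      moreover have "B / h\<^sup>2 * (y - h - y)\<^sup>2 = B" "B / h\<^sup>2 * (y + h - y)\<^sup>2 = B" using h by simp_all
      moreover have "u \<delta> t (y - h) \<le> B" "u \<delta> t (y + h) \<le> B"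
        using bounds[OF \<delta>, of t "y - h"] bounds[OF \<delta>, of t "y + h"] t \<tau> by simp_all
      ultimately show "u \<delta> t (y - h) < w t (y - h) \<and> u \<delta> t (y + h) < w t (y + h)"
        using \<eta> unfolding w_def by linarith
    next
      fix t x assume t: "\<tau> < t" "t \<le> s" and x: "y - h < x" "x < y + h" and eq: "u \<delta> t x = w t x"
      have xy: "\<bar>x - y\<bar> < h" using x by (simp add: abs_less_iff)
      have "0 \<le> B / s * (s - t)" "0 \<le> B / h\<^sup>2 * (x - y)\<^sup>2" using t s B_ge_1 by auto
      then have w1: "1 + \<eta> \<le> w t x" unfolding w_def by linarith
      have wB: "w t x \<le> B" using eq bounds[OF \<delta>, of t x] t \<tau> by simp
      have "g x (w t x) * w t x \<le> - \<kappa> * w t x" using rate[OF xy w1 wB] w1 \<eta> by (intro mult_right_mono) auto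
      also have "\<dots> \<le> - \<kappa> * 1" using w1 \<eta> \<kappa> by (intro mult_left_mono_neg) auto
      finally have "1 / \<delta> * (g x (w t x) * w t x) \<le> 1 / \<delta> * (- \<kappa>)" using \<delta> by (intro mult_left_mono) auto
      moreover have "b x * (x - y) \<le> \<beta> * h"
      proof -
        have "\<bar>b x * (x - y)\<bar> \<le> \<beta> * h" unfolding abs_mult using \<beta> x xy by (intro mult_mono) auto
        then show ?thesis by linarith
      qed
      then have "\<delta> * (B / h\<^sup>2) * (b x * (x - y)) \<le> \<delta> * (B / h\<^sup>2) * (\<beta> * h)"
        using \<delta> B_ge_1 by (intro mult_left_mono) auto
      moreover have "\<delta> * (B / h\<^sup>2) * (\<beta> * h) = \<delta> * (\<beta> * B / h)" using h by (simp add: field_simps power2_eq_square)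
      moreover have "\<delta> * (B / h\<^sup>2 + \<beta> * B / h) + B / s < \<kappa> / \<delta>" using elim(1) \<delta> by (simp add: pos_less_divide_eq mult.commute)
      then have "\<delta> * (B / h\<^sup>2) + \<delta> * (\<beta> * B / h) + B / s < 1 / \<delta> * \<kappa>" by (simp add: distrib_left)
      ultimately show "\<delta> / 2 * (2 * (B / h\<^sup>2)) + \<delta> / 2 * b x * (2 * (B / h\<^sup>2) * (x - y)) + 1 / \<delta> * g x (w t x) * w t x < - B / s"
        by (simp add: algebra_simps)
    qed (use h \<tau> in auto)
    then show ?case unfolding w_def by simp
  qed
qed

section \<open>Spreading of the excitation\<close>

text \<open>
  A lower bound travels with speed \<open>\<nu>\<close>, and its amplitude changes at the exponential rate
  \<open>c - \<nu>\<^sup>2 / 2\<close>, up to the errors \<open>\<epsilon>\<close> and \<open>h\<close>. The barrier is \<open>E - E\<^sub>+ - E\<^sub>-\<close> with a subsolution \<open>E\<close>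
  of slope \<open>- \<nu>\<close> and supersolutions \<open>E\<^sub>+\<close> and \<open>E\<^sub>-\<close> of the slopes \<open>- \<nu> + \<theta>\<close> and \<open>- \<nu> - \<theta>\<close>; as the
  linearised equation is linear, this difference is a subsolution. In the moving coordinate \<open>\<xi>\<close> it
  equals \<open>E (1 - 2 cosh (\<theta> \<xi> / \<delta>) exp (\<dots>))\<close> and is negative for \<open>\<bar>\<xi>\<bar> \<ge> h\<close>, so that nothing has to
  be known about the solution there beyond its sign.
  
  The condition \<open>cap\<close> keeps the bump below the level \<open>M\<close> up to which the reaction rate is at least \<open>c\<close>.
  The times \<open>ts\<close> and \<open>\<tau>\<close> are separate because the initial values are attained only in the limit: the
  bump is set off at \<open>ts = 0\<close>, but the comparison begins at a time \<open>\<tau> > 0\<close> that depends on \<open>\<delta>\<close>.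
\<close>
lemma bump_propagation:
  assumes \<delta>: "0 < \<delta>" and T: "0 < T" and \<nu>: "0 \<le> \<nu>" and h: "0 < h"
    and \<epsilon>: "0 < \<epsilon>" "16 * \<epsilon> * T\<^sup>2 \<le> h\<^sup>2"
    and drift: "\<And>x. l < x \<Longrightarrow> x < r \<Longrightarrow> \<bar>b x\<bar> \<le> \<beta>" and small: "\<delta> / 2 * \<beta> * (\<nu> + h / (2 * T)) < \<epsilon>"
    and rate: "\<And>x v. l < x \<Longrightarrow> x < r \<Longrightarrow> 0 \<le> v \<Longrightarrow> v \<le> M \<Longrightarrow> c \<le> g x v"
    and room: "l \<le> z - h" "z + \<nu> * T + h \<le> r"
    and m: "0 < m" and bracket: "2 * exp (- h\<^sup>2 / (8 * T * \<delta>)) \<le> 1"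
    and cap: "\<And>\<sigma>. 0 \<le> \<sigma> \<Longrightarrow> \<sigma> \<le> T \<Longrightarrow> m * exp ((\<nu> * h + (c - \<nu>\<^sup>2 / 2 - \<epsilon>) * \<sigma>) / \<delta>) \<le> M"
    and \<tau>: "0 < \<tau>" "ts \<le> \<tau>" "\<tau> \<le> ts + T"
    and start: "\<And>x. \<bar>x - z - \<nu> * (\<tau> - ts)\<bar> < h \<Longrightarrow>
      m * exp ((\<nu> * h + (c - \<nu>\<^sup>2 / 2 - \<epsilon>) * (\<tau> - ts)) / \<delta>) < u \<delta> \<tau> x"
    and x: "\<bar>x - z - \<nu> * T\<bar> \<le> h / 4"
  shows "m * exp ((- \<nu> * h / 4 + (c - \<nu>\<^sup>2 / 2 - \<epsilon>) * T) / \<delta>) * (1 - 2 * exp (- h\<^sup>2 / (8 * T * \<delta>)))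
    < u \<delta> (ts + T) x"
proof -
  \<comment> \<open>With this slope at least half of the exponent \<open>\<theta> h\<close> is left after the time \<open>T\<close>, and a quarter
    of it at distance \<open>h / 4\<close> from the centre.\<close>
  define \<theta> where "\<theta> = h / (2 * T)"
  have \<theta>: "0 < \<theta>" using h T unfolding \<theta>_def by simp
  \<comment> \<open>An exponent of slope \<open>p\<close> that is anchored at the point \<open>z\<close> and the time \<open>ts\<close> and has the
    residual \<open>e\<close>.\<close>
  define \<alpha> where "\<alpha> p e = c + p\<^sup>2 / 2 + e" for p e :: real
  define entry where "entry m' p e k = (m', \<alpha> p e, p, - p * z - \<alpha> p e * ts + k)" for m' p e k :: real
  define ps where "ps = [entry m (- \<nu>) (- \<epsilon>) 0, entry (- m) (- \<nu> + \<theta>) \<epsilon> (- \<theta> * h), entry (- m) (- \<nu> - \<theta>) \<epsilon> (- \<theta> * h)]"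
  define w where "w = exp_sum \<delta> (\<lambda>_ _. 1) ps"
  define \<xi> where "\<xi> t x = x - z - \<nu> * (t - ts)" for t x
  define \<gamma> where "\<gamma> = c - \<nu>\<^sup>2 / 2 - \<epsilon>"
  define A where "A t x = exp ((- \<nu> * \<xi> t x + \<gamma> * (t - ts)) / \<delta>)" for t x
  define P where "P s t x = exp ((s * \<theta> * \<xi> t x + (\<theta>\<^sup>2 / 2 + 2 * \<epsilon>) * (t - ts) - \<theta> * h) / \<delta>)" for s t x
  have e1: "\<alpha> (- \<nu>) (- \<epsilon>) * t + (- \<nu>) * x + (- (- \<nu>) * z - \<alpha> (- \<nu>) (- \<epsilon>) * ts + 0)
      = - \<nu> * \<xi> t x + \<gamma> * (t - ts)" for t x
    unfolding \<alpha>_def \<xi>_def \<gamma>_def by (simp add: field_simps power2_eq_square)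
  have e2: "\<alpha> (- \<nu> + \<theta>) \<epsilon> * t + (- \<nu> + \<theta>) * x + (- (- \<nu> + \<theta>) * z - \<alpha> (- \<nu> + \<theta>) \<epsilon> * ts + - \<theta> * h)
      = (- \<nu> * \<xi> t x + \<gamma> * (t - ts)) + (1 * \<theta> * \<xi> t x + (\<theta>\<^sup>2 / 2 + 2 * \<epsilon>) * (t - ts) - \<theta> * h)" for t x
    unfolding \<alpha>_def \<xi>_def \<gamma>_def by (simp add: field_simps power2_eq_square)
  have e3: "\<alpha> (- \<nu> - \<theta>) \<epsilon> * t + (- \<nu> - \<theta>) * x + (- (- \<nu> - \<theta>) * z - \<alpha> (- \<nu> - \<theta>) \<epsilon> * ts + - \<theta> * h)
      = (- \<nu> * \<xi> t x + \<gamma> * (t - ts)) + ((- 1) * \<theta> * \<xi> t x + (\<theta>\<^sup>2 / 2 + 2 * \<epsilon>) * (t - ts) - \<theta> * h)" for t x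
    unfolding \<alpha>_def \<xi>_def \<gamma>_def by (simp add: field_simps power2_eq_square)
  have exp_sum_ps: "exp_sum \<delta> F ps t x = m * F (\<alpha> (- \<nu>) (- \<epsilon>)) (- \<nu>) * A t x
      - m * F (\<alpha> (- \<nu> + \<theta>) \<epsilon>) (- \<nu> + \<theta>) * (A t x * P 1 t x)
      - m * F (\<alpha> (- \<nu> - \<theta>) \<epsilon>) (- \<nu> - \<theta>) * (A t x * P (- 1) t x)" for F t x
    unfolding ps_def entry_def exp_sum_simps e1 e2 e3 A_def P_def
    by (simp only: add_divide_distrib exp_add)
  have w: "w t x = m * A t x * (1 - P 1 t x - P (- 1) t x)" for t x
    unfolding w_def exp_sum_ps by (simp add: algebra_simps)
  have Apos: "A t x > 0" and Ppos: "P s t x > 0" for s t x unfolding A_def P_def by auto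
  have outside: "w t x < 0" if "ts \<le> t" "h \<le> \<bar>\<xi> t x\<bar>" for t x
  proof -
    obtain s where s: "s = 1 \<or> s = - 1" "s * \<xi> t x = \<bar>\<xi> t x\<bar>" 
      by (rule that[of "if \<xi> t x \<ge> 0 then 1 else - 1"]) auto
    have "\<theta> * h \<le> \<theta> * (s * \<xi> t x)" using that(2) s(2) \<theta> by simp
    moreover have "0 \<le> (\<theta>\<^sup>2 / 2 + 2 * \<epsilon>) * (t - ts)" using that(1) \<epsilon> by simp
    ultimately have "0 \<le> s * \<theta> * \<xi> t x + (\<theta>\<^sup>2 / 2 + 2 * \<epsilon>) * (t - ts) - \<theta> * h" by (simp add: mult_ac)
    then have "1 \<le> P s t x" unfolding P_def using \<delta> by simp
    then have "1 - P 1 t x - P (- 1) t x < 0"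
      using s(1) Ppos[of 1 t x] Ppos[of "- 1" t x] by auto
    then show ?thesis unfolding w using m Apos[of t x] by (simp add: mult_pos_neg)
  qed
  have inside: "w t x \<le> m * exp ((\<nu> * h + \<gamma> * (t - ts)) / \<delta>)" if "\<bar>\<xi> t x\<bar> < h" for t x
  proof -
    have "\<nu> * (- \<xi> t x) \<le> \<nu> * \<bar>\<xi> t x\<bar>" using \<nu> by (intro mult_left_mono) auto
    also have "\<dots> \<le> \<nu> * h" using that \<nu> by (simp add: mult_left_mono)
    finally have "A t x \<le> exp ((\<nu> * h + \<gamma> * (t - ts)) / \<delta>)" unfolding A_def using \<delta> by (simp add: divide_right_mono)
    moreover have "w t x \<le> m * A t x"
      unfolding w using m Apos[of t x] Ppos[of 1 t x] Ppos[of "- 1" t x] by (intro mult_left_le) auto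
    moreover have "m * A t x \<le> m * exp ((\<nu> * h + \<gamma> * (t - ts)) / \<delta>)" using calculation(1) m by simp
    ultimately show ?thesis by linarith
  qed
  have "w (ts + T) x < u \<delta> (ts + T) x"
    unfolding w_def
  proof (rule above_exponential_barrier[where \<tau> = \<tau> and T = "ts + T" and l = l and r = r and M = M and c = c])
    have "0 \<le> \<nu> * T" using \<nu> T by simp
    then show "l \<le> r" using room h by linarith
    have "h / 4 \<le> h" using h by simp
    with x have "\<bar>x - z - \<nu> * T\<bar> \<le> h" by linarith
    then show "l \<le> x" "x \<le> r" using room \<open>0 \<le> \<nu> * T\<close> unfolding abs_le_iff by linarith+
    fix t x assume t: "\<tau> < t" "t \<le> ts + T" and lxr: "l < x" "x < r"
    show "exp_sum \<delta> (\<lambda>_ _. 1) ps t x \<le> M"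
    proof (cases "\<bar>\<xi> t x\<bar> < h")
      case True
      have "w t x \<le> M" using inside[OF True] cap[of "t - ts"] t \<tau> unfolding \<gamma>_def by simp
      then show ?thesis unfolding w_def .
    next
      case False
      have "0 < M" using cap[of 0] m T by (smt (verit) exp_gt_zero mult_pos_pos)
      moreover have "w t x < 0" using outside[of t x] False t \<tau> by simp
      ultimately show ?thesis unfolding w_def by simp
    qed
    have \<beta>: "\<bar>\<delta> / 2 * b x * p\<bar> < \<epsilon>" if "\<bar>p\<bar> \<le> \<nu> + \<theta>" for p
    proof -
      have "\<bar>\<delta> / 2 * b x * p\<bar> = \<delta> / 2 * (\<bar>b x\<bar> * \<bar>p\<bar>)" using \<delta> by (simp add: abs_mult)
      also have "\<dots> \<le> \<delta> / 2 * (\<beta> * (\<nu> + \<theta>))"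
        using drift[OF lxr] that \<delta> \<nu> \<theta> by (intro mult_left_mono mult_mono) auto
      also have "\<dots> < \<epsilon>" using small unfolding \<theta>_def by (simp add: mult_ac)
      finally show ?thesis .
    qed
    have "\<bar>\<delta> / 2 * b x * (- \<nu>)\<bar> < \<epsilon>" "\<bar>\<delta> / 2 * b x * (- \<nu> + \<theta>)\<bar> < \<epsilon>" "\<bar>\<delta> / 2 * b x * (- \<nu> - \<theta>)\<bar> < \<epsilon>"
      by (rule \<beta>; use \<nu> \<theta> in auto)+
    then have neg: "- \<epsilon> - \<delta> / 2 * b x * (- \<nu>) < 0" "0 < \<epsilon> - \<delta> / 2 * b x * (- \<nu> + \<theta>)"
      "0 < \<epsilon> - \<delta> / 2 * b x * (- \<nu> - \<theta>)" unfolding abs_less_iff by linarith+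
    have r: "\<alpha> p e - p\<^sup>2 / 2 - \<delta> / 2 * b x * p - c = e - \<delta> / 2 * b x * p" for p e unfolding \<alpha>_def by simp
    have "m * (- \<epsilon> - \<delta> / 2 * b x * (- \<nu>)) * A t x < 0"
      using neg(1) m Apos[of t x] by (intro mult_neg_pos mult_pos_neg)
    moreover have "0 < m * (\<epsilon> - \<delta> / 2 * b x * (- \<nu> + \<theta>)) * (A t x * P 1 t x)"
      using neg(2) m Apos[of t x] Ppos by (intro mult_pos_pos)
    moreover have "0 < m * (\<epsilon> - \<delta> / 2 * b x * (- \<nu> - \<theta>)) * (A t x * P (- 1) t x)"
      using neg(3) m Apos[of t x] Ppos by (intro mult_pos_pos)
    ultimately show "exp_sum \<delta> (\<lambda>\<alpha> p. \<alpha> - p\<^sup>2 / 2 - \<delta> / 2 * b x * p - c) ps t x < 0"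
      unfolding exp_sum_ps r by linarith
  next
    fix x assume "l \<le> x" "x \<le> r"
    show "exp_sum \<delta> (\<lambda>_ _. 1) ps \<tau> x < u \<delta> \<tau> x"
    proof (cases "\<bar>\<xi> \<tau> x\<bar> < h")
      case True
      then show ?thesis using inside[OF True] start[of x] unfolding w_def \<xi>_def \<gamma>_def by simp
    next
      case False
      then show ?thesis using outside[of \<tau> x] \<tau> bounds[OF \<delta>, of \<tau> x] unfolding w_def by simp
    qed
  next
    fix t assume t: "\<tau> \<le> t" "t \<le> ts + T"
    have "0 \<le> \<nu> * (t - ts)" "\<nu> * (t - ts) \<le> \<nu> * T" using t \<tau> \<nu> by (auto intro: mult_left_mono)
    then have "h \<le> \<bar>\<xi> t l\<bar>" "h \<le> \<bar>\<xi> t r\<bar>" using room unfolding \<xi>_def by auto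
    then show "exp_sum \<delta> (\<lambda>_ _. 1) ps t l < u \<delta> t l \<and> exp_sum \<delta> (\<lambda>_ _. 1) ps t r < u \<delta> t r"
      using outside[of t l] outside[of t r] t \<tau> bounds[OF \<delta>, of t l] bounds[OF \<delta>, of t r]
      unfolding w_def by auto
  qed (use \<delta> \<tau> rate in auto)
  moreover have "m * exp ((- \<nu> * h / 4 + \<gamma> * T) / \<delta>) * (1 - 2 * exp (- h\<^sup>2 / (8 * T * \<delta>))) \<le> w (ts + T) x"
  proof -
    define \<eta> where "\<eta> = \<xi> (ts + T) x"
    have \<eta>: "\<bar>\<eta>\<bar> \<le> h / 4" using x unfolding \<eta>_def \<xi>_def by simp
    then have "\<nu> * \<eta> \<le> \<nu> * (h / 4)" using \<nu> by (intro mult_left_mono) auto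
    then have A: "exp ((- \<nu> * h / 4 + \<gamma> * T) / \<delta>) \<le> A (ts + T) x"
      unfolding A_def \<eta>_def[symmetric] using \<delta> by (simp add: divide_right_mono)
    have "P s (ts + T) x \<le> exp (- h\<^sup>2 / (8 * T * \<delta>))" if "s = 1 \<or> s = - 1" for s
    proof -
      have "s * \<eta> \<le> h / 4" using \<eta> that by (auto simp: abs_le_iff)
      then have "\<theta> * (s * \<eta>) \<le> \<theta> * (h / 4)" using \<theta> by (intro mult_left_mono) auto
      moreover have "\<theta> * (h / 4) = h\<^sup>2 / (8 * T)" "\<theta> * h = h\<^sup>2 / (2 * T)" "\<theta>\<^sup>2 / 2 * T = h\<^sup>2 / (8 * T)"
        using T unfolding \<theta>_def by (simp_all add: field_simps power2_eq_square)
      moreover have "2 * \<epsilon> * T \<le> h\<^sup>2 / (8 * T)" using \<epsilon>(2) T by (simp add: field_simps power2_eq_square)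
      moreover have "h\<^sup>2 / (2 * T) = 4 * (h\<^sup>2 / (8 * T))" using T by (simp add: field_simps)
      ultimately have "s * \<theta> * \<eta> + (\<theta>\<^sup>2 / 2 + 2 * \<epsilon>) * T - \<theta> * h \<le> - (h\<^sup>2 / (8 * T))"
        by (simp add: algebra_simps)
      then have "(s * \<theta> * \<eta> + (\<theta>\<^sup>2 / 2 + 2 * \<epsilon>) * T - \<theta> * h) / \<delta> \<le> - (h\<^sup>2 / (8 * T)) / \<delta>"
        using \<delta> by (intro divide_right_mono) auto
      then show ?thesis unfolding P_def \<eta>_def by (simp add: mult.commute)
    qed
    from this[of 1] this[of "- 1"]
    have "1 - 2 * exp (- h\<^sup>2 / (8 * T * \<delta>)) \<le> 1 - P 1 (ts + T) x - P (- 1) (ts + T) x" by simp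
    then show ?thesis unfolding w using A m bracket Apos[of "ts + T" x] by (intro mult_mono) auto
  qed
  ultimately show ?thesis unfolding \<gamma>_def by simp
qed

lemma bump_propagation_eventually:
  assumes T: "0 < T" and \<nu>: "0 \<le> \<nu>" and h: "0 < h" and \<omega>: "0 < \<omega>" and e: "0 < e" "e < 1"
    and rate: "\<And>x v. l < x \<Longrightarrow> x < r \<Longrightarrow> 0 \<le> v \<Longrightarrow> v \<le> M \<Longrightarrow> c \<le> g x v"
    and room: "l \<le> z - h" "z + \<nu> * T + h \<le> r"
  shows "\<exists>\<epsilon>. 0 < \<epsilon> \<and> \<epsilon> \<le> \<omega> \<and> (\<forall>\<^sub>F \<delta> in at_right 0. \<forall>m ts \<tau>. 0 < m \<longrightarrow>
    (\<forall>\<sigma>. 0 \<le> \<sigma> \<longrightarrow> \<sigma> \<le> T \<longrightarrow> m * exp ((\<nu> * h + (c - \<nu>\<^sup>2 / 2 - \<epsilon>) * \<sigma>) / \<delta>) \<le> M) \<longrightarrow>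
    0 < \<tau> \<longrightarrow> ts \<le> \<tau> \<longrightarrow> \<tau> \<le> ts + T \<longrightarrow>
    (\<forall>x. \<bar>x - z - \<nu> * (\<tau> - ts)\<bar> < h \<longrightarrow>
      m * exp ((\<nu> * h + (c - \<nu>\<^sup>2 / 2 - \<epsilon>) * (\<tau> - ts)) / \<delta>) < u \<delta> \<tau> x) \<longrightarrow>
    (\<forall>x. \<bar>x - z - \<nu> * T\<bar> \<le> h / 4 \<longrightarrow>
      m * exp ((- \<nu> * h / 4 + (c - \<nu>\<^sup>2 / 2 - \<epsilon>) * T) / \<delta>) * (1 - e) < u \<delta> (ts + T) x))"
proof -
  define \<epsilon> where "\<epsilon> = min \<omega> (h\<^sup>2 / (16 * T\<^sup>2))"
  have \<epsilon>: "0 < \<epsilon>" "\<epsilon> \<le> \<omega>" using \<omega> h T unfolding \<epsilon>_def by auto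
  have "\<epsilon> \<le> h\<^sup>2 / (16 * T\<^sup>2)" unfolding \<epsilon>_def by (rule min.cobounded2)
  then have \<epsilon>3: "16 * \<epsilon> * T\<^sup>2 \<le> h\<^sup>2" using T by (simp add: field_simps)
  obtain \<beta> where \<beta>: "0 \<le> \<beta>" "\<And>x. l \<le> x \<Longrightarrow> x \<le> r \<Longrightarrow> \<bar>b x\<bar> \<le> \<beta>"
    by (rule drift_bounded_on[of l r]) blast
  have "\<forall>\<^sub>F \<delta> in at_right 0. \<delta> * (\<beta> * (\<nu> + h / (2 * T)) / 2) < \<epsilon>" using \<epsilon>(1) by (rule eventually_mult_less)
  moreover have "\<forall>\<^sub>F \<delta> in at_right 0. exp (- (h\<^sup>2 / (8 * T)) / \<delta>) < e / 2"
    using h T e by (intro eventually_exp_less) auto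
  moreover have "\<forall>\<^sub>F \<delta> in at_right 0. (0::real) < \<delta>" by (simp add: eventually_at_right_less)
  ultimately have "\<forall>\<^sub>F \<delta> in at_right 0. \<forall>m ts \<tau>. 0 < m \<longrightarrow>
    (\<forall>\<sigma>. 0 \<le> \<sigma> \<longrightarrow> \<sigma> \<le> T \<longrightarrow> m * exp ((\<nu> * h + (c - \<nu>\<^sup>2 / 2 - \<epsilon>) * \<sigma>) / \<delta>) \<le> M) \<longrightarrow>
    0 < \<tau> \<longrightarrow> ts \<le> \<tau> \<longrightarrow> \<tau> \<le> ts + T \<longrightarrow>
    (\<forall>x. \<bar>x - z - \<nu> * (\<tau> - ts)\<bar> < h \<longrightarrow>
      m * exp ((\<nu> * h + (c - \<nu>\<^sup>2 / 2 - \<epsilon>) * (\<tau> - ts)) / \<delta>) < u \<delta> \<tau> x) \<longrightarrow>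
    (\<forall>x. \<bar>x - z - \<nu> * T\<bar> \<le> h / 4 \<longrightarrow>
      m * exp ((- \<nu> * h / 4 + (c - \<nu>\<^sup>2 / 2 - \<epsilon>) * T) / \<delta>) * (1 - e) < u \<delta> (ts + T) x)"
  proof eventually_elim
    case (elim \<delta>)
    have \<delta>: "0 < \<delta>" by fact
    have ex: "exp (- h\<^sup>2 / (8 * T * \<delta>)) < e / 2" using elim(2) by (simp add: mult.commute)
    have drift: "\<And>x. l < x \<Longrightarrow> x < r \<Longrightarrow> \<bar>b x\<bar> \<le> \<beta>" using \<beta>(2) by simp
    have small: "\<delta> / 2 * \<beta> * (\<nu> + h / (2 * T)) < \<epsilon>" using elim(1) by (simp add: mult_ac)
    have bracket: "2 * exp (- h\<^sup>2 / (8 * T * \<delta>)) \<le> 1" using ex e by linarith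
    show ?case
    proof (intro allI impI)
      fix m ts \<tau> x
      assume m: "0 < m"
        and cap: "\<forall>\<sigma>. 0 \<le> \<sigma> \<longrightarrow> \<sigma> \<le> T \<longrightarrow> m * exp ((\<nu> * h + (c - \<nu>\<^sup>2 / 2 - \<epsilon>) * \<sigma>) / \<delta>) \<le> M"
        and \<tau>: "0 < \<tau>" "ts \<le> \<tau>" "\<tau> \<le> ts + T"
        and start: "\<forall>x. \<bar>x - z - \<nu> * (\<tau> - ts)\<bar> < h \<longrightarrow>
          m * exp ((\<nu> * h + (c - \<nu>\<^sup>2 / 2 - \<epsilon>) * (\<tau> - ts)) / \<delta>) < u \<delta> \<tau> x"
        and x: "\<bar>x - z - \<nu> * T\<bar> \<le> h / 4"
      have "m * exp ((- \<nu> * h / 4 + (c - \<nu>\<^sup>2 / 2 - \<epsilon>) * T) / \<delta>) * (1 - e)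
        \<le> m * exp ((- \<nu> * h / 4 + (c - \<nu>\<^sup>2 / 2 - \<epsilon>) * T) / \<delta>) * (1 - 2 * exp (- h\<^sup>2 / (8 * T * \<delta>)))"
        using ex m by (intro mult_left_mono) auto
      also have "\<dots> < u \<delta> (ts + T) x"
        by (rule bump_propagation[OF \<delta> T \<nu> h \<epsilon>(1) \<epsilon>3 drift small rate room m bracket _ \<tau> _ x])
          (use cap start in auto)
      finally show "m * exp ((- \<nu> * h / 4 + (c - \<nu>\<^sup>2 / 2 - \<epsilon>) * T) / \<delta>) * (1 - e) < u \<delta> (ts + T) x" .
    qed
  qed
  then show ?thesis using \<epsilon> by blast
qed

text \<open>
  A bump at rest, normalised so that it reaches the level \<open>M\<close> at the time \<open>ts + T\<close>. It serves twice:
  with a small level \<open>M\<close> and the rate at \<open>u = 0\<close>, and with a level close to \<open>1\<close> and whatever positive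
  rate is available below this level.
\<close>
lemma growth_in_place:
  assumes T: "0 < T" and h: "0 < h" and e: "0 < e" "e < 1" and c: "0 < c'" "c' < c" and M: "0 < M"
    and rate: "\<And>x v. \<bar>x - y\<bar> < h \<Longrightarrow> 0 \<le> v \<Longrightarrow> v \<le> M \<Longrightarrow> c \<le> g x v"
  shows "\<forall>\<^sub>F \<delta> in at_right 0. \<forall>ts>0. (\<forall>x. \<bar>x - y\<bar> < h \<longrightarrow> M * exp (- (c' * T) / \<delta>) < u \<delta> ts x) \<longrightarrow>
    (\<forall>x. \<bar>x - y\<bar> \<le> h / 4 \<longrightarrow> M * (1 - e) < u \<delta> (ts + T) x)"
proof -
  have rate': "c \<le> g x v" if "y - h < x" "x < y + h" "0 \<le> v" "v \<le> M" for x v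
    using that by (intro rate) (auto simp: abs_less_iff)
  have cc: "0 < c - c'" and room: "y - h \<le> y - h" "y + 0 * T + h \<le> y + h" using c by simp_all
  obtain \<epsilon> where \<epsilon>: "0 < \<epsilon>" "\<epsilon> \<le> c - c'" and ev: "\<forall>\<^sub>F \<delta> in at_right 0. \<forall>m ts \<tau>. 0 < m \<longrightarrow>
    (\<forall>\<sigma>. 0 \<le> \<sigma> \<longrightarrow> \<sigma> \<le> T \<longrightarrow> m * exp ((0 * h + (c - 0\<^sup>2 / 2 - \<epsilon>) * \<sigma>) / \<delta>) \<le> M) \<longrightarrow>
    0 < \<tau> \<longrightarrow> ts \<le> \<tau> \<longrightarrow> \<tau> \<le> ts + T \<longrightarrow>
    (\<forall>x. \<bar>x - y - 0 * (\<tau> - ts)\<bar> < h \<longrightarrow>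
      m * exp ((0 * h + (c - 0\<^sup>2 / 2 - \<epsilon>) * (\<tau> - ts)) / \<delta>) < u \<delta> \<tau> x) \<longrightarrow>
    (\<forall>x. \<bar>x - y - 0 * T\<bar> \<le> h / 4 \<longrightarrow>
      m * exp ((- 0 * h / 4 + (c - 0\<^sup>2 / 2 - \<epsilon>) * T) / \<delta>) * (1 - e) < u \<delta> (ts + T) x)"
    using bump_propagation_eventually[OF T order_refl h cc e rate' room] by blast
  show ?thesis
    using ev eventually_at_right_less[of "0::real"]
  proof eventually_elim
    case (elim \<delta>)
    have \<delta>: "0 < \<delta>" by fact
    define m where "m = M * exp (- ((c - \<epsilon>) * T) / \<delta>)"
    have c\<epsilon>: "c' \<le> c - \<epsilon>" "0 < c - \<epsilon>" using \<epsilon> c by auto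
    have m: "0 < m" using M unfolding m_def by simp
    have m_le: "m \<le> M * exp (- (c' * T) / \<delta>)"
      unfolding m_def using c\<epsilon> T \<delta> M by (intro mult_left_mono exp_le_cancel_iff[THEN iffD2] divide_right_mono) auto
    have m_eq: "m * exp ((c - \<epsilon>) * \<sigma> / \<delta>) = M * exp ((c - \<epsilon>) * (\<sigma> - T) / \<delta>)" for \<sigma>
    proof -
      have "- ((c - \<epsilon>) * T) / \<delta> + (c - \<epsilon>) * \<sigma> / \<delta> = (c - \<epsilon>) * (\<sigma> - T) / \<delta>"
        by (simp add: right_diff_distrib diff_divide_distrib)
      then show ?thesis unfolding m_def mult.assoc exp_add[symmetric] by simp
    qed
    show ?case
    proof (intro allI impI)
      fix ts x
      assume ts: "0 < ts" and start: "\<forall>x. \<bar>x - y\<bar> < h \<longrightarrow> M * exp (- (c' * T) / \<delta>) < u \<delta> ts x"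
        and x: "\<bar>x - y\<bar> \<le> h / 4"
      have "m * exp ((- 0 * h / 4 + (c - 0\<^sup>2 / 2 - \<epsilon>) * T) / \<delta>) * (1 - e) < u \<delta> (ts + T) x"
      proof (rule elim(1)[rule_format, OF m _ ts order_refl])
        fix \<sigma> assume \<sigma>: "0 \<le> \<sigma>" "\<sigma> \<le> T"
        have "(c - \<epsilon>) * (\<sigma> - T) / \<delta> \<le> 0" using \<sigma> c\<epsilon> \<delta> by (simp add: mult_nonneg_nonpos divide_nonpos_pos)
        then have "M * exp ((c - \<epsilon>) * (\<sigma> - T) / \<delta>) \<le> M * 1" using M by (intro mult_left_mono) auto
        then show "m * exp ((0 * h + (c - 0\<^sup>2 / 2 - \<epsilon>) * \<sigma>) / \<delta>) \<le> M" using m_eq[of \<sigma>] by simp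
      next
        fix x assume "\<bar>x - y - 0 * (ts - ts)\<bar> < h"
        then have "M * exp (- (c' * T) / \<delta>) < u \<delta> ts x" using start by simp
        then show "m * exp ((0 * h + (c - 0\<^sup>2 / 2 - \<epsilon>) * (ts - ts)) / \<delta>) < u \<delta> ts x" using m_le by simp
      qed (use T x in auto)
      then show "M * (1 - e) < u \<delta> (ts + T) x" using m_eq[of T] by simp
    qed
  qed
qed

text \<open>
  Travelling with speed \<open>\<nu>\<close> costs \<open>\<nu>\<^sup>2 / 2 - d1 = d2 - 2 d1\<close> per unit of time, and the way from the
  support of \<open>f\<close> to \<open>x2\<close> takes the time \<open>x2 / \<nu>\<close>, up to an arbitrarily small error.
\<close>
lemma arrival_at_interface:
  assumes behind: "\<And>y. y < 0 \<Longrightarrow> \<exists>z h \<kappa>. y < z - h \<and> z + h < 0 \<and> 0 < h \<and> 0 < \<kappa> \<and>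
      (\<forall>x\<in>{z - h..z + h}. isCont f x \<and> \<kappa> < f x)"
    and d: "0 < d1" "2 * d1 < d2" and x2: "0 < x2" and hs: "0 < hs" and \<eta>: "0 < \<eta>"
    and rate: "\<And>x v. - 1 < x \<Longrightarrow> x < x2 + hs \<Longrightarrow> 0 \<le> v \<Longrightarrow> v \<le> \<eta> \<Longrightarrow> d1 \<le> g x v"
    and \<nu>: "\<nu> = sqrt (2 * (d2 - d1))"
    and T': "x2 / \<nu> < T'" and \<Lambda>: "(d2 - 2 * d1) * (x2 / \<nu>) < \<Lambda>"
  shows "\<exists>T1 h1. 0 < T1 \<and> T1 < T' \<and> 0 < h1 \<and> h1 \<le> hs \<and>
    (\<forall>\<^sub>F \<delta> in at_right 0. \<forall>x. \<bar>x - x2\<bar> < h1 \<longrightarrow> exp (- \<Lambda> / \<delta>) < u \<delta> T1 x)"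
proof -
  have \<nu>2: "\<nu>\<^sup>2 = 2 * (d2 - d1)" and \<nu>0: "0 < \<nu>" using d unfolding \<nu> by auto
  have "((\<lambda>\<omega>. (d2 - 2 * d1 + \<omega>) * (x2 / \<nu> + \<omega>) + 2 * \<nu> * \<omega> + 2 * \<omega>) \<longlongrightarrow>
      (d2 - 2 * d1 + 0) * (x2 / \<nu> + 0) + 2 * \<nu> * 0 + 2 * 0) (at_right 0)" by (intro tendsto_intros)
  then have "\<forall>\<^sub>F \<omega> in at_right 0. (d2 - 2 * d1 + \<omega>) * (x2 / \<nu> + \<omega>) + 2 * \<nu> * \<omega> + 2 * \<omega> < \<Lambda>"
    by (rule order_tendstoD(2)) (use \<Lambda> in simp)
  moreover have "\<forall>\<^sub>F \<omega> in at_right 0. \<omega> * \<nu> < 1" by (intro eventually_mult_less) simp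
  moreover have "\<forall>\<^sub>F \<omega> in at_right 0. \<omega> * 1 < T' - x2 / \<nu>" using T' by (intro eventually_mult_less) simp
  moreover have "\<forall>\<^sub>F \<omega> in at_right 0. (0::real) < \<omega>" by (simp add: eventually_at_right_less)
  ultimately have "\<forall>\<^sub>F \<omega> in at_right 0. (d2 - 2 * d1 + \<omega>) * (x2 / \<nu> + \<omega>) + 2 * \<nu> * \<omega> + 2 * \<omega> < \<Lambda> \<and>
      \<omega> * \<nu> < 1 \<and> \<omega> < T' - x2 / \<nu> \<and> 0 < \<omega>" by eventually_elim simp
  then obtain \<omega> where \<omega>: "(d2 - 2 * d1 + \<omega>) * (x2 / \<nu> + \<omega>) + 2 * \<nu> * \<omega> + 2 * \<omega> < \<Lambda>"
      "\<omega> * \<nu> < 1" "\<omega> < T' - x2 / \<nu>" "0 < \<omega>"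
    using eventually_happens'[OF trivial_limit_at_right_real] by blast
  have "- (\<omega> * \<nu>) < 0" using \<omega> \<nu>0 by simp
  from behind[OF this] obtain z h0 \<kappa> where z: "- (\<omega> * \<nu>) < z - h0" "z + h0 < 0" "0 < h0" and \<kappa>: "0 < \<kappa>"
    and fz: "\<And>x. x \<in> {z - h0..z + h0} \<Longrightarrow> isCont f x \<and> f x \<in> {\<kappa><..}" by auto
  define T1 where "T1 = (x2 - z) / \<nu>"
  have "x2 - z < x2 + \<omega> * \<nu>" using z by linarith
  then have "T1 < (x2 + \<omega> * \<nu>) / \<nu>" unfolding T1_def using \<nu>0 by (intro divide_strict_right_mono)
  then have T1: "T1 < x2 / \<nu> + \<omega>" using \<nu>0 by (simp add: add_divide_distrib)
  have T1pos: "0 < T1" unfolding T1_def using \<nu>0 z x2 by simp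
  have \<nu>T1: "\<nu> * T1 = x2 - z" unfolding T1_def using \<nu>0 by simp
  define h1 where "h1 = min (h0 / 2) (min \<omega> hs)"
  have h1: "0 < h1" "h1 \<le> h0 / 2" "h1 \<le> \<omega>" "h1 \<le> hs" using z \<omega> hs unfolding h1_def by auto
  have "h1 \<le> h0" using h1 z(3) by linarith
  have half: "0 < (1 / 2 :: real)" "(1 / 2 :: real) < 1" by simp_all
  have room: "- 1 \<le> z - h1" "z + \<nu> * T1 + h1 \<le> x2 + hs" using z \<omega> \<open>h1 \<le> h0\<close> h1 \<nu>T1 by auto
  obtain \<epsilon> where \<epsilon>: "0 < \<epsilon>" "\<epsilon> \<le> \<omega>" and ev: "\<forall>\<^sub>F \<delta> in at_right 0. \<forall>m ts \<tau>. 0 < m \<longrightarrow>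
    (\<forall>\<sigma>. 0 \<le> \<sigma> \<longrightarrow> \<sigma> \<le> T1 \<longrightarrow> m * exp ((\<nu> * h1 + (d1 - \<nu>\<^sup>2 / 2 - \<epsilon>) * \<sigma>) / \<delta>) \<le> \<eta>) \<longrightarrow>
    0 < \<tau> \<longrightarrow> ts \<le> \<tau> \<longrightarrow> \<tau> \<le> ts + T1 \<longrightarrow>
    (\<forall>x. \<bar>x - z - \<nu> * (\<tau> - ts)\<bar> < h1 \<longrightarrow>
      m * exp ((\<nu> * h1 + (d1 - \<nu>\<^sup>2 / 2 - \<epsilon>) * (\<tau> - ts)) / \<delta>) < u \<delta> \<tau> x) \<longrightarrow>
    (\<forall>x. \<bar>x - z - \<nu> * T1\<bar> \<le> h1 / 4 \<longrightarrow>
      m * exp ((- \<nu> * h1 / 4 + (d1 - \<nu>\<^sup>2 / 2 - \<epsilon>) * T1) / \<delta>) * (1 - 1 / 2) < u \<delta> (ts + T1) x)"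
    using bump_propagation_eventually[OF T1pos less_imp_le[OF \<nu>0] h1(1) \<omega>(4) half rate room] by blast
  define \<gamma> where "\<gamma> = d1 - \<nu>\<^sup>2 / 2 - \<epsilon>"
  have \<gamma>: "\<gamma> = - (d2 - 2 * d1 + \<epsilon>)" unfolding \<gamma>_def \<nu>2 by (simp add: field_simps)
  then have \<gamma>_neg: "\<gamma> < 0" using d \<epsilon> by simp
  have exponent: "- (\<Lambda> - \<omega>) \<le> - (\<nu> * h1 + \<omega>) + (- \<nu> * h1 / 4 + \<gamma> * T1)"
  proof -
    have "(d2 - 2 * d1 + \<epsilon>) * T1 \<le> (d2 - 2 * d1 + \<omega>) * (x2 / \<nu> + \<omega>)"
      using T1 T1pos \<epsilon> d by (intro mult_mono) auto
    moreover have "\<nu> * h1 \<le> \<nu> * \<omega>" using h1 \<nu>0 by simp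
    moreover have "0 \<le> \<nu> * \<omega>" "0 \<le> \<nu> * h1" using \<nu>0 \<omega> h1 by auto
    ultimately show ?thesis using \<omega>(1) unfolding \<gamma> mult_minus_left by linarith
  qed
  have "\<forall>\<^sub>F \<delta> in at_right 0. exp (- \<omega> / \<delta>) < min \<eta> (min \<kappa> (1 / 2))"
    using \<omega>(4) \<eta> \<kappa> by (intro eventually_exp_less) auto
  moreover have "\<forall>\<^sub>F \<delta> in at_right 0. (0::real) < \<delta>" by (simp add: eventually_at_right_less)
  ultimately have "\<forall>\<^sub>F \<delta> in at_right 0. \<forall>x. \<bar>x - x2\<bar> < h1 / 4 \<longrightarrow> exp (- \<Lambda> / \<delta>) < u \<delta> T1 x"
    using ev
  proof eventually_elim
    case (elim \<delta>)
    have \<delta>: "0 < \<delta>" by fact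
    have small: "exp (- \<omega> / \<delta>) < \<eta>" "exp (- \<omega> / \<delta>) < \<kappa>" "exp (- \<omega> / \<delta>) < 1 / 2" using elim(1) by auto
    define m where "m = exp (- (\<nu> * h1 + \<omega>) / \<delta>)"
    have m_eq: "m * exp (w / \<delta>) = exp ((- (\<nu> * h1 + \<omega>) + w) / \<delta>)" for w
      unfolding m_def by (simp add: add_divide_distrib flip: exp_add)
    have m_small: "m * exp ((\<nu> * h1 + \<gamma> * \<sigma>) / \<delta>) \<le> exp (- \<omega> / \<delta>)" if "0 \<le> \<sigma>" for \<sigma>
    proof -
      have "\<gamma> * \<sigma> \<le> 0" using \<gamma>_neg that by (simp add: mult_nonpos_nonneg)
      then show ?thesis unfolding m_eq exp_le_cancel_iff using \<delta> by (intro divide_right_mono) auto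
    qed
    from initial_values_on_compact[where K = "{z - h0..z + h0}", OF \<delta> compact_Icc open_greaterThan fz]
    obtain \<tau>0 where \<tau>0: "0 < \<tau>0"
      "\<And>t x. 0 < t \<Longrightarrow> t < \<tau>0 \<Longrightarrow> x \<in> {z - h0..z + h0} \<Longrightarrow> \<kappa> < u \<delta> t x"
      unfolding greaterThan_iff by blast
    define \<tau> where "\<tau> = min (\<tau>0 / 2) (min T1 (h1 / \<nu>))"
    have \<tau>: "0 < \<tau>" "\<tau> < \<tau>0" "\<tau> \<le> T1" using \<tau>0(1) T1pos h1 \<nu>0 unfolding \<tau>_def by auto
    have "\<tau> \<le> h1 / \<nu>" unfolding \<tau>_def by simp
    then have \<nu>\<tau>: "\<nu> * \<tau> \<le> h1" using \<nu>0 by (simp add: field_simps)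
    show ?case
    proof (intro allI impI)
      fix x assume x: "\<bar>x - x2\<bar> < h1 / 4"
      have "m * exp ((- \<nu> * h1 / 4 + (d1 - \<nu>\<^sup>2 / 2 - \<epsilon>) * T1) / \<delta>) * (1 - 1 / 2) < u \<delta> (0 + T1) x"
      proof (rule elim(3)[THEN spec, of m, THEN spec, of 0, THEN spec, of \<tau>, rule_format])
        show "0 < m" unfolding m_def by simp
        fix \<sigma> :: real assume "0 \<le> \<sigma>"
        then show "m * exp ((\<nu> * h1 + (d1 - \<nu>\<^sup>2 / 2 - \<epsilon>) * \<sigma>) / \<delta>) \<le> \<eta>"
          using m_small[of \<sigma>] small unfolding \<gamma>_def by linarith
      next
        fix x assume x: "\<bar>x - z - \<nu> * (\<tau> - 0)\<bar> < h1"
        have "\<nu> * \<tau> \<ge> 0" using \<nu>0 \<tau> by simp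
        then have "x \<in> {z - h0..z + h0}" using x \<nu>\<tau> h1(2) by (auto simp: abs_less_iff)
        then have "\<kappa> < u \<delta> \<tau> x" using \<tau>0(2) \<tau> by blast
        then show "m * exp ((\<nu> * h1 + (d1 - \<nu>\<^sup>2 / 2 - \<epsilon>) * (\<tau> - 0)) / \<delta>) < u \<delta> \<tau> x"
          using m_small[of \<tau>] small \<tau> unfolding \<gamma>_def by simp
      qed (use \<tau> x \<nu>T1 in auto)
      then have bump: "m * exp ((- \<nu> * h1 / 4 + \<gamma> * T1) / \<delta>) * (1 / 2) < u \<delta> T1 x" unfolding \<gamma>_def by simp
      have "exp (- \<Lambda> / \<delta>) = exp (- (\<Lambda> - \<omega>) / \<delta>) * exp (- \<omega> / \<delta>)"
        by (simp add: diff_divide_distrib flip: exp_add)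
      also have "\<dots> \<le> exp (- (\<Lambda> - \<omega>) / \<delta>) * (1 / 2)"
        using small(3) by (intro mult_left_mono) auto
      also have "\<dots> \<le> m * exp ((- \<nu> * h1 / 4 + \<gamma> * T1) / \<delta>) * (1 / 2)"
        unfolding m_eq using exponent \<delta> by (intro mult_right_mono exp_le_cancel_iff[THEN iffD2] divide_right_mono) auto
      also note bump
      finally show "exp (- \<Lambda> / \<delta>) < u \<delta> T1 x" .
    qed
  qed
  moreover have "0 < h1 / 4" "h1 / 4 \<le> hs" "T1 < T'" using h1 T1 \<omega>(3) by auto
  ultimately show ?thesis using T1pos by blast
qed

text \<open>
  At the rate \<open>d2\<close> the loss \<open>(d2 - 2 d1) x2 / \<nu>\<close> of the journey is made up for in the time
  \<open>D = s - x2 / \<nu>\<close>. With the rate \<open>c' > d2\<close> a shorter time \<open>T2\<close> is enough, and the time \<open>T3\<close> that is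
  left takes the solution from the level \<open>\<eta> / 2\<close> to any level below \<open>1\<close>.
\<close>
lemma excited_at_interface:
  assumes behind: "\<And>y. y < 0 \<Longrightarrow> \<exists>z h \<kappa>. y < z - h \<and> z + h < 0 \<and> 0 < h \<and> 0 < \<kappa> \<and>
      (\<forall>x\<in>{z - h..z + h}. isCont f x \<and> \<kappa> < f x)"
    and d: "0 < d1" "2 * d1 < d2" and x2: "0 < x2" and hs: "0 < hs" and \<eta>: "0 < \<eta>" "\<eta> < 1" and \<epsilon>: "0 < \<epsilon>"
    and rate1: "\<And>x v. - 1 < x \<Longrightarrow> x < x2 + hs \<Longrightarrow> 0 \<le> v \<Longrightarrow> v \<le> \<eta> \<Longrightarrow> d1 \<le> g x v"
    and rate2: "\<And>x v. \<bar>x - x2\<bar> < hs \<Longrightarrow> 0 \<le> v \<Longrightarrow> v \<le> \<eta> \<Longrightarrow> d2 + \<epsilon> \<le> g x v"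
    and below1: "\<And>e. 0 < e \<Longrightarrow> e < 1 \<Longrightarrow> \<exists>\<kappa>>0. \<forall>x v. \<bar>x - x2\<bar> < hs \<longrightarrow> 0 \<le> v \<longrightarrow> v \<le> 1 - e \<longrightarrow> \<kappa> \<le> g x v"
    and above1: "\<And>e. 0 < e \<Longrightarrow> \<exists>\<kappa>>0. \<forall>x v. \<bar>x - x2\<bar> < hs \<longrightarrow> 1 + e \<le> v \<longrightarrow> v \<le> B \<longrightarrow> g x v \<le> - \<kappa>"
    and s: "s = x2 * (sqrt (2 * (d2 - d1)) / d2)"
  shows "((\<lambda>\<delta>. u \<delta> s x2) \<longlongrightarrow> 1) (at_right 0)"
proof -
  define \<nu> where "\<nu> = sqrt (2 * (d2 - d1))"
  have \<nu>2: "\<nu> * \<nu> = 2 * (d2 - d1)" and \<nu>0: "0 < \<nu>" using d unfolding \<nu>_def by auto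
  have spos: "0 < s" unfolding s \<nu>_def[symmetric] using \<nu>0 x2 d by simp
  define D where "D = s - x2 / \<nu>"
  have D: "d2 * D = (d2 - 2 * d1) * (x2 / \<nu>)"
  proof -
    have "d2 * s = (\<nu> * \<nu>) * (x2 / \<nu>)" unfolding s \<nu>_def[symmetric] using d \<nu>0 by simp
    then show ?thesis unfolding D_def \<nu>2 by (simp add: algebra_simps)
  qed
  have "0 < d2 * D" unfolding D using d x2 \<nu>0 by simp
  then have Dpos: "0 < D" using d by (simp add: zero_less_mult_iff)
  show ?thesis
  proof (rule order_tendstoI)
    fix a :: real assume "1 < a"
    then obtain \<kappa> where \<kappa>: "0 < \<kappa>" "\<And>x v. \<bar>x - x2\<bar> < hs \<Longrightarrow> 1 + (a - 1) \<le> v \<Longrightarrow> v \<le> B \<Longrightarrow> g x v \<le> - \<kappa>"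
      using above1[of "a - 1"] by auto
    have "\<forall>\<^sub>F \<delta> in at_right 0. u \<delta> s x2 < 1 + (a - 1)"
      by (rule eventually_below_one_plus[OF spos hs _ \<kappa>]) (use \<open>1 < a\<close> in auto)
    then show "\<forall>\<^sub>F \<delta> in at_right 0. u \<delta> s x2 < a" by simp
  next
    fix a :: real assume a: "a < 1"
    define e where "e = min (1 / 2) ((1 - a) / 2)"
    have e: "0 < e" "e < 1" using a unfolding e_def by auto
    have e2: "e \<le> (1 - a) / 2" unfolding e_def by (rule min.cobounded2)
    have "(1 - e) * (1 - e) = 1 - 2 * e + e * e" by (simp add: algebra_simps)
    moreover have "0 \<le> e * e" "2 * e \<le> 1 - a" using e2 by simp_all
    ultimately have ea: "a \<le> (1 - e) * (1 - e)" by linarith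
    obtain \<kappa> where \<kappa>: "0 < \<kappa>" "\<And>x v. \<bar>x - x2\<bar> < hs \<Longrightarrow> 0 \<le> v \<Longrightarrow> v \<le> 1 - e \<Longrightarrow> \<kappa> \<le> g x v"
      using below1[OF e(1,2)] by blast
    define c' where "c' = d2 + \<epsilon> / 2"
    have c': "0 < c'" "d2 < c'" "c' < d2 + \<epsilon>" using d \<epsilon> unfolding c'_def by auto
    have "d2 * D / c' < D" using c' Dpos by (simp add: pos_divide_less_eq)
    then obtain T2 where T2: "d2 * D / c' < T2" "T2 < D" using dense by blast
    have "0 < d2 * D / c'" using \<open>0 < d2 * D\<close> c' by simp
    then have T2pos: "0 < T2" using T2 by linarith
    have "x2 / \<nu> < s - T2" using T2(2) unfolding D_def by simp
    moreover have "(d2 - 2 * d1) * (x2 / \<nu>) < c' * T2"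
      using T2(1) c' unfolding D[symmetric] by (simp add: pos_divide_less_eq mult.commute)
    ultimately obtain T1 h1 where T1: "0 < T1" "T1 < s - T2" and h1: "0 < h1" "h1 \<le> hs"
      and ev1: "\<forall>\<^sub>F \<delta> in at_right 0. \<forall>x. \<bar>x - x2\<bar> < h1 \<longrightarrow> exp (- (c' * T2) / \<delta>) < u \<delta> T1 x"
      using arrival_at_interface[OF behind d x2 hs \<eta>(1) rate1 \<nu>_def] by blast
    define T3 where "T3 = s - T1 - T2"
    have T3: "0 < T3" using T1 unfolding T3_def by simp
    have ev2: "\<forall>\<^sub>F \<delta> in at_right 0. \<forall>ts>0. (\<forall>x. \<bar>x - x2\<bar> < h1 \<longrightarrow> \<eta> * exp (- (c' * T2) / \<delta>) < u \<delta> ts x) \<longrightarrow>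
        (\<forall>x. \<bar>x - x2\<bar> \<le> h1 / 4 \<longrightarrow> \<eta> * (1 - 1 / 2) < u \<delta> (ts + T2) x)"
      by (rule growth_in_place[OF T2pos h1(1) _ _ c'(1,3) \<eta>(1)]) (use rate2 h1 in auto)
    have ev3: "\<forall>\<^sub>F \<delta> in at_right 0. \<forall>ts>0. (\<forall>x. \<bar>x - x2\<bar> < h1 / 4 \<longrightarrow> (1 - e) * exp (- (\<kappa> / 2 * T3) / \<delta>) < u \<delta> ts x) \<longrightarrow>
        (\<forall>x. \<bar>x - x2\<bar> \<le> h1 / 4 / 4 \<longrightarrow> (1 - e) * (1 - e) < u \<delta> (ts + T3) x)"
      by (rule growth_in_place[where c = \<kappa>, OF T3 _ e(1,2)]) (use \<kappa> h1 e in auto)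
    have "\<forall>\<^sub>F \<delta> in at_right 0. exp (- (\<kappa> / 2 * T3) / \<delta>) < \<eta> / 2"
      using \<kappa>(1) T3 \<eta> by (intro eventually_exp_less) auto
    with ev1 ev2 ev3 show "\<forall>\<^sub>F \<delta> in at_right 0. a < u \<delta> s x2"
    proof eventually_elim
      case (elim \<delta>)
      have 1: "\<eta> * exp (- (c' * T2) / \<delta>) < u \<delta> T1 x" if "\<bar>x - x2\<bar> < h1" for x
      proof -
        have "\<eta> * exp (- (c' * T2) / \<delta>) \<le> 1 * exp (- (c' * T2) / \<delta>)" using \<eta> by (intro mult_right_mono) auto
        then show ?thesis using elim(1)[rule_format, OF that] by linarith
      qed
      have 2: "\<eta> * (1 - 1 / 2) < u \<delta> (T1 + T2) x" if "\<bar>x - x2\<bar> \<le> h1 / 4" for x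
        using elim(2) T1(1) 1 that by blast
      have 3: "(1 - e) * exp (- (\<kappa> / 2 * T3) / \<delta>) < u \<delta> (T1 + T2) x" if "\<bar>x - x2\<bar> < h1 / 4" for x
      proof -
        have "(1 - e) * exp (- (\<kappa> / 2 * T3) / \<delta>) \<le> 1 * exp (- (\<kappa> / 2 * T3) / \<delta>)" using e by (intro mult_right_mono) auto
        moreover have "\<eta> / 2 < u \<delta> (T1 + T2) x" using 2[of x] that by simp
        ultimately show ?thesis using elim(4) by linarith
      qed
      have "0 < T1 + T2" using T1 T2pos by simp
      moreover have "\<bar>x2 - x2\<bar> \<le> h1 / 4 / 4" using h1 by simp
      ultimately have "(1 - e) * (1 - e) < u \<delta> (T1 + T2 + T3) x2" using elim(3) 3 by blast
      then show ?case using ea unfolding T3_def by simp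
    qed
  qed
qed

end

section \<open>The tube and its wavefront\<close>

lemma initial_function_ahead:
  assumes "initial_function f" "0 < x" shows "f x = 0"
proof -
  have cl: "closure {x. f x > 0} = {..0}" and "0 \<le> f x"
    using assms unfolding initial_function_def by (auto simp: closure_lessThan lessThan_def[symmetric])
  show ?thesis
  proof (rule ccontr)
    assume "f x \<noteq> 0"
    then have "x \<in> {x. f x > 0}" using \<open>0 \<le> f x\<close> by simp
    then have "x \<in> closure {x. f x > 0}" by (rule subsetD[OF closure_subset])
    then show False using assms(2) unfolding cl by simp
  qed
qed

text \<open>
  The set where \<open>f\<close> is positive is dense in the left half-line, and \<open>f\<close> is continuous there except at
  finitely many points.
\<close>
lemma initial_function_behind:
  assumes init: "initial_function f" and y: "y < 0"
  shows "\<exists>z h \<kappa>. y < z - h \<and> z + h < 0 \<and> 0 < h \<and> 0 < \<kappa> \<and> (\<forall>x\<in>{z - h..z + h}. isCont f x \<and> \<kappa> < f x)"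
proof -
  have cl: "closure {x. f x > 0} = {..0}" and fin: "finite {x. \<not> isCont f x}"
    using init unfolding initial_function_def by (auto simp: closure_lessThan lessThan_def[symmetric])
  define P where "P = {y<..<0} - {x. \<not> isCont f x}"
  have "open P" unfolding P_def by (intro open_Diff finite_imp_closed fin) auto
  have "P \<noteq> {}"
  proof
    assume "P = {}"
    then have "{y<..<0} \<subseteq> {x. \<not> isCont f x}" unfolding P_def by blast
    then have "finite {y<..<0}" using fin finite_subset by blast
    then show False using y by (simp add: infinite_Ioo)
  qed
  then obtain w where "w \<in> P" by blast
  then have "w \<in> closure {x. f x > 0}" unfolding cl P_def by auto
  with \<open>w \<in> P\<close> \<open>open P\<close> have "P \<inter> {x. f x > 0} \<noteq> {}"
    using open_Int_closure_eq_empty[of P "{x. f x > 0}"] by blast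
  then obtain z where z: "z \<in> P" "f z > 0" by blast
  have "isCont f z" using z(1) unfolding P_def by blast
  then have "(f \<longlongrightarrow> f z) (nhds z)" unfolding isCont_def tendsto_at_iff_tendsto_nhds .
  then have "\<forall>\<^sub>F x in nhds z. f z / 2 < f x" by (rule order_tendstoD(1)) (use z(2) in simp)
  moreover have "\<forall>\<^sub>F x in nhds z. x \<in> P" using \<open>open P\<close> z(1) by (rule eventually_nhds_in_open)
  ultimately have "\<forall>\<^sub>F x in nhds z. f z / 2 < f x \<and> x \<in> P" by (rule eventually_conj)
  then obtain d where d: "d > 0" "\<And>x. dist x z < d \<Longrightarrow> f z / 2 < f x \<and> x \<in> P"
    unfolding eventually_nhds_metric by blast
  have near: "f z / 2 < f x \<and> x \<in> P" if "x \<in> {z - d / 2..z + d / 2}" for x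
    using that d(1) by (intro d(2)) (auto simp: dist_real_def abs_less_iff)
  have "y < z - d / 2" "z + d / 2 < 0" using near[of "z - d / 2"] near[of "z + d / 2"] d(1) unfolding P_def by auto
  moreover have "\<forall>x\<in>{z - d / 2..z + d / 2}. isCont f x \<and> f z / 2 < f x" using near unfolding P_def by blast
  ultimately show ?thesis using d(1) z(2) half_gt_zero by blast
qed

lemma cauchy_solutions_kpp_family:
  fixes Q :: "real \<Rightarrow> (real ^ 'm) set"
  assumes tube: "smooth_tube \<alpha> Q"
    and sol: "\<And>\<delta>. 0 < \<delta> \<Longrightarrow> cauchy_solution \<delta> (cross_volume Q) g f (u \<delta>)"
  shows "kpp_family u f (\<lambda>x. deriv (cross_volume Q) x / cross_volume Q x) g (max 1 (SUP z. f z))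
    (\<lambda>\<delta> t x. deriv (\<lambda>s. u \<delta> s x) t) (\<lambda>\<delta> t. deriv (u \<delta> t)) (\<lambda>\<delta> t. deriv (deriv (u \<delta> t)))"
proof
  show "1 \<le> max 1 (SUP z. f z)" by simp
  show "\<exists>\<beta>. \<forall>x\<in>{- R..R}. \<bar>deriv (cross_volume Q) x / cross_volume Q x\<bar> \<le> \<beta>" for R
    using tube_log_derivative_locally_bounded[OF tube] .
  fix \<delta> :: real assume \<delta>: "0 < \<delta>"
  note s = sol[OF \<delta>, unfolded cauchy_solution_def]
  show "0 \<le> u \<delta> t x \<and> u \<delta> t x \<le> max 1 (SUP z. f z)" if "0 \<le> t" for t x using s that by blast
  show "((\<lambda>(t, z). u \<delta> t z) \<longlongrightarrow> f x) (at (0, x) within {0<..} \<times> UNIV)" if "isCont f x" for x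
    using s that by blast
  show "continuous_on ({0<..} \<times> UNIV) (\<lambda>(t, x). u \<delta> t x)" using s by blast
  fix t x :: real assume t: "0 < t"
  have diff: "(\<lambda>s. u \<delta> s x) differentiable (at t)" "u \<delta> t differentiable (at x)" "deriv (u \<delta> t) differentiable (at x)"
    using s t by blast+
  show "((\<lambda>s. u \<delta> s x) has_real_derivative deriv (\<lambda>s. u \<delta> s x) t) (at t)"
    "(u \<delta> t has_real_derivative deriv (u \<delta> t) x) (at x)"
    "(deriv (u \<delta> t) has_real_derivative deriv (deriv (u \<delta> t)) x) (at x)"
    using diff by (simp_all add: real_differentiable_def field_differentiable_def DERIV_deriv_iff_field_differentiable)
  show "deriv (\<lambda>s. u \<delta> s x) t = \<delta> / 2 * deriv (deriv (u \<delta> t)) x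
      + \<delta> / 2 * (deriv (cross_volume Q) x / cross_volume Q x) * deriv (u \<delta> t) x + 1 / \<delta> * g x (u \<delta> t x) * u \<delta> t x"
    using s t by blast
qed

text \<open>
  The factor \<open>S / V\<close> is recovered from \<open>cbar\<close> as \<open>2 cbar x / c x 0 0\<close>. Its sign and its continuity
  follow in this way from the properties of \<open>cbar\<close> and \<open>c\<close>, although \<open>S\<close> is a Hausdorff measure.
\<close>
lemma reaction_rate:
  fixes Q :: "real \<Rightarrow> (real ^ 'm) set"
  assumes tube: "smooth_tube \<alpha> Q" and kpp: "kpp_coefficient Q c"
    and smooth: "smooth (cbar Q c)" and pos: "\<And>x. 0 < cbar Q c x"
  shows "continuous_on UNIV (cbar Q c)"
    and "continuous_on (UNIV \<times> {0..}) (\<lambda>(x, v). cbar2 Q c x v)"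
    and "\<And>x v. 0 \<le> v \<Longrightarrow> cbar2 Q c x v \<le> cbar Q c x"
    and "\<And>x v. 0 \<le> v \<Longrightarrow> v < 1 \<Longrightarrow> 0 < cbar2 Q c x v"
    and "\<And>x v. 1 < v \<Longrightarrow> cbar2 Q c x v < 0"
proof -
  have axis: "(x, 0) \<in> closure (tube Q)" for x
  proof -
    have "(x, 0) \<in> tube Q" using tube unfolding smooth_tube_def tube_def by simp
    then show ?thesis by (rule subsetD[OF closure_subset])
  qed
  have k: "\<And>x v. 0 \<le> v \<Longrightarrow> v < 1 \<Longrightarrow> 0 < c x 0 v" "\<And>x v. 1 < v \<Longrightarrow> c x 0 v < 0"
    "\<And>x v. v \<in> {0..1} \<Longrightarrow> c x 0 v \<le> c x 0 0"
    and contx: "\<And>v. 0 \<le> v \<Longrightarrow> continuous_on (closure (tube Q)) (\<lambda>(x, y). c x y v)"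
    using kpp unfolding kpp_coefficient_def by blast+
  have "\<exists>L. \<forall>(x, y) \<in> closure (tube Q). L-lipschitz_on {0..} (c x y)"
    using kpp unfolding kpp_coefficient_def by (elim conjE)
  then obtain L where L: "\<And>x y. (x, y) \<in> closure (tube Q) \<Longrightarrow> L-lipschitz_on {0..} (c x y)"
    by auto
  show cont: "continuous_on UNIV (cbar Q c)"
  proof (rule differentiable_imp_continuous_on)
    have "(deriv ^^ 0) (cbar Q c) differentiable (at x)" for x using smooth unfolding smooth_def by blast
    then show "cbar Q c differentiable_on UNIV" by (simp add: differentiable_on_def)
  qed
  define r where "r x = 1 / 2 * (cross_surface Q x / cross_volume Q x)" for x
  have g: "cbar2 Q c x v = r x * c x 0 v" for x v unfolding cbar2_def r_def by simp
  have c0: "0 < c x 0 0" for x using k(1) by simp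
  have r_eq: "r x = cbar Q c x / c x 0 0" for x unfolding cbar_def g using c0[of x] by simp
  have r: "0 < r x" for x unfolding r_eq using pos c0 by simp
  have cont_axis: "continuous_on UNIV (\<lambda>x. c x 0 v)" if "0 \<le> v" for v
  proof -
    have "continuous_on UNIV (\<lambda>x. (\<lambda>(x, y). c x y v) (x, 0))"
      by (rule continuous_on_compose2[OF contx[OF that]]) (auto intro!: continuous_intros axis)
    then show ?thesis by simp
  qed
  have "continuous_on (UNIV \<times> {0..}) (\<lambda>(x, v). c x 0 v)"
  proof (rule continuous_on_TimesI)
    show "local_lipschitz UNIV {0..} (\<lambda>x. c x 0)"
    proof (rule local_lipschitzI)
      fix x and v :: real
      have "\<forall>t\<in>cball x 1 \<inter> UNIV. L-lipschitz_on (cball v 1 \<inter> {0..}) (c t 0)"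
        using L[OF axis] by (auto intro: lipschitz_on_subset)
      then show "\<exists>u>0. \<exists>L. \<forall>t\<in>cball x u \<inter> UNIV. L-lipschitz_on (cball v u \<inter> {0..}) (c t 0)"
        using zero_less_one by blast
    qed
  qed (use cont_axis in auto)
  moreover have "continuous_on UNIV r"
    unfolding r_eq using c0 by (intro continuous_intros cont cont_axis) (auto simp: less_imp_neq[symmetric])
  then have "continuous_on (UNIV \<times> {0::real..}) (\<lambda>p. r (fst p))"
    by (rule continuous_on_compose2) (auto intro: continuous_intros)
  ultimately have "continuous_on (UNIV \<times> {0..}) (\<lambda>p. r (fst p) * (\<lambda>(x, v). c x 0 v) p)"
    by (rule continuous_on_mult[rotated])
  then show "continuous_on (UNIV \<times> {0..}) (\<lambda>(x, v). cbar2 Q c x v)"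
    unfolding g by (simp add: case_prod_unfold)
  show "cbar2 Q c x v \<le> cbar Q c x" if "0 \<le> v" for x v
  proof -
    have "c x 0 v \<le> c x 0 0"
      using k(3)[of v x] k(2)[of v x] c0[of x] that by (cases "v \<le> 1") auto
    then show ?thesis unfolding cbar_def g using r[of x] by (intro mult_left_mono) auto
  qed
  show "0 < cbar2 Q c x v" if "0 \<le> v" "v < 1" for x v
    unfolding g using r k(1) that by simp
  show "cbar2 Q c x v < 0" if "1 < v" for x v
    unfolding g using r k(2) that by (simp add: mult_pos_neg)
qed

theorem theorem4p1p5:
  fixes Q :: "real \<Rightarrow> (real ^ 'm) set"
    and c :: "real \<Rightarrow> real ^ 'm \<Rightarrow> real \<Rightarrow> real"
    and f :: "real \<Rightarrow> real"
    and u :: "real \<Rightarrow> real \<Rightarrow> real \<Rightarrow> real"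
    and \<alpha> d1 d2 x2 A a t0 t1 x1 :: real
    and d :: "real \<Rightarrow> real"
  assumes "0 < \<alpha>" "\<alpha> < 1" "smooth_tube \<alpha> Q"
    and "kpp_coefficient Q c"
    and "initial_function f"
    and "\<And>\<delta>. 0 < \<delta> \<Longrightarrow> cauchy_solution \<delta> (cross_volume Q) (cbar2 Q c) f (u \<delta>)"
    and "d1 > 0" "d2 > 0" "d2 > 2 * d1" "d2 > 2 * sqrt (d1 * (d2 - d1))" "x2 > 0"
    and "\<And>x. d x = (if x < x2 then d1 else d2)"
    and "a > 1" "A > 1"
    and "a * sqrt A < 1 / 2 * (1 + d2 / (2 * sqrt (d1 * (d2 - d1))))"
    and "t0 = x2 * (sqrt (2 * (d2 - d1)) / d2)"
    and "t1 = 1 / (2 * sqrt (2 * d1)) * (x2 + sqrt (2 * d1) * t0)"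
    and "x1 = sqrt (2 * d1) * t1"
    and "smooth (cbar Q c)" "mono (cbar Q c)"
    and "\<And>x. d x < cbar Q c x \<and> cbar Q c x < A * d (a * x)"
  shows "wavefront_has_jump u \<and>
    (\<forall>\<^sub>F \<rho> in at_right 0. \<exists>s>0. \<exists>x > x1 / a + \<rho>.
       excited u s x \<and> (\<forall>t. 0 < t \<and> t \<le> s \<longrightarrow> non_excited u t (x1 / a)))"
proof -
  note tube = assms(3) and kpp = assms(4) and init = assms(5) and sol = assms(6)
    and d_def = assms(12) and between = assms(21)
  have d: "0 < d1" "0 < d2" "2 * d1 < d2" "2 * sqrt (d1 * (d2 - d1)) < d2" and x2: "0 < x2"
    and a: "1 < a" and A: "1 < A" by fact+
  define B where "B = max 1 (SUP z. f z)"
  define g where "g = cbar2 Q c"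
  define C where "C = cbar Q c"
  interpret kpp_family u f "\<lambda>x. deriv (cross_volume Q) x / cross_volume Q x" g B
    "\<lambda>\<delta> t x. deriv (\<lambda>s. u \<delta> s x) t" "\<lambda>\<delta> t. deriv (u \<delta> t)" "\<lambda>\<delta> t. deriv (deriv (u \<delta> t))"
    unfolding B_def g_def by (rule cauchy_solutions_kpp_family[OF tube sol])
  have lower: "d x < C x" and upper: "C x < A * d (a * x)" for x using between unfolding C_def by auto
  have d_le: "d1 \<le> d x" "d x \<le> d2" for x unfolding d_def using d by auto
  have Cpos: "0 < cbar Q c x" for x using lower[of x] d_le(1)[of x] d(1) unfolding C_def by linarith
  note rr = reaction_rate[OF tube kpp assms(19) Cpos, folded g_def C_def]
  have g0: "g x 0 = C x" for x unfolding g_def C_def cbar_def ..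
  have g_compact: "continuous_on ({l..r} \<times> {v..w}) (\<lambda>(x, v). g x v)" if "0 \<le> v" for l r v w
    by (rule continuous_on_subset[OF rr(2)]) (use that in auto)

  define p where "p = sqrt (2 * d1)"
  define n where "n = sqrt (2 * (d2 - d1))"
  define k where "k = sqrt A"
  have p: "0 < p" and n: "0 < n" and k: "0 < k" using d A unfolding p_def n_def k_def by auto
  have kk: "A = k * k" using A unfolding k_def by simp
  have pn: "p * n = 2 * sqrt (d1 * (d2 - d1))"
  proof -
    have "p * n = sqrt (4 * (d1 * (d2 - d1)))" unfolding p_def n_def by (simp flip: real_sqrt_mult add: mult_ac)
    then show ?thesis by (simp add: real_sqrt_mult)
  qed
  have t0: "t0 = x2 * n / d2" using assms(16) unfolding n_def by simp
  have t0pos: "0 < t0" unfolding t0 using x2 n d by simp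
  have x1: "2 * x1 = x2 + p * t0" using assms(17,18) p unfolding p_def[symmetric] by simp
  have "p * t0 = x2 * (p * n / d2)" unfolding t0 by simp
  also have "\<dots> < x2 * 1" using x2 d(2,4) unfolding pn by (intro mult_strict_left_mono) auto
  finally have pt0: "p * t0 < x2" by simp
  \<comment> \<open>This is \<open>t0 < t1 / (a sqrt A)\<close>: up to the time \<open>t0\<close> neither of the two fronts has reached \<open>x1 / a\<close>.\<close>
  have key: "a * (k * (p * t0)) < x1"
  proof -
    have "a * k < 1 / 2 * (1 + d2 / (p * n))" using assms(15) unfolding k_def pn .
    then have "a * k * (p * t0) < 1 / 2 * (1 + d2 / (p * n)) * (p * t0)"
      using p t0pos by (intro mult_strict_right_mono) auto
    also have "\<dots> = 1 / 2 * (p * t0 + x2)" unfolding t0 using p n d by (simp add: field_simps)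
    finally show ?thesis using x1 by (simp add: mult.assoc)
  qed
  have "0 < p * t0" using p t0pos by simp
  then have x1pos: "0 < x1" using x1 x2 by linarith
  have x1x2: "x1 < x2" using x1 pt0 by linarith
  have "x1 / a < x1 / 1" using a x1pos by (intro divide_strict_left_mono) auto
  then have ahead: "x1 / a < x2" using x1x2 by simp

  have excited: "excited u t0 x2"
    unfolding excited_def
  proof -
    \<comment> \<open>As \<open>cbar\<close> is continuous, a rate larger than \<open>d2\<close> is available on both sides of \<open>x2\<close>, although
      \<open>d\<close> is only \<open>d1\<close> to the left.\<close>
    define \<epsilon> where "\<epsilon> = (C x2 - d2) / 3"
    have \<epsilon>: "0 < \<epsilon>" "d2 + 2 * \<epsilon> < C x2" using lower[of x2] unfolding \<epsilon>_def d_def by (auto simp: field_simps)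
    have "isCont C x2" using rr(1) by (simp add: continuous_on_eq_continuous_at)
    then have "(C \<longlongrightarrow> C x2) (nhds x2)" unfolding isCont_def tendsto_at_iff_tendsto_nhds .
    then have "\<forall>\<^sub>F x in nhds x2. d2 + 2 * \<epsilon> < C x" using \<epsilon>(2) by (rule order_tendstoD(1))
    then obtain hs where hs: "0 < hs" "\<And>x. \<bar>x - x2\<bar> < hs \<Longrightarrow> d2 + 2 * \<epsilon> < C x"
      unfolding eventually_nhds_metric dist_real_def by blast
    have "\<exists>x\<in>{- 1..x2 + hs}. \<forall>y\<in>{- 1..x2 + hs}. C x \<le> C y"
      by (rule continuous_attains_inf[OF compact_Icc _ continuous_on_subset[OF rr(1)]]) (use hs x2 in auto)
    then obtain xm where xm: "\<And>y. y \<in> {- 1..x2 + hs} \<Longrightarrow> C xm \<le> C y" by blast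
    define \<mu> where "\<mu> = min \<epsilon> (C xm - d1)"
    have \<mu>: "0 < \<mu>" "\<mu> \<le> \<epsilon>" "\<mu> \<le> C xm - d1" using \<epsilon> lower[of xm] d_le(1)[of xm] unfolding \<mu>_def by auto
    have "uniformly_continuous_on ({- 1 - x2 - hs..x2 + hs} \<times> {0..1}) (\<lambda>(x, v). g x v)"
      by (rule compact_uniformly_continuous[OF g_compact]) (auto intro: compact_Times)
    then obtain \<eta>0 where \<eta>0: "0 < \<eta>0" "\<And>p q. p \<in> {- 1 - x2 - hs..x2 + hs} \<times> {0..1} \<Longrightarrow>
        q \<in> {- 1 - x2 - hs..x2 + hs} \<times> {0..1} \<Longrightarrow> dist q p < \<eta>0 \<Longrightarrow>
        dist ((\<lambda>(x, v). g x v) q) ((\<lambda>(x, v). g x v) p) < \<mu>"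
      using \<mu>(1) unfolding uniformly_continuous_on_def by blast
    define \<eta> where "\<eta> = min (1 / 2) (\<eta>0 / 2)"
    have \<eta>: "0 < \<eta>" "\<eta> < 1" "\<eta> < \<eta>0" using \<eta>0(1) unfolding \<eta>_def by auto
    have small: "C x - \<mu> \<le> g x v" if "- 1 - x2 - hs \<le> x" "x \<le> x2 + hs" "0 \<le> v" "v \<le> \<eta>" for x v
    proof -
      have "dist ((\<lambda>(x, v). g x v) (x, v)) ((\<lambda>(x, v). g x v) (x, 0)) < \<mu>"
        using that \<eta> by (intro \<eta>0(2)) (auto simp: dist_prod_def)
      then show ?thesis unfolding g0[symmetric] by (simp add: dist_real_def abs_less_iff)
    qed
    show "((\<lambda>\<delta>. u \<delta> t0 x2) \<longlongrightarrow> 1) (at_right 0)"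
    proof (rule excited_at_interface[OF initial_function_behind[OF init] d(1,3) x2 hs(1) \<eta>(1,2) \<epsilon>(1) _ _ _ _ assms(16)])
      fix x v assume xv: "- 1 < x" "x < x2 + hs" "0 \<le> v" "v \<le> \<eta>"
      have "C xm \<le> C x" using xv by (intro xm) auto
      moreover have "C x - \<mu> \<le> g x v" using xv x2 hs by (intro small) auto
      ultimately show "d1 \<le> g x v" using \<mu> by linarith
    next
      fix x v assume xv: "\<bar>x - x2\<bar> < hs" "0 \<le> v" "v \<le> \<eta>"
      have "C x - \<mu> \<le> g x v" using xv x2 by (intro small) (auto simp: abs_less_iff)
      then show "d2 + \<epsilon> \<le> g x v" using hs(2)[OF xv(1)] \<mu> by linarith
    next
      fix e :: real assume e: "0 < e" "e < 1"
      define K where "K = {x2 - hs..x2 + hs} \<times> {0..1 - e}"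
      have "\<exists>q\<in>K. \<forall>r\<in>K. (\<lambda>(x, v). g x v) q \<le> (\<lambda>(x, v). g x v) r"
        unfolding K_def by (rule continuous_attains_inf[OF _ _ g_compact]) (use hs e in \<open>auto intro: compact_Times\<close>)
      then obtain x0 v0 where q: "(x0, v0) \<in> K" "\<And>x v. (x, v) \<in> K \<Longrightarrow> g x0 v0 \<le> g x v" by force
      have "0 < g x0 v0" using q(1) e unfolding K_def by (intro rr(4)) auto
      moreover have "g x0 v0 \<le> g x v" if "\<bar>x - x2\<bar> < hs" "0 \<le> v" "v \<le> 1 - e" for x v
        using that by (intro q(2)) (auto simp: K_def abs_less_iff)
      ultimately show "\<exists>\<kappa>>0. \<forall>x v. \<bar>x - x2\<bar> < hs \<longrightarrow> 0 \<le> v \<longrightarrow> v \<le> 1 - e \<longrightarrow> \<kappa> \<le> g x v" by blast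
    next
      fix e :: real assume e: "0 < e"
      define K where "K = {x2 - hs..x2 + hs} \<times> {1 + e..max B (1 + e)}"
      have "\<exists>q\<in>K. \<forall>r\<in>K. (\<lambda>(x, v). g x v) r \<le> (\<lambda>(x, v). g x v) q"
        unfolding K_def by (rule continuous_attains_sup[OF _ _ g_compact]) (use hs e in \<open>auto intro: compact_Times\<close>)
      then obtain x0 v0 where q: "(x0, v0) \<in> K" "\<And>x v. (x, v) \<in> K \<Longrightarrow> g x v \<le> g x0 v0" by force
      have "g x0 v0 < 0" using q(1) e unfolding K_def by (intro rr(5)) auto
      moreover have "g x v \<le> - (- g x0 v0)" if "\<bar>x - x2\<bar> < hs" "1 + e \<le> v" "v \<le> B" for x v
        using that q(2)[of x v] by (auto simp: K_def abs_less_iff)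
      ultimately show "\<exists>\<kappa>>0. \<forall>x v. \<bar>x - x2\<bar> < hs \<longrightarrow> 1 + e \<le> v \<longrightarrow> v \<le> B \<longrightarrow> g x v \<le> - \<kappa>"
        by (meson neg_0_less_iff_less)
    qed
  qed

  have calm: "non_excited u t (x1 / a)" if t: "0 < t" "t \<le> t0" for t
    unfolding non_excited_def
  proof (rule not_excited_before_the_fronts_meet[where ?c1.0 = "A * d1" and ?c2.0 = "A * d2" and X = "x2 / a" and s = t0])
    have speed1: "sqrt (2 * (A * d1)) = k * p" unfolding k_def p_def by (simp flip: real_sqrt_mult add: mult_ac)
    have speed2: "sqrt (2 * (A * d2 - A * d1)) = k * n"
      unfolding k_def n_def by (simp flip: real_sqrt_mult add: algebra_simps)
    have kpt: "k * (p * t0) < x1 / a" using key a by (simp add: pos_less_divide_eq mult.commute)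
    show "sqrt (2 * (A * d1)) * t0 < x1 / a" unfolding speed1 using kpt by (simp add: mult.assoc)
    have "k * p * (t0 - k * n * (x2 / a) / (A * d2)) = k * (p * t0) - p * t0 / a"
      unfolding t0 kk using k d a by (simp add: field_simps)
    also have "\<dots> < x1 / a - p * t0 / a" using kpt by simp
    also have "\<dots> = x2 / a - x1 / a" using x1 by (simp flip: diff_divide_distrib)
    finally show "sqrt (2 * (A * d1)) * (t0 - sqrt (2 * (A * d2 - A * d1)) * (x2 / a) / (A * d2)) < x2 / a - x1 / a"
      unfolding speed1 speed2 .
    show "2 * (A * d1) \<le> A * d2" using d A by simp
    show "x1 / a < x2 / a" using x1x2 a by (simp add: divide_strict_right_mono)
    fix x v :: real assume v: "0 \<le> v"
    show "g x v \<le> A * d1" if "0 < x" "x < x2 / a"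
    proof -
      have "a * x < x2" using that a by (simp add: pos_less_divide_eq mult.commute)
      then show ?thesis using rr(3)[OF v, of x] upper[of x] unfolding d_def by simp
    qed
    have "A * d (a * x) \<le> A * d2" using d_le(2) A by simp
    then show "g x v \<le> A * d2" using rr(3)[OF v, of x] upper[of x] by linarith
  qed (use initial_function_ahead[OF init] d A a x1pos t0pos t in auto)

  have "wavefront_has_jump u"
    unfolding wavefront_has_jump_def using t0pos ahead excited calm by blast
  moreover have "\<forall>\<^sub>F \<rho> in at_right 0. \<rho> * 1 < x2 - x1 / a" using ahead by (intro eventually_mult_less) simp
  then have "\<forall>\<^sub>F \<rho> in at_right 0. \<exists>s>0. \<exists>x > x1 / a + \<rho>.
       excited u s x \<and> (\<forall>t. 0 < t \<and> t \<le> s \<longrightarrow> non_excited u t (x1 / a))"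
  proof eventually_elim
    case (elim \<rho>)
    then have "x1 / a + \<rho> < x2" by simp
    then show ?case using t0pos excited calm by blast
  qed
  ultimately show ?thesis ..
qed

end
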